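(* Let $E$ be a directed graph and $K$ a field, and assume that the Leavitt path algebra $L_K(E)$ is non-commutative. Then every Lie ideal of $L_K(E)$ is an ideal of $L_K(E)$ if and only if $\operatorname{char}(K)=p>0$ and $E$ satisfies one of the following conditions: (1) $E$ is a $p$-commutator graph. (2) $E$ is a disjoint union of a $p$-commutator graph $F$ and an isolated vertex $v$. In this case, $L_K(E)=Kv\oplus L_K(F)$. (3) $E^0=H\sqcup\{v\}$, where $H$ is a non-empty hereditary and saturated subset of $E^0$ such that the porcupine graph $P_H$ is a $p$-commutator graph, and $v$ is the unique infinite emitter of $E$ and is a source in $E$. In this case, $L_K(E)=Kv+I(H)$, where $I(H)$ is the ideal of $L_K(E)$ generated by $H$. In particular, in this situation (i.e. whenever every Lie ideal of $L_K(E)$ is an ideal) the graph $E$ is acyclic.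
   Context: A directed graph $E=(E^0,E^1,r,s)$ consists of sets $E^0$ (vertices), $E^1$ (edges), of arbitrary cardinality, and maps $r,s:E^1\to E^0$ (range, source). A vertex $v$ is a sink if $s^{-1}(v)=\varnothing$, a source if $r^{-1}(v)=\varnothing$, an infinite emitter if $s^{-1}(v)$ is infinite, isolated if $r^{-1}(v)=s^{-1}(v)=\varnothing$, and regular if it is neither a sink nor an infinite emitter; $\mathrm{Reg}(E)$ is the set of regular vertices. A path of length $n\ge 1$ is a sequence $\mu=e_1\cdots e_n$ of edges with $r(e_i)=s(e_{i+1})$, $s(\mu)=s(e_1)$, $r(\mu)=r(e_n)$; vertices are regarded as paths of length $0$. $\mathrm{Path}(E)$ is the set of finite paths. $E$ is acyclic if there is no path of length $\ge1$ with $s(\mu)=r(\mu)$. The Leavitt path algebra $L_K(E)$ is the associative (not necessarily unital) $K$-algebra generated by $E^0\cup E^1\cup\{e^*: e\in E^1\}$ subject to: $vv'=\delta_{v,v'}v$ for $v,v'\in E^0$; $s(e)e=er(e)=e$ and $r(e)e^*=e^*s(e)=e^*$ for $e\in E^1$; $e^*f=\delta_{e,f}r(e)$ for $e,f\in E^1$; $v=\sum_{s(e)=v}ee^*$ for $v\in\mathrm{Reg}(E)$. "Ideal" means two-sided ring-theoretic ideal. A Lie ideal of a $K$-algebra $A$ is a $K$-subspace $U$ with $[U,A]\subseteq U$, where $[a,b]=ab-ba$. A subset $H\subseteq E^0$ is hereditary if whenever $u\in H$ and there is a path from $u$ to $v$ then $v\in H$; it is saturated if for every regular vertex $v$, $r(s^{-1}(v))\subseteq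 H$ implies $v\in H$. For $u,v\in E^0$, $d(u,v)$ is the length of a shortest path from $u$ to $v$ (so $d(u,u)=0$), and $d(u,v)=\infty$ if there is none. For $m\in\mathbb N=\{0,1,2,\dots\}$, $D(u,m)=\{v\in E^0: d(u,v)\le m\}$. For a prime $p$, $E$ is a $p$-commutator graph if: (i) $E$ is acyclic; (ii) every vertex of $E$ is regular; (iii) for each $u\in E^0$ there is $m\in\mathbb N$ such that for all $w\in E^0$ with $d(u,w)=m+1$, the number of paths $q=e_1\cdots e_k\in\mathrm{Path}(E)$ with $s(q)=u$, $r(q)=w$ and $s(e_2),\dots,s(e_k)\in D(u,m)$ is a multiple of $p$. Porcupine graph: in the situation of (3) (where $E^0=H\sqcup\{v\}$, $H$ is hereditary and saturated, and $v$ is a source), the porcupine graph $P_H$ (of the admissible pair $(H,\varnothing)$) has vertex set $H\cup\{w^e: e\in s^{-1}(v)\}$ and edge set $\{e\in E^1: s(e)\in H\}\cup\{f^e: e\in s^{-1}(v)\}$, where $w^e$ and $f^e$ are new distinct symbols; the range and source maps agree with those of $E$ on edges $e$ with $s(e)\in H$, and $f^e$ has source $w^e$ and range $r(e)$. *)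

theory Defs
  imports
    "Graph_Theory.Arc_Walk"
    "HOL-Library.Poly_Mapping"
    "HOL-Library.Extended_Nat"
    "HOL-Computational_Algebra.Computational_Algebra"
begin

section \<open>Directed graphs\<close>

text \<open>
  A directed graph is a \<^const>\<open>wf_digraph\<close>: \<^const>\<open>tail\<close> is the source map, \<^const>\<open>head\<close> the
  range map, and parallel arcs, loops and infinite vertex or arc sets are allowed.
  A path from \<open>u\<close> to \<open>w\<close> is a list \<open>q\<close> of arcs with \<open>pre_digraph.awalk E u q w\<close>; the
  empty list represents the path of length 0 at \<open>u = w\<close>.
\<close>

definition sink_vertex :: "('v, 'e) pre_digraph \<Rightarrow> 'v \<Rightarrow> bool" where
  "sink_vertex E v \<longleftrightarrow> v \<in> verts E \<and> out_arcs E v = {}"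

definition source_vertex :: "('v, 'e) pre_digraph \<Rightarrow> 'v \<Rightarrow> bool" where
  "source_vertex E v \<longleftrightarrow> v \<in> verts E \<and> in_arcs E v = {}"

definition infinite_emitter :: "('v, 'e) pre_digraph \<Rightarrow> 'v \<Rightarrow> bool" where
  "infinite_emitter E v \<longleftrightarrow> v \<in> verts E \<and> infinite (out_arcs E v)"

definition isolated_vertex :: "('v, 'e) pre_digraph \<Rightarrow> 'v \<Rightarrow> bool" where
  "isolated_vertex E v \<longleftrightarrow> v \<in> verts E \<and> in_arcs E v = {} \<and> out_arcs E v = {}"

definition regular_vertex :: "('v, 'e) pre_digraph \<Rightarrow> 'v \<Rightarrow> bool" where
  "regular_vertex E v \<longleftrightarrow> v \<in> verts E \<and> \<not> sink_vertex E v \<and> \<not> infinite_emitter E v"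

definition acyclic_digraph :: "('v, 'e) pre_digraph \<Rightarrow> bool" where
  "acyclic_digraph E \<longleftrightarrow> \<not> (\<exists>u q. pre_digraph.awalk E u q u \<and> length q \<ge> 1)"

definition hereditary :: "('v, 'e) pre_digraph \<Rightarrow> 'v set \<Rightarrow> bool" where
  "hereditary E H \<longleftrightarrow> H \<subseteq> verts E \<and>
     (\<forall>u\<in>H. \<forall>v q. pre_digraph.awalk E u q v \<longrightarrow> v \<in> H)"

definition saturated :: "('v, 'e) pre_digraph \<Rightarrow> 'v set \<Rightarrow> bool" where
  "saturated E H \<longleftrightarrow> H \<subseteq> verts E \<and>
     (\<forall>v. regular_vertex E v \<and> head E ` out_arcs E v \<subseteq> H \<longrightarrow> v \<in> H)"

text \<open>The infimum of the empty set is \<open>\<infinity>\<close>.\<close>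

definition path_dist :: "('v, 'e) pre_digraph \<Rightarrow> 'v \<Rightarrow> 'v \<Rightarrow> enat" where
  "path_dist E u v = (INF q \<in> {q. pre_digraph.awalk E u q v}. enat (length q))"

definition dist_ball :: "('v, 'e) pre_digraph \<Rightarrow> 'v \<Rightarrow> nat \<Rightarrow> 'v set" where
  "dist_ball E u m = {v \<in> verts E. path_dist E u v \<le> enat m}"

text \<open>
  In the last clause the condition on \<open>e\<^sub>2, \<dots>, e\<^sub>k\<close> is the condition on the arcs of \<open>tl q\<close>
  (note that \<open>q \<noteq> []\<close> as \<open>u \<noteq> w\<close>). The first two clauses ensure that the set whose
  cardinality is taken is finite, so the convention \<open>card A = 0\<close> for infinite \<open>A\<close> plays
  no role.
\<close>

definition p_commutator_graph :: "nat \<Rightarrow> ('v, 'e) pre_digraph \<Rightarrow> bool" where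
  "p_commutator_graph p E \<longleftrightarrow> wf_digraph E \<and>
     acyclic_digraph E \<and>
     (\<forall>v\<in>verts E. regular_vertex E v) \<and>
     (\<forall>u\<in>verts E. \<exists>m. \<forall>w\<in>verts E. path_dist E u w = enat (m + 1) \<longrightarrow>
        p dvd card {q. pre_digraph.awalk E u q w \<and> (\<forall>e\<in>set (tl q). tail E e \<in> dist_ball E u m)})"

text \<open>
  \<open>E\<close> is the disjoint union of \<open>F\<close> and the graph with the single vertex \<open>v\<close> and no arcs.
\<close>

definition disjoint_union_isolated ::
    "('v, 'e) pre_digraph \<Rightarrow> ('v, 'e) pre_digraph \<Rightarrow> 'v \<Rightarrow> bool" where
  "disjoint_union_isolated E F v \<longleftrightarrow> wf_digraph F \<and> v \<notin> verts F \<and>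
     verts E = verts F \<union> {v} \<and> arcs E = arcs F \<and>
     (\<forall>e\<in>arcs F. tail E e = tail F e \<and> head E e = head F e) \<and>
     isolated_vertex E v"

text \<open>
  The symbols \<open>w\<^sup>e\<close> and \<open>f\<^sup>e\<close> are both encoded as \<open>Inr e\<close>; the vertices in \<open>H\<close> and the arcs
  with source in \<open>H\<close> are embedded by \<^const>\<open>Inl\<close>.
\<close>

definition porcupine ::
    "('v, 'e) pre_digraph \<Rightarrow> 'v set \<Rightarrow> 'v \<Rightarrow> ('v + 'e, 'e + 'e) pre_digraph" where
  "porcupine E H v =
     \<lparr> verts = Inl ` H \<union> Inr ` out_arcs E v,
       arcs = Inl ` {e \<in> arcs E. tail E e \<in> H} \<union> Inr ` out_arcs E v,
       tail = (\<lambda>x. case x of Inl e \<Rightarrow> Inl (tail E e) | Inr e \<Rightarrow> Inr e),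
       head = (\<lambda>x. case x of Inl e \<Rightarrow> Inl (head E e) | Inr e \<Rightarrow> Inl (head E e)) \<rparr>"


section \<open>Associative algebras, not necessarily unital\<close>

text \<open>
  HOL-Algebra's rings have a unit, so they cannot be used for algebras of graphs with
  infinitely many vertices. The scalars form a type.
\<close>

record ('k, 'a) kalg =
  kcarrier :: "'a set"
  kzero :: 'a
  kadd :: "'a \<Rightarrow> 'a \<Rightarrow> 'a"
  kdiff :: "'a \<Rightarrow> 'a \<Rightarrow> 'a"
  kmult :: "'a \<Rightarrow> 'a \<Rightarrow> 'a"
  kscale :: "'k \<Rightarrow> 'a \<Rightarrow> 'a"

locale kalgebra =
  fixes A :: "('k::field, 'a) kalg"
  assumes zero_closed: "kzero A \<in> kcarrier A"
    and add_closed: "\<lbrakk>x \<in> kcarrier A; y \<in> kcarrier A\<rbrakk> \<Longrightarrow> kadd A x y \<in> kcarrier A"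
    and diff_closed: "\<lbrakk>x \<in> kcarrier A; y \<in> kcarrier A\<rbrakk> \<Longrightarrow> kdiff A x y \<in> kcarrier A"
    and mult_closed: "\<lbrakk>x \<in> kcarrier A; y \<in> kcarrier A\<rbrakk> \<Longrightarrow> kmult A x y \<in> kcarrier A"
    and scale_closed: "x \<in> kcarrier A \<Longrightarrow> kscale A c x \<in> kcarrier A"
    and add_assoc: "\<lbrakk>x \<in> kcarrier A; y \<in> kcarrier A; z \<in> kcarrier A\<rbrakk> \<Longrightarrow>
      kadd A (kadd A x y) z = kadd A x (kadd A y z)"
    and add_commute: "\<lbrakk>x \<in> kcarrier A; y \<in> kcarrier A\<rbrakk> \<Longrightarrow> kadd A x y = kadd A y x"
    and add_zero: "x \<in> kcarrier A \<Longrightarrow> kadd A x (kzero A) = x"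
    and diff_add: "\<lbrakk>x \<in> kcarrier A; y \<in> kcarrier A\<rbrakk> \<Longrightarrow> kadd A (kdiff A x y) y = x"
    and mult_assoc: "\<lbrakk>x \<in> kcarrier A; y \<in> kcarrier A; z \<in> kcarrier A\<rbrakk> \<Longrightarrow>
      kmult A (kmult A x y) z = kmult A x (kmult A y z)"
    and distrib_left: "\<lbrakk>x \<in> kcarrier A; y \<in> kcarrier A; z \<in> kcarrier A\<rbrakk> \<Longrightarrow>
      kmult A x (kadd A y z) = kadd A (kmult A x y) (kmult A x z)"
    and distrib_right: "\<lbrakk>x \<in> kcarrier A; y \<in> kcarrier A; z \<in> kcarrier A\<rbrakk> \<Longrightarrow>
      kmult A (kadd A x y) z = kadd A (kmult A x z) (kmult A y z)"
    and scale_add: "\<lbrakk>x \<in> kcarrier A; y \<in> kcarrier A\<rbrakk> \<Longrightarrow>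
      kscale A c (kadd A x y) = kadd A (kscale A c x) (kscale A c y)"
    and add_scale: "x \<in> kcarrier A \<Longrightarrow>
      kscale A (c + d) x = kadd A (kscale A c x) (kscale A d x)"
    and scale_scale: "x \<in> kcarrier A \<Longrightarrow> kscale A c (kscale A d x) = kscale A (c * d) x"
    and scale_one: "x \<in> kcarrier A \<Longrightarrow> kscale A 1 x = x"
    and scale_mult_left: "\<lbrakk>x \<in> kcarrier A; y \<in> kcarrier A\<rbrakk> \<Longrightarrow>
      kmult A (kscale A c x) y = kscale A c (kmult A x y)"
    and scale_mult_right: "\<lbrakk>x \<in> kcarrier A; y \<in> kcarrier A\<rbrakk> \<Longrightarrow>
      kmult A x (kscale A c y) = kscale A c (kmult A x y)"

definition commutative_kalg :: "('k, 'a) kalg \<Rightarrow> bool" where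
  "commutative_kalg A \<longleftrightarrow> (\<forall>x\<in>kcarrier A. \<forall>y\<in>kcarrier A. kmult A x y = kmult A y x)"

definition kcommutator :: "('k, 'a) kalg \<Rightarrow> 'a \<Rightarrow> 'a \<Rightarrow> 'a" where
  "kcommutator A x y = kdiff A (kmult A x y) (kmult A y x)"

definition ksubspace :: "('k, 'a) kalg \<Rightarrow> 'a set \<Rightarrow> bool" where
  "ksubspace A U \<longleftrightarrow> U \<subseteq> kcarrier A \<and> kzero A \<in> U \<and>
     (\<forall>x\<in>U. \<forall>y\<in>U. kadd A x y \<in> U) \<and> (\<forall>c. \<forall>x\<in>U. kscale A c x \<in> U)"

definition lie_ideal :: "('k, 'a) kalg \<Rightarrow> 'a set \<Rightarrow> bool" where
  "lie_ideal A U \<longleftrightarrow> ksubspace A U \<and> (\<forall>u\<in>U. \<forall>a\<in>kcarrier A. kcommutator A u a \<in> U)"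

text \<open>A two-sided ideal of the underlying ring; scalars are not mentioned.\<close>

definition ring_ideal :: "('k, 'a) kalg \<Rightarrow> 'a set \<Rightarrow> bool" where
  "ring_ideal A I \<longleftrightarrow> I \<subseteq> kcarrier A \<and> kzero A \<in> I \<and>
     (\<forall>x\<in>I. \<forall>y\<in>I. kdiff A x y \<in> I) \<and>
     (\<forall>x\<in>I. \<forall>a\<in>kcarrier A. kmult A a x \<in> I \<and> kmult A x a \<in> I)"

definition ring_ideal_gen :: "('k, 'a) kalg \<Rightarrow> 'a set \<Rightarrow> 'a set" where
  "ring_ideal_gen A S = \<Inter>{I. ring_ideal A I \<and> S \<subseteq> I}"

text \<open>
  Ideals of the algebra. In the free algebra, which has no unit, these are not the same
  as the ideals of the underlying ring, and it is these by which one has to divide.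
\<close>

definition kalg_ideal :: "('k, 'a) kalg \<Rightarrow> 'a set \<Rightarrow> bool" where
  "kalg_ideal A I \<longleftrightarrow> ksubspace A I \<and> ring_ideal A I"

definition kalg_ideal_gen :: "('k, 'a) kalg \<Rightarrow> 'a set \<Rightarrow> 'a set" where
  "kalg_ideal_gen A S = \<Inter>{I. kalg_ideal A I \<and> S \<subseteq> I}"

definition kalg_hom :: "('k, 'a) kalg \<Rightarrow> ('k, 'b) kalg \<Rightarrow> ('a \<Rightarrow> 'b) \<Rightarrow> bool" where
  "kalg_hom A B f \<longleftrightarrow> f ` kcarrier A \<subseteq> kcarrier B \<and>
     (\<forall>x\<in>kcarrier A. \<forall>y\<in>kcarrier A.
        f (kadd A x y) = kadd B (f x) (f y) \<and> f (kmult A x y) = kmult B (f x) (f y)) \<and>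
     (\<forall>c. \<forall>x\<in>kcarrier A. f (kscale A c x) = kscale B c (f x))"

definition kline :: "('k, 'a) kalg \<Rightarrow> 'a \<Rightarrow> 'a set" where
  "kline A x = range (\<lambda>c. kscale A c x)"

definition ksum :: "('k, 'a) kalg \<Rightarrow> 'a set \<Rightarrow> 'a set \<Rightarrow> 'a set" where
  "ksum A U V = {kadd A x y | x y. x \<in> U \<and> y \<in> V}"

definition kalg_direct_sum :: "('k, 'a) kalg \<Rightarrow> 'a set \<Rightarrow> 'a set \<Rightarrow> bool" where
  "kalg_direct_sum A I J \<longleftrightarrow> kalg_ideal A I \<and> kalg_ideal A J \<and>
     ksum A I J = kcarrier A \<and> I \<inter> J = {kzero A}"

definition kcong :: "('k, 'a) kalg \<Rightarrow> 'a set \<Rightarrow> ('a \<times> 'a) set" where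
  "kcong A I = {(x, y). x \<in> kcarrier A \<and> y \<in> kcarrier A \<and> kdiff A x y \<in> I}"

text \<open>
  All summands of the unions below coincide if \<open>I\<close> is an ideal of the algebra \<open>A\<close>.
\<close>

definition kquot :: "('k, 'a) kalg \<Rightarrow> 'a set \<Rightarrow> ('k, 'a set) kalg" where
  "kquot A I =
     \<lparr> kcarrier = kcarrier A // kcong A I,
       kzero = kcong A I `` {kzero A},
       kadd = (\<lambda>X Y. \<Union>x\<in>X. \<Union>y\<in>Y. kcong A I `` {kadd A x y}),
       kdiff = (\<lambda>X Y. \<Union>x\<in>X. \<Union>y\<in>Y. kcong A I `` {kdiff A x y}),
       kmult = (\<lambda>X Y. \<Union>x\<in>X. \<Union>y\<in>Y. kcong A I `` {kmult A x y}),
       kscale = (\<lambda>c X. \<Union>x\<in>X. kcong A I `` {kscale A c x}) \<rparr>"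


section \<open>Leavitt path algebras\<close>

text \<open>
  Words form a monoid under concatenation; hence \<open>'g list \<Rightarrow>\<^sub>0 'k\<close>, with the convolution
  product of \<^theory>\<open>HOL-Library.Poly_Mapping\<close>, is the free unital associative algebra over \<open>'g\<close>.
\<close>

instantiation list :: (type) monoid_add
begin

definition zero_list :: "'a list" where "0 = []"

definition plus_list :: "'a list \<Rightarrow> 'a list \<Rightarrow> 'a list" where "xs + ys = xs @ ys"

instance by standard (simp_all add: zero_list_def plus_list_def)

end

text \<open>The free (non-unital) algebra on \<open>X\<close>: only non-empty words with letters in \<open>X\<close> occur.\<close>

definition free_kalg :: "'g set \<Rightarrow> ('k::field, 'g list \<Rightarrow>\<^sub>0 'k) kalg" where
  "free_kalg X =
     \<lparr> kcarrier = {x. Poly_Mapping.keys x \<subseteq> lists X - {[]}},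
       kzero = 0, kadd = (+), kdiff = (-), kmult = (*),
       kscale = (\<lambda>c x. Poly_Mapping.single [] c * x) \<rparr>"

datatype ('v, 'e) lpa_gen = Vert 'v | Arc 'e | Ghost 'e

definition lpa_gens :: "('v, 'e) pre_digraph \<Rightarrow> ('v, 'e) lpa_gen set" where
  "lpa_gens E = Vert ` verts E \<union> Arc ` arcs E \<union> Ghost ` arcs E"

abbreviation free_gen :: "'g \<Rightarrow> ('g list \<Rightarrow>\<^sub>0 'k::field)" where
  "free_gen g \<equiv> Poly_Mapping.single [g] 1"

text \<open>Each \<open>x\<close> in this set stands for the relation \<open>x = 0\<close>.\<close>

definition lpa_rels :: "('v, 'e) pre_digraph \<Rightarrow> (('v, 'e) lpa_gen list \<Rightarrow>\<^sub>0 'k::field) set" where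
  "lpa_rels E =
     {free_gen (Vert v) * free_gen (Vert v') - (if v = v' then free_gen (Vert v) else 0) | v v'.
        v \<in> verts E \<and> v' \<in> verts E} \<union>
     {free_gen (Vert (tail E e)) * free_gen (Arc e) - free_gen (Arc e) | e. e \<in> arcs E} \<union>
     {free_gen (Arc e) * free_gen (Vert (head E e)) - free_gen (Arc e) | e. e \<in> arcs E} \<union>
     {free_gen (Vert (head E e)) * free_gen (Ghost e) - free_gen (Ghost e) | e. e \<in> arcs E} \<union>
     {free_gen (Ghost e) * free_gen (Vert (tail E e)) - free_gen (Ghost e) | e. e \<in> arcs E} \<union>
     {free_gen (Ghost e) * free_gen (Arc f) - (if e = f then free_gen (Vert (head E e)) else 0) | e f.
        e \<in> arcs E \<and> f \<in> arcs E} \<union>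
     {free_gen (Vert v) - (\<Sum>e\<in>out_arcs E v. free_gen (Arc e) * free_gen (Ghost e)) | v.
        regular_vertex E v}"

definition lpa_ideal :: "('v, 'e) pre_digraph \<Rightarrow> (('v, 'e) lpa_gen list \<Rightarrow>\<^sub>0 'k::field) set" where
  "lpa_ideal E = kalg_ideal_gen (free_kalg (lpa_gens E)) (lpa_rels E)"

definition leavitt :: "'k::field itself \<Rightarrow> ('v, 'e) pre_digraph \<Rightarrow>
    ('k, (('v, 'e) lpa_gen list \<Rightarrow>\<^sub>0 'k) set) kalg" where
  "leavitt K E = kquot (free_kalg (lpa_gens E)) (lpa_ideal E)"

definition leavitt_gen :: "'k::field itself \<Rightarrow> ('v, 'e) pre_digraph \<Rightarrow> ('v, 'e) lpa_gen \<Rightarrow>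
    (('v, 'e) lpa_gen list \<Rightarrow>\<^sub>0 'k) set" where
  "leavitt_gen K E g = kcong (free_kalg (lpa_gens E)) (lpa_ideal E) `` {free_gen g}"


subsection \<open>Leavitt path algebras are associative algebras\<close>

lemma keys_mult_words:
  "Poly_Mapping.keys x \<subseteq> lists X - {[]} \<Longrightarrow> Poly_Mapping.keys y \<subseteq> lists X - {[]} \<Longrightarrow>
   Poly_Mapping.keys (x * y) \<subseteq> lists X - {[]}" for x y :: "'g list \<Rightarrow>\<^sub>0 'k::field"
  using keys_mult[of x y] by (fastforce simp: plus_list_def)

lemma keys_scale_words:
  "Poly_Mapping.keys x \<subseteq> lists X - {[]} \<Longrightarrow>
   Poly_Mapping.keys (Poly_Mapping.single [] c * x) \<subseteq> lists X - {[]}"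
  for x :: "'g list \<Rightarrow>\<^sub>0 'k::field"
  using keys_mult[of "Poly_Mapping.single [] c" x]
  by (fastforce simp: plus_list_def split: if_splits)

lemma single_Nil_commute:
  "x * Poly_Mapping.single [] c = Poly_Mapping.single [] c * x" for x :: "'g list \<Rightarrow>\<^sub>0 'k::field"
proof (rule poly_mapping_eqI)
  have 1: "x = (\<Sum>k\<in>Poly_Mapping.keys x. Poly_Mapping.single k (Poly_Mapping.lookup x k))"
    by (rule poly_mapping_eqI) (simp add: lookup_sum lookup_single when_def in_keys_iff)
  have "x * Poly_Mapping.single [] c = Poly_Mapping.single [] c * x"
    by (subst (1 2) 1)
      (simp add: sum_distrib_left sum_distrib_right mult_single plus_list_def mult.commute)
  then show "Poly_Mapping.lookup (x * Poly_Mapping.single [] c) k =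
      Poly_Mapping.lookup (Poly_Mapping.single [] c * x) k" for k
    by simp
qed

lemma single_Nil_left_commute:
  "x * (Poly_Mapping.single [] c * y) = Poly_Mapping.single [] c * (x * y)"
  for x y :: "'g list \<Rightarrow>\<^sub>0 'k::field"
  by (metis mult.assoc single_Nil_commute)

lemma single_Nil_mult:
  "Poly_Mapping.single [] c * (Poly_Mapping.single [] d * x) = Poly_Mapping.single [] (c * d) * x"
  for x :: "'g list \<Rightarrow>\<^sub>0 'k::field"
  by (simp add: mult.assoc[symmetric] mult_single plus_list_def)

lemma single_Nil_one: "Poly_Mapping.single [] 1 = (1 :: 'g list \<Rightarrow>\<^sub>0 'k::field)"
  by (metis single_one zero_list_def)

lemma kalgebra_free_kalg: "kalgebra (free_kalg (X :: 'g set) :: ('k::field, _) kalg)"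
proof -
  have closed: "Poly_Mapping.keys (x + y) \<subseteq> lists X - {[]}" "Poly_Mapping.keys (x - y) \<subseteq> lists X - {[]}"
    if "Poly_Mapping.keys x \<subseteq> lists X - {[]}" "Poly_Mapping.keys y \<subseteq> lists X - {[]}"
    for x y :: "'g list \<Rightarrow>\<^sub>0 'k"
    using keys_add[of x y] keys_diff[of x y] that by blast+
  show ?thesis
    apply (unfold_locales; unfold free_kalg_def kalg.simps mem_Collect_eq)
    subgoal by simp
    subgoal by (rule closed)
    subgoal by (rule closed)
    subgoal by (rule keys_mult_words)
    subgoal by (rule keys_scale_words)
    subgoal by (rule add.assoc)
    subgoal by (rule add.commute)
    subgoal by (rule add.right_neutral)
    subgoal by (rule diff_add_cancel)
    subgoal by (rule mult.assoc)
    subgoal by (rule distrib_left)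
    subgoal by (rule distrib_right)
    subgoal by (rule distrib_left)
    subgoal by (simp only: single_add distrib_right)
    subgoal by (rule single_Nil_mult)
    subgoal by (simp only: single_Nil_one mult_1_left)
    subgoal by (rule mult.assoc)
    subgoal by (rule single_Nil_left_commute)
    done
qed

lemma kalg_ideal_gen:
  assumes "kalgebra A" "S \<subseteq> kcarrier A"
  shows "kalg_ideal A (kalg_ideal_gen A S)" "S \<subseteq> kalg_ideal_gen A S"
proof -
  interpret kalgebra A by fact
  have "kalg_ideal A (kcarrier A)"
    by (auto simp: kalg_ideal_def ksubspace_def ring_ideal_def
        zero_closed add_closed diff_closed mult_closed scale_closed)
  then have sub: "kalg_ideal_gen A S \<subseteq> kcarrier A"
    unfolding kalg_ideal_gen_def using assms(2) by (intro Inter_lower) simp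
  show "S \<subseteq> kalg_ideal_gen A S"
    by (auto simp: kalg_ideal_gen_def)
  show "kalg_ideal A (kalg_ideal_gen A S)"
    using sub by (auto simp: kalg_ideal_gen_def kalg_ideal_def ksubspace_def ring_ideal_def)
qed

lemma lpa_rels_carrier:
  assumes "wf_digraph E"
  shows "lpa_rels E \<subseteq> kcarrier (free_kalg (lpa_gens E) :: ('k::field, _) kalg)"
proof -
  let ?F = "free_kalg (lpa_gens E) :: ('k, _) kalg"
  interpret kalgebra ?F by (rule kalgebra_free_kalg)
  have gen: "free_gen g \<in> kcarrier ?F" if "g \<in> lpa_gens E" for g
    using that by (simp add: free_kalg_def)
  have mult: "x * y \<in> kcarrier ?F" and diff: "x - y \<in> kcarrier ?F"
    if "x \<in> kcarrier ?F" "y \<in> kcarrier ?F" for x y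
    using mult_closed[of x y] diff_closed[of x y] that by (simp_all add: free_kalg_def)
  have zero: "0 \<in> kcarrier ?F" using zero_closed by (simp add: free_kalg_def)
  have sum: "sum f B \<in> kcarrier ?F" if "\<And>e. e \<in> B \<Longrightarrow> f e \<in> kcarrier ?F" for f and B :: "'c set"
    using that
    by (induction B rule: infinite_finite_induct)
      (use zero add_closed in \<open>auto simp: free_kalg_def\<close>)
  have V: "Vert v \<in> lpa_gens E" if "v \<in> verts E" for v using that by (simp add: lpa_gens_def)
  have A: "Arc e \<in> lpa_gens E" "Ghost e \<in> lpa_gens E" "Vert (tail E e) \<in> lpa_gens E"
    "Vert (head E e) \<in> lpa_gens E" if "e \<in> arcs E" for e
    using that assms by (auto simp: lpa_gens_def wf_digraph_def)
  show ?thesis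
    unfolding lpa_rels_def
    by (auto simp: regular_vertex_def intro!: diff sum mult gen zero V A
        simp del: wf_digraph.tail_in_verts)
qed

lemma kalg_ideal_lpa_ideal:
  assumes "wf_digraph E"
  shows "kalg_ideal (free_kalg (lpa_gens E)) (lpa_ideal E)" "lpa_rels E \<subseteq> lpa_ideal E"
  unfolding lpa_ideal_def
  using kalg_ideal_gen[OF kalgebra_free_kalg lpa_rels_carrier[OF assms]] by blast+

context
  fixes X :: "'g set" and I :: "('g list \<Rightarrow>\<^sub>0 'k::field) set"
  assumes I: "kalg_ideal (free_kalg X) I"
begin

private abbreviation (input) "C \<equiv> kcarrier (free_kalg X :: ('k, _) kalg)"
private abbreviation (input) "cls x \<equiv> kcong (free_kalg X) I `` {x}"
private abbreviation (input) "Q \<equiv> kquot (free_kalg X) I"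

lemma ideal_facts:
  "0 \<in> I" "x \<in> I \<Longrightarrow> y \<in> I \<Longrightarrow> x + y \<in> I" "x \<in> I \<Longrightarrow> y \<in> I \<Longrightarrow> x - y \<in> I"
  "x \<in> I \<Longrightarrow> a \<in> C \<Longrightarrow> a * x \<in> I" "x \<in> I \<Longrightarrow> a \<in> C \<Longrightarrow> x * a \<in> I"
  "x \<in> I \<Longrightarrow> Poly_Mapping.single [] c * x \<in> I"
  using I unfolding kalg_ideal_def ksubspace_def ring_ideal_def free_kalg_def by auto

lemma carrier_facts:
  "0 \<in> C" "x \<in> C \<Longrightarrow> y \<in> C \<Longrightarrow> x + y \<in> C" "x \<in> C \<Longrightarrow> y \<in> C \<Longrightarrow> x - y \<in> C"
  "x \<in> C \<Longrightarrow> y \<in> C \<Longrightarrow> x * y \<in> C" "x \<in> C \<Longrightarrow> Poly_Mapping.single [] c * x \<in> C"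
proof -
  interpret kalgebra "free_kalg X :: ('k, _) kalg" by (rule kalgebra_free_kalg)
  show "0 \<in> C" "x \<in> C \<Longrightarrow> y \<in> C \<Longrightarrow> x + y \<in> C" "x \<in> C \<Longrightarrow> y \<in> C \<Longrightarrow> x - y \<in> C"
  "x \<in> C \<Longrightarrow> y \<in> C \<Longrightarrow> x * y \<in> C" "x \<in> C \<Longrightarrow> Poly_Mapping.single [] c * x \<in> C"
    using zero_closed add_closed[of x y] diff_closed[of x y] mult_closed[of x y] scale_closed[of x c]
    by (simp_all add: free_kalg_def)
qed

lemma kcong_iff: "(x, y) \<in> kcong (free_kalg X) I \<longleftrightarrow> x \<in> C \<and> y \<in> C \<and> x - y \<in> I"
  by (simp add: kcong_def free_kalg_def)

lemma equiv_kcong: "equiv C (kcong (free_kalg X) I)"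
proof (rule equivI)
  show "kcong (free_kalg X) I \<subseteq> C \<times> C" by (auto simp: kcong_iff)
  show "refl_on C (kcong (free_kalg X) I)" by (rule refl_onI) (auto simp: kcong_iff ideal_facts)
  show "sym (kcong (free_kalg X) I)"
    by (rule symI) (use ideal_facts(1) ideal_facts(3)[OF ideal_facts(1)] in \<open>fastforce simp: kcong_iff\<close>)
  show "trans (kcong (free_kalg X) I)"
    by (rule transI) (use ideal_facts(2) in \<open>fastforce simp: kcong_iff\<close>)
qed

lemma cls_eq_iff: "x \<in> C \<Longrightarrow> y \<in> C \<Longrightarrow> cls x = cls y \<longleftrightarrow> x - y \<in> I"
  using eq_equiv_class_iff[OF equiv_kcong, of x y] by (simp add: kcong_iff)

lemma cls_binop:
  assumes xy: "x \<in> C" "y \<in> C"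
    and closed: "\<And>a b. a \<in> C \<Longrightarrow> b \<in> C \<Longrightarrow> f a b \<in> C"
    and cong: "\<And>a b. a \<in> C \<Longrightarrow> b \<in> C \<Longrightarrow> x - a \<in> I \<Longrightarrow> y - b \<in> I \<Longrightarrow> f x y - f a b \<in> I"
  shows "(\<Union>a\<in>cls x. \<Union>b\<in>cls y. cls (f a b)) = cls (f x y)"
proof -
  have "cls (f a b) = cls (f x y)" if "a \<in> cls x" "b \<in> cls y" for a b
    using that cong[of a b] closed[of a b] closed[OF xy] cls_eq_iff[of "f x y" "f a b"]
    by (simp add: kcong_iff)
  moreover have "x \<in> cls x" "y \<in> cls y" using xy by (simp_all add: kcong_iff ideal_facts)
  ultimately show ?thesis by blast
qed

lemma kquot_ops:
  assumes "x \<in> C" "y \<in> C"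
  shows "kadd Q (cls x) (cls y) = cls (x + y)"
    and "kdiff Q (cls x) (cls y) = cls (x - y)"
    and "kmult Q (cls x) (cls y) = cls (x * y)"
    and "kscale Q c (cls x) = cls (Poly_Mapping.single [] c * x)"
proof -
  have ops: "kadd (free_kalg X :: ('k, _) kalg) = (+)" "kdiff (free_kalg X :: ('k, _) kalg) = (-)"
    "kmult (free_kalg X :: ('k, _) kalg) = (*)"
    "kscale (free_kalg X :: ('k, _) kalg) = (\<lambda>c x. Poly_Mapping.single [] c * x)"
    by (simp_all add: free_kalg_def)
  show "kadd Q (cls x) (cls y) = cls (x + y)"
    unfolding kquot_def kalg.simps ops
  proof (rule cls_binop[OF assms])
    fix a b assume "x - a \<in> I" "y - b \<in> I"
    from ideal_facts(2)[OF this] show "x + y - (a + b) \<in> I" by (simp add: algebra_simps)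
  qed (rule carrier_facts)
  show "kdiff Q (cls x) (cls y) = cls (x - y)"
    unfolding kquot_def kalg.simps ops
  proof (rule cls_binop[OF assms])
    fix a b assume "x - a \<in> I" "y - b \<in> I"
    from ideal_facts(3)[OF this] show "x - y - (a - b) \<in> I" by (simp add: algebra_simps)
  qed (rule carrier_facts)
  show "kmult Q (cls x) (cls y) = cls (x * y)"
    unfolding kquot_def kalg.simps ops
  proof (rule cls_binop[OF assms])
    fix a b assume *: "a \<in> C" "b \<in> C" "x - a \<in> I" "y - b \<in> I"
    have "(x - a) * y + a * (y - b) \<in> I"
      by (rule ideal_facts(2)[OF ideal_facts(5)[OF *(3) assms(2)] ideal_facts(4)[OF *(4) *(1)]])
    then show "x * y - a * b \<in> I" by (simp add: algebra_simps)
  qed (rule carrier_facts)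
  have "(\<Union>a\<in>cls x. \<Union>b\<in>cls x. cls (Poly_Mapping.single [] c * a)) =
      cls (Poly_Mapping.single [] c * x)"
  proof (rule cls_binop[OF assms(1) assms(1)])
    fix a assume "x - a \<in> I"
    from ideal_facts(6)[OF this, of c]
    show "Poly_Mapping.single [] c * x - Poly_Mapping.single [] c * a \<in> I"
      by (simp add: algebra_simps)
  qed (rule carrier_facts)
  moreover have "x \<in> cls x" using assms by (simp add: kcong_iff ideal_facts)
  then have "cls x \<noteq> {}" by blast
  ultimately show "kscale Q c (cls x) = cls (Poly_Mapping.single [] c * x)"
    unfolding kquot_def kalg.simps ops by simp
qed

lemma kquot_carrier: "kcarrier Q = (\<lambda>x. cls x) ` C"
  by (auto simp: kquot_def quotient_def)

lemma kalgebra_kquot: "kalgebra Q"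
proof -
  let ?F = "free_kalg X :: ('k, _) kalg"
  interpret F: kalgebra ?F by (rule kalgebra_free_kalg)
  have ops: "kzero Q = cls (kzero ?F)"
    "\<And>x y. x \<in> C \<Longrightarrow> y \<in> C \<Longrightarrow> kadd Q (cls x) (cls y) = cls (kadd ?F x y)"
    "\<And>x y. x \<in> C \<Longrightarrow> y \<in> C \<Longrightarrow> kdiff Q (cls x) (cls y) = cls (kdiff ?F x y)"
    "\<And>x y. x \<in> C \<Longrightarrow> y \<in> C \<Longrightarrow> kmult Q (cls x) (cls y) = cls (kmult ?F x y)"
    "\<And>c x. x \<in> C \<Longrightarrow> kscale Q c (cls x) = cls (kscale ?F c x)"
    using kquot_ops kquot_ops(4)[OF _ carrier_facts(1)] by (simp_all add: free_kalg_def kquot_def)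
  note closed = F.zero_closed F.add_closed F.diff_closed F.mult_closed F.scale_closed
  have elim: thesis if "A \<in> kcarrier Q" "\<And>a. a \<in> C \<Longrightarrow> A = cls a \<Longrightarrow> thesis" for A thesis
    using that by (auto simp: kquot_carrier)
  have mem: "cls a \<in> kcarrier Q" if "a \<in> C" for a
    using that by (simp add: kquot_carrier)
  show ?thesis
    apply (unfold_locales; ((erule elim)+)?; simp only: ops mem closed)
    subgoal by (simp only: F.add_assoc)
    subgoal by (simp only: F.add_commute)
    subgoal by (simp only: F.add_zero)
    subgoal by (simp only: F.diff_add)
    subgoal by (simp only: F.mult_assoc)
    subgoal by (simp only: F.distrib_left)
    subgoal by (simp only: F.distrib_right)
    subgoal by (simp only: F.scale_add)
    subgoal by (simp only: F.add_scale)
    subgoal by (simp only: F.scale_scale)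
    subgoal by (simp only: F.scale_one)
    subgoal by (simp only: F.scale_mult_left)
    subgoal by (simp only: F.scale_mult_right)
    done
qed

end

theorem kalgebra_leavitt:
  assumes "wf_digraph E"
  shows "kalgebra (leavitt K E)"
  unfolding leavitt_def by (rule kalgebra_kquot[OF kalg_ideal_lpa_ideal(1)[OF assms]])


section \<open>The exceptional graphs\<close>

definition p_commutator_plus_isolated ::
    "nat \<Rightarrow> ('v, 'e) pre_digraph \<Rightarrow> ('v, 'e) pre_digraph \<Rightarrow> 'v \<Rightarrow> bool" where
  "p_commutator_plus_isolated p E F v \<longleftrightarrow> p_commutator_graph p F \<and> disjoint_union_isolated E F v"

definition p_commutator_porcupine :: "nat \<Rightarrow> ('v, 'e) pre_digraph \<Rightarrow> 'v set \<Rightarrow> 'v \<Rightarrow> bool" where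
  "p_commutator_porcupine p E H v \<longleftrightarrow>
     verts E = H \<union> {v} \<and> v \<notin> H \<and> H \<noteq> {} \<and> hereditary E H \<and> saturated E H \<and>
     p_commutator_graph p (porcupine E H v) \<and>
     {w. infinite_emitter E w} = {v} \<and> source_vertex E v"

text \<open>
  \<open>L\<^sub>K(E) = Kv \<oplus> L\<^sub>K(F)\<close>: here \<open>L\<^sub>K(F)\<close> is identified with its image under the homomorphism
  that maps vertices, edges and ghost edges of \<open>F\<close> to the same symbols in \<open>L\<^sub>K(E)\<close>.
\<close>

definition leavitt_splits ::
    "'k::field itself \<Rightarrow> ('v, 'e) pre_digraph \<Rightarrow> ('v, 'e) pre_digraph \<Rightarrow> 'v \<Rightarrow> bool" where
  "leavitt_splits K E F v \<longleftrightarrow>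
     (\<exists>\<phi>. kalg_hom (leavitt K F) (leavitt K E) \<phi> \<and>
        (\<forall>g\<in>lpa_gens F. \<phi> (leavitt_gen K F g) = leavitt_gen K E g) \<and>
        inj_on \<phi> (kcarrier (leavitt K F)) \<and>
        kalg_direct_sum (leavitt K E)
          (kline (leavitt K E) (leavitt_gen K E (Vert v)))
          (\<phi> ` kcarrier (leavitt K F)))"

end

theory Submission
  imports Defs
begin

text \<open>
  Let \<open>L\<close> be the Leavitt path algebra of \<open>E\<close>.

  If all Lie ideals are ideals, then so is every subspace between \<open>[L, L]\<close> and \<open>L\<close>. Applied to
  \<open>[L, L] + K (v + w)\<close> this shows that at most one vertex \<open>v\<close> lies outside \<open>[L, L]\<close>, and
  \<open>L = K v + [L, L]\<close>. Counting the fixed points of a word of degree \<open>l > 0\<close> on the infinite paths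
  defines a trace that is \<open>0\<close> on \<open>K v\<close> and \<open>1\<close> on closed paths of length \<open>l\<close>, so \<open>E\<close> is acyclic.
  If \<open>u \<in> [L, L]\<close>, then only finitely many arcs are involved in an expression of \<open>u\<close> as a sum of
  commutators, and the trace of \<open>u\<close> on a finite set of paths that is stable under these arcs vanishes.
  Finite paths ending in a singular vertex show that \<open>u\<close> is regular, and paths continued by a fixed
  infinite path give the divisibility by the characteristic of the number of paths that leave a large finite set.

  Conversely, if these numbers are divisible by \<open>p\<close>, then a vertex \<open>w\<close> is the sum of the commutators
  \<open>[q, q\<^sup>*]\<close>, where \<open>q\<close> runs through the paths from \<open>w\<close> that leave a large finite set. Let \<open>U\<close> be a Lie ideal,
  \<open>u \<in> U\<close>, and let \<open>\<beta>\<close> be a path from the finite support of \<open>u\<close> to a vertex \<open>w\<close> outside of it. Then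
  \<open>u \<beta> = [u, \<beta>] \<in> U\<close> is a combination of paths that end in \<open>w\<close>. If it is not \<open>0\<close>, brackets with ghost paths
  and with the paths \<open>q\<close> as above show first \<open>q \<in> U\<close>, then \<open>w \<in> U\<close>, and finally \<open>L w L \<subseteq> U\<close>. Hence
  \<open>u \<beta>\<close> always lies in an ideal contained in \<open>U\<close>, and \<open>u L \<subseteq> U\<close> follows by expanding the vertices.
\<close>

section \<open>Linear maps on free algebras\<close>

text \<open>The balls in the definition of a p-commutator graph are tied to one vertex and behave
  badly when they are enlarged or when the graph is changed. They are therefore replaced by
  arbitrary finite sets B. For fixed w, the number of paths from x that leave B at w extends to a
  function whose value at each vertex of B is the sum of its values at the heads of the emitted
  arcs. For such functions divisibility survives every enlargement of B. This supplies the large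
  finite sets that the argument asks for, and it lets the condition pass between E, the graph on H
  and the porcupine graph. Divisibility enters through q*q = r(q): a vertex is the sum of the
  products qq* over its exit paths, and the correction terms r(q) add up to 0 if every range occurs
  a multiple of p times. In the converse direction the three cases of the theorem take one form: a
  set H of regular vertices that contains the heads of all arcs, and at most one further vertex. In
  the other direction, subspaces that contain [L, L] are Lie ideals for a trivial reason, so the
  hypothesis is strongest there.\<close>

abbreviation scal :: "'k::field \<Rightarrow> ('g list \<Rightarrow>\<^sub>0 'k)" where
  "scal c \<equiv> Poly_Mapping.single [] c"

abbreviation mon :: "'g list \<Rightarrow> ('g list \<Rightarrow>\<^sub>0 'k::field)" where
  "mon w \<equiv> Poly_Mapping.single w 1"

lemma mon_mult: "mon a * mon b = (mon (a @ b) :: 'g list \<Rightarrow>\<^sub>0 'k::field)"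
  by (simp add: mult_single plus_list_def)

lemma mon_Nil: "mon [] = (1 :: 'g list \<Rightarrow>\<^sub>0 'k::field)"
  by (rule single_Nil_one)

lemma lookup_scal_mult:
  "Poly_Mapping.lookup (scal c * x) w = c * Poly_Mapping.lookup x w" for x :: "'g list \<Rightarrow>\<^sub>0 'k::field"
proof -
  have "scal c * x = Poly_Mapping.map ((*) c) x"
    by (simp add: mult_map_scale_conv_mult zero_list_def)
  then show ?thesis by (simp add: Poly_Mapping.map.rep_eq when_def)
qed

interpretation fa: vector_space "\<lambda>c x. scal c * (x :: 'g list \<Rightarrow>\<^sub>0 'k::field)"
proof
qed (simp_all add: distrib_left single_add distrib_right single_Nil_mult single_Nil_one)

lemma expand_mon:
  "x = (\<Sum>w\<in>Poly_Mapping.keys x. scal (Poly_Mapping.lookup x w) * mon w)"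
  for x :: "'g list \<Rightarrow>\<^sub>0 'k::field"
  by (rule poly_mapping_eqI)
    (simp add: lookup_sum lookup_scal_mult lookup_single when_def in_keys_iff if_distrib cong: if_cong)

lemma mem_span_mon: "x \<in> fa.span (mon ` Poly_Mapping.keys x)" for x :: "'g list \<Rightarrow>\<^sub>0 'k::field"
proof -
  have "(\<Sum>w\<in>Poly_Mapping.keys x. scal (Poly_Mapping.lookup x w) * mon w) \<in> fa.span (mon ` Poly_Mapping.keys x)"
    by (intro fa.span_sum fa.span_scale fa.span_base imageI)
  then show ?thesis using expand_mon[of x] by argo
qed

lemma subspace_mon:
  assumes "fa.subspace S" "\<And>w. w \<in> Poly_Mapping.keys x \<Longrightarrow> mon w \<in> S"
  shows "(x :: 'g list \<Rightarrow>\<^sub>0 'k::field) \<in> S"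
proof -
  have "fa.span (mon ` Poly_Mapping.keys x) \<subseteq> S"
    by (rule fa.span_minimal[OF _ assms(1)]) (use assms(2) in auto)
  then show ?thesis using mem_span_mon[of x] by (rule subsetD)
qed

lemma mon_induct:
  assumes "fa.subspace {x. P x}" "\<And>w. w \<in> Poly_Mapping.keys x \<Longrightarrow> P (mon w)"
  shows "P (x :: 'g list \<Rightarrow>\<^sub>0 'k::field)"
  using subspace_mon[OF assms(1), of x] assms(2) by simp

text \<open>The linear extension of \<open>f\<close> from words to the free algebra. The scalar
  multiplication \<open>s\<close> of the target is a parameter, so that maps into the free algebra
  and functionals (\<open>linf\<close>) are both instances.\<close>

definition lin :: "('k::field \<Rightarrow> 'b \<Rightarrow> 'b) \<Rightarrow> ('g list \<Rightarrow> 'b) \<Rightarrow> ('g list \<Rightarrow>\<^sub>0 'k) \<Rightarrow> 'b::ab_group_add" where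
  "lin s f x = (\<Sum>w\<in>Poly_Mapping.keys x. s (Poly_Mapping.lookup x w) (f w))"

context vector_space
begin

lemma lin_superset:
  assumes "finite A" "Poly_Mapping.keys x \<subseteq> A"
  shows "lin scale f x = (\<Sum>w\<in>A. scale (Poly_Mapping.lookup x w) (f w))"
  unfolding lin_def
proof (rule sum.mono_neutral_left[OF assms], rule ballI)
  fix w assume "w \<in> A - Poly_Mapping.keys x"
  then have "Poly_Mapping.lookup x w = 0" by (simp add: in_keys_iff)
  then show "scale (Poly_Mapping.lookup x w) (f w) = 0" by (simp only: scale_zero_left)
qed

lemma lin_add: "lin scale f (x + y) = lin scale f x + lin scale f y"
proof -
  let ?A = "Poly_Mapping.keys x \<union> Poly_Mapping.keys y"
  have "finite ?A" "Poly_Mapping.keys (x + y) \<subseteq> ?A" using keys_add[of x y] by auto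
  then show ?thesis
    by (simp add: lin_superset[of ?A] lookup_add scale_left_distrib sum.distrib)
qed

lemma lin_scale: "lin scale f (scal c * x) = scale c (lin scale f x)"
proof -
  have "Poly_Mapping.keys (scal c * x) \<subseteq> Poly_Mapping.keys x"
    by (auto simp: in_keys_iff lookup_scal_mult)
  then show ?thesis
    by (simp add: lin_superset[of "Poly_Mapping.keys x"] lookup_scal_mult scale_sum_right)
qed

lemma lin_single: "lin scale f (Poly_Mapping.single w c) = scale c (f w)"
  by (subst lin_superset[of "{w}"]) auto

lemma lin_mon: "lin scale f (mon w) = f w"
  by (simp add: lin_single)

lemma lin_zero: "lin scale f 0 = 0"
  by (simp add: lin_def)

lemma lin_diff: "lin scale f (x - y) = lin scale f x - lin scale f y"
  using lin_add[of f "x - y" y] by (simp add: algebra_simps)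

lemma lin_sum: "lin scale f (\<Sum>i\<in>A. g i) = (\<Sum>i\<in>A. lin scale f (g i))"
  by (induction A rule: infinite_finite_induct) (simp_all add: lin_zero lin_add)

end

abbreviation linf :: "('g list \<Rightarrow> 'k::field) \<Rightarrow> ('g list \<Rightarrow>\<^sub>0 'k) \<Rightarrow> 'k" where
  "linf \<equiv> lin (*)"

lemma vector_space_field: "vector_space ((*) :: 'k::field \<Rightarrow> 'k \<Rightarrow> 'k)"
  by standard (simp_all add: algebra_simps)

lemmas linf_add = vector_space.lin_add[OF vector_space_field]
lemmas linf_diff = vector_space.lin_diff[OF vector_space_field]
lemmas linf_scale = vector_space.lin_scale[OF vector_space_field]
lemmas linf_sum = vector_space.lin_sum[OF vector_space_field]
lemmas linf_zero = vector_space.lin_zero[OF vector_space_field]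
lemmas linf_mon = vector_space.lin_mon[OF vector_space_field]

text \<open>The endomorphism that sends every letter outside \<open>X\<close> to 0, given by its
  values on words. It compares free algebras over different alphabets inside one type.\<close>

definition restr :: "'g set \<Rightarrow> ('g list \<Rightarrow>\<^sub>0 'k::field) \<Rightarrow> ('g list \<Rightarrow>\<^sub>0 'k)" where
  "restr X = lin (\<lambda>c x. scal c * x) (\<lambda>w. if set w \<subseteq> X then mon w else 0)"

lemmas restr_add = fa.lin_add[where f="\<lambda>w. if set w \<subseteq> X then mon w else 0" for X, folded restr_def]
lemmas restr_diff = fa.lin_diff[where f="\<lambda>w. if set w \<subseteq> X then mon w else 0" for X, folded restr_def]
lemmas restr_scale = fa.lin_scale[where f="\<lambda>w. if set w \<subseteq> X then mon w else 0" for X, folded restr_def]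
lemmas restr_zero = fa.lin_zero[where f="\<lambda>w. if set w \<subseteq> X then mon w else 0" for X, folded restr_def]
lemmas restr_mon = fa.lin_mon[where f="\<lambda>w. if set w \<subseteq> X then mon w else 0" for X, folded restr_def]

lemma lookup_restr:
  "Poly_Mapping.lookup (restr X x) w = (if set w \<subseteq> X then Poly_Mapping.lookup x w else 0)"
proof -
  have "Poly_Mapping.lookup (restr X x) w =
      (\<Sum>v\<in>Poly_Mapping.keys x. if v = w then (if set w \<subseteq> X then Poly_Mapping.lookup x w else 0) else 0)"
    unfolding restr_def lin_def lookup_sum lookup_scal_mult
    by (intro sum.cong) (auto simp: lookup_single when_def)
  then show ?thesis by (simp add: in_keys_iff)
qed

lemma restr_mult: "restr X (x * y) = restr X x * restr X y"
proof -
  have *: "restr X (x * mon b) = restr X x * restr X (mon b)" for b x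
  proof (rule mon_induct[of "\<lambda>x. restr X (x * mon b) = restr X x * restr X (mon b)"])
    show "fa.subspace {x. restr X (x * mon b) = restr X x * restr X (mon b)}"
      by (simp add: fa.subspace_def restr_zero restr_add restr_scale distrib_right mult.assoc)
    show "restr X (mon a * mon b) = restr X (mon a) * restr X (mon b)" for a
      by (simp add: mon_mult restr_mon)
  qed
  show ?thesis
  proof (rule mon_induct[of "\<lambda>y. restr X (x * y) = restr X x * restr X y"])
    show "fa.subspace {y. restr X (x * y) = restr X x * restr X y}"
      by (simp add: fa.subspace_def restr_zero restr_add restr_scale distrib_left
          single_Nil_left_commute)
  qed (rule *)
qed

lemma keys_restr: "Poly_Mapping.keys (restr X x) \<subseteq> lists X"
  by (auto simp: in_keys_iff lookup_restr split: if_splits)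

lemma restr_id: "Poly_Mapping.keys x \<subseteq> lists X \<Longrightarrow> restr X x = x"
  by (rule poly_mapping_eqI) (auto simp: lookup_restr in_keys_iff)

lemma free_kalg_idealI:
  fixes J :: "('g list \<Rightarrow>\<^sub>0 'k::field) set"
  assumes "J \<subseteq> kcarrier (free_kalg X)" "0 \<in> J" "\<And>x y. x \<in> J \<Longrightarrow> y \<in> J \<Longrightarrow> x + y \<in> J"
    "\<And>x y. x \<in> J \<Longrightarrow> y \<in> J \<Longrightarrow> x - y \<in> J" "\<And>c x. x \<in> J \<Longrightarrow> scal c * x \<in> J"
    "\<And>a x. x \<in> J \<Longrightarrow> a \<in> kcarrier (free_kalg X) \<Longrightarrow> a * x \<in> J"
    "\<And>a x. x \<in> J \<Longrightarrow> a \<in> kcarrier (free_kalg X) \<Longrightarrow> x * a \<in> J"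
  shows "kalg_ideal (free_kalg X) J"
proof -
  have ops: "kzero (free_kalg X :: ('k, _) kalg) = 0" "kadd (free_kalg X :: ('k, _) kalg) = (+)"
    "kdiff (free_kalg X :: ('k, _) kalg) = (-)" "kmult (free_kalg X :: ('k, _) kalg) = (*)"
    "kscale (free_kalg X :: ('k, _) kalg) = (\<lambda>c x. scal c * x)"
    by (simp_all add: free_kalg_def)
  show ?thesis
    unfolding kalg_ideal_def ksubspace_def ring_ideal_def ops
    by (intro conjI ballI allI) (simp_all add: assms)
qed

section \<open>Leavitt path algebras modulo their relations\<close>

locale lpa = wf_digraph E for E :: "('v, 'e) pre_digraph" +
  fixes K :: "'k::field itself"
begin

text \<open>
  Computations are done with representatives in the free unital algebra on all symbols. There \<open>x \<approx> y\<close> means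
  that \<open>x\<close> and \<open>y\<close> agree in the Leavitt path algebra after deletion of the words that contain a symbol
  outside \<open>E\<close>; so such symbols are congruent to \<open>0\<close>, and \<open>\<approx>\<close> is a congruence without any side condition.
\<close>

definition Z :: "(('v, 'e) lpa_gen list \<Rightarrow>\<^sub>0 'k) set" where
  "Z = {x. restr (lpa_gens E) x \<in> lpa_ideal E}"

text \<open>The augmentation ideal. Its elements represent those of the non-unital algebra; elements
  with a constant term serve as multipliers.\<close>

definition augm :: "(('v, 'e) lpa_gen list \<Rightarrow>\<^sub>0 'k) set" where
  "augm = {x. Poly_Mapping.lookup x [] = 0}"

definition eqv :: "(('v, 'e) lpa_gen list \<Rightarrow>\<^sub>0 'k) \<Rightarrow> (('v, 'e) lpa_gen list \<Rightarrow>\<^sub>0 'k) \<Rightarrow> bool"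
    (infix \<open>\<approx>\<close> 50) where
  "x \<approx> y \<longleftrightarrow> x - y \<in> Z"

abbreviation V :: "'v \<Rightarrow> (('v, 'e) lpa_gen list \<Rightarrow>\<^sub>0 'k)" where "V v \<equiv> mon [Vert v]"
abbreviation A :: "'e \<Rightarrow> (('v, 'e) lpa_gen list \<Rightarrow>\<^sub>0 'k)" where "A e \<equiv> mon [Arc e]"
abbreviation G :: "'e \<Rightarrow> (('v, 'e) lpa_gen list \<Rightarrow>\<^sub>0 'k)" where "G e \<equiv> mon [Ghost e]"

abbreviation Car :: "(('v, 'e) lpa_gen list \<Rightarrow>\<^sub>0 'k) set" where
  "Car \<equiv> kcarrier (free_kalg (lpa_gens E))"

abbreviation res :: "(('v, 'e) lpa_gen list \<Rightarrow>\<^sub>0 'k) \<Rightarrow> (('v, 'e) lpa_gen list \<Rightarrow>\<^sub>0 'k)" where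
  "res \<equiv> restr (lpa_gens E)"

abbreviation cls :: "(('v, 'e) lpa_gen list \<Rightarrow>\<^sub>0 'k) \<Rightarrow> (('v, 'e) lpa_gen list \<Rightarrow>\<^sub>0 'k) set" where
  "cls x \<equiv> kcong (free_kalg (lpa_gens E)) (lpa_ideal E) `` {x}"

lemma ideal_Z: "kalg_ideal (free_kalg (lpa_gens E)) (lpa_ideal E :: (('v, 'e) lpa_gen list \<Rightarrow>\<^sub>0 'k) set)"
  by (rule kalg_ideal_lpa_ideal(1)) unfold_locales

lemmas idf = ideal_facts[OF ideal_Z]

lemma lpa_ideal_Car: "lpa_ideal E \<subseteq> Car"
  using ideal_Z by (simp add: kalg_ideal_def ksubspace_def)

lemma Car_iff: "x \<in> Car \<longleftrightarrow> Poly_Mapping.keys x \<subseteq> lists (lpa_gens E) - {[]}"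
  by (simp add: free_kalg_def)

lemma Car_augm: "x \<in> Car \<Longrightarrow> x \<in> augm"
  by (auto simp: Car_iff augm_def in_keys_iff)

lemma res_Car: "x \<in> Car \<Longrightarrow> res x = x"
  by (rule restr_id) (auto simp: Car_iff)

lemma res_in_Car: "x \<in> augm \<Longrightarrow> res x \<in> Car"
  using keys_restr[of "lpa_gens E" x] by (auto simp: Car_iff augm_def in_keys_iff lookup_restr split: if_splits)

lemma augm_iff_res: "res x \<in> Car \<longleftrightarrow> x \<in> augm"
proof
  assume "res x \<in> Car"
  then have "Poly_Mapping.lookup (res x) [] = 0" using Car_augm by (simp add: augm_def)
  then show "x \<in> augm" by (simp add: augm_def lookup_restr)
qed (rule res_in_Car)

lemma Z_augm: "Z \<subseteq> augm"
  using lpa_ideal_Car augm_iff_res by (auto simp: Z_def)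

lemma subspace_Z: "fa.subspace Z"
  unfolding fa.subspace_def by (auto simp: Z_def restr_zero restr_add restr_scale idf)

lemma subspace_augm: "fa.subspace augm"
  unfolding fa.subspace_def by (auto simp: augm_def lookup_add lookup_scal_mult)

lemma augm_decomp: "\<exists>c y. y \<in> augm \<and> x = scal c + y"
proof (intro exI conjI)
  show "x = scal (Poly_Mapping.lookup x []) + (x - scal (Poly_Mapping.lookup x []))" by simp
  show "x - scal (Poly_Mapping.lookup x []) \<in> augm" by (simp add: augm_def lookup_minus)
qed

lemma res_scal: "res (scal c) = scal c"
  by (rule restr_id) auto

text \<open>The factor \<open>a\<close> may have a constant term: that part acts as a scalar and
  preserves the subspace \<open>lpa_ideal E\<close>, while the rest restricts to an element of the
  free non-unital algebra.\<close>

lemma Z_mult: assumes "x \<in> Z" shows "a * x \<in> Z" "x * a \<in> Z"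
proof -
  obtain c y where y: "y \<in> augm" "a = scal c + y" using augm_decomp by blast
  have x: "res x \<in> lpa_ideal E" using assms by (simp add: Z_def)
  have "scal c * res x + res y * res x \<in> lpa_ideal E"
    by (intro idf x res_in_Car y)
  then show "a * x \<in> Z" unfolding Z_def y(2) by (simp add: restr_mult restr_add res_scal distrib_right)
  have "scal c * res x + res x * res y \<in> lpa_ideal E"
    by (intro idf x res_in_Car y)
  then show "x * a \<in> Z" unfolding Z_def y(2) by (simp add: restr_mult restr_add res_scal distrib_left single_Nil_commute)
qed

lemma eqv_refl[simp]: "x \<approx> x"
  by (simp add: eqv_def fa.subspace_0[OF subspace_Z])

lemma eqv_sym: "x \<approx> y \<Longrightarrow> y \<approx> x"
  using fa.subspace_neg[OF subspace_Z, of "x - y"] by (simp add: eqv_def)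

lemma eqv_trans[trans]: "x \<approx> y \<Longrightarrow> y \<approx> z \<Longrightarrow> x \<approx> z"
  using fa.subspace_add[OF subspace_Z, of "x - y" "y - z"] by (simp add: eqv_def)

lemma eqv_add: "x \<approx> y \<Longrightarrow> x' \<approx> y' \<Longrightarrow> x + x' \<approx> y + y'"
  using fa.subspace_add[OF subspace_Z, of "x - y" "x' - y'"] by (simp add: eqv_def algebra_simps)

lemma eqv_diff: "x \<approx> y \<Longrightarrow> x' \<approx> y' \<Longrightarrow> x - x' \<approx> y - y'"
  using fa.subspace_diff[OF subspace_Z, of "x - y" "x' - y'"] by (simp add: eqv_def algebra_simps)

lemma eqv_mult: assumes "x \<approx> y" "x' \<approx> y'" shows "x * x' \<approx> y * y'"
proof -
  have "(x - y) * x' + y * (x' - y') \<in> Z"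
    using assms by (intro fa.subspace_add[OF subspace_Z] Z_mult) (simp_all add: eqv_def)
  then show ?thesis by (simp add: eqv_def algebra_simps)
qed

lemma eqv_left: "x \<approx> y \<Longrightarrow> a * x \<approx> a * y"
  and eqv_right: "x \<approx> y \<Longrightarrow> x * a \<approx> y * a"
  by (simp_all add: eqv_mult)

lemma eqv_sum: "(\<And>i. i \<in> I \<Longrightarrow> f i \<approx> g i) \<Longrightarrow> sum f I \<approx> sum g I"
  by (induction I rule: infinite_finite_induct) (auto intro: eqv_add)

lemma eqv_zero_left: "x \<approx> 0 \<Longrightarrow> a * x \<approx> 0" and eqv_zero_right: "x \<approx> 0 \<Longrightarrow> x * a \<approx> 0"
  using eqv_left[of x 0] eqv_right[of x 0] by simp_all

lemma eqv_zero_iff: "x \<approx> 0 \<longleftrightarrow> x \<in> Z"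
  by (simp add: eqv_def)

section \<open>Lie ideals as subspaces of the free algebra\<close>

definition lie_sub :: "(('v, 'e) lpa_gen list \<Rightarrow>\<^sub>0 'k) set \<Rightarrow> bool" where
  "lie_sub U \<longleftrightarrow> fa.subspace U \<and> Z \<subseteq> U \<and> U \<subseteq> augm \<and> (\<forall>u\<in>U. \<forall>a. u * a - a * u \<in> U)"

text \<open>Constant terms are central, so bracketing with an arbitrary \<open>a\<close>, as in
  \<open>lie_sub\<close>, amounts to bracketing with an element of \<open>augm\<close>.\<close>

lemma lie_sub_commutator_scal:
  assumes "a = scal c + y" shows "u * a - a * u = u * y - y * (u :: ('v, 'e) lpa_gen list \<Rightarrow>\<^sub>0 'k)"
  unfolding assms by (simp add: algebra_simps single_Nil_commute)

lemma leavitt_ops: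
  assumes "x \<in> Car" "y \<in> Car"
  shows "kadd (leavitt K E) (cls x) (cls y) = cls (x + y)"
    and "kdiff (leavitt K E) (cls x) (cls y) = cls (x - y)"
    and "kmult (leavitt K E) (cls x) (cls y) = cls (x * y)"
    and "kscale (leavitt K E) c (cls x) = cls (scal c * x)"
  unfolding leavitt_def by (simp_all add: kquot_ops[OF ideal_Z assms])

lemma leavitt_carrier: "kcarrier (leavitt K E) = cls ` Car"
  unfolding leavitt_def by (rule kquot_carrier[OF ideal_Z])

lemma leavitt_zero: "kzero (leavitt K E) = cls 0"
  by (simp add: leavitt_def kquot_def free_kalg_def)

lemmas cls_eq = cls_eq_iff[OF ideal_Z]
lemmas Car_facts = carrier_facts[OF ideal_Z]

lemma cls_res_eqv: "x \<in> augm \<Longrightarrow> y \<in> augm \<Longrightarrow> cls (res x) = cls (res y) \<longleftrightarrow> x \<approx> y"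
  by (simp add: cls_eq res_in_Car eqv_def Z_def restr_diff)

lemma augm_mult: "x \<in> augm \<Longrightarrow> x * a \<in> augm" "x \<in> augm \<Longrightarrow> a * x \<in> augm"
proof -
  have *: "x * y \<in> augm" if "x \<in> augm" "y \<in> augm" for x y
  proof -
    have "[] \<notin> Poly_Mapping.keys x" using that by (simp add: augm_def in_keys_iff)
    then have "[] \<notin> {a + b |a b. a \<in> Poly_Mapping.keys x \<and> b \<in> Poly_Mapping.keys y}"
      by (auto simp: plus_list_def)
    then have "[] \<notin> Poly_Mapping.keys (x * y)" using keys_mult[of x y] by blast
    then show ?thesis by (simp add: augm_def in_keys_iff)
  qed
  obtain c y where y: "y \<in> augm" "a = scal c + y" using augm_decomp by blast
  show "x * a \<in> augm" "a * x \<in> augm" if "x \<in> augm"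
    unfolding y(2) using that y(1)
    by (auto simp: distrib_left distrib_right single_Nil_commute
        intro!: fa.subspace_add[OF subspace_augm] fa.subspace_scale[OF subspace_augm] *)
qed

text \<open>Images and full preimages under the class map translate between Lie ideals and
  \<open>lie_sub\<close>. Right multiplication suffices in the second statement, because
  \<open>a * u\<close> differs from \<open>u * a\<close> by a commutator that lies in the set
  anyway.\<close>

lemma all_lie_ideals_ideals_iff:
  "(\<forall>U. lie_ideal (leavitt K E) U \<longrightarrow> ring_ideal (leavitt K E) U) \<longleftrightarrow>
   (\<forall>U. lie_sub U \<longrightarrow> (\<forall>u\<in>U. \<forall>a. u * a \<in> U))" (is "?L \<longleftrightarrow> ?R")
proof
  assume L: ?L
  show ?R
  proof (intro allI impI ballI)
    fix U u a assume U: "lie_sub U" and u: "u \<in> U"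
    have sub: "fa.subspace U" "Z \<subseteq> U" "U \<subseteq> augm" "\<And>u a. u \<in> U \<Longrightarrow> u * a - a * u \<in> U"
      using U by (auto simp: lie_sub_def)
    let ?U = "cls ` (U \<inter> Car)"
    have "lie_ideal (leavitt K E) ?U"
      unfolding lie_ideal_def ksubspace_def kcommutator_def leavitt_carrier leavitt_zero
      using sub(1)
      by (auto simp: leavitt_ops Car_facts fa.subspace_def intro!: imageI sub)
    then have "ring_ideal (leavitt K E) ?U" using L by blast
    then have id: "kmult (leavitt K E) (cls x) (cls b) \<in> ?U" if "x \<in> U \<inter> Car" "b \<in> Car" for x b
      using that unfolding ring_ideal_def leavitt_carrier by blast
    \<comment> \<open>As \<open>U\<close> contains \<open>Z\<close>, it is a union of congruence
      classes.\<close>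
    have cong: "y \<in> U" if "x \<in> U" "x \<approx> y" for x y
      using fa.subspace_diff[OF sub(1) that(1), of "x - y"] that(2) sub(2) by (auto simp: eqv_def)
    have res_eqv: "res x \<approx> x" if "x \<in> augm" for x
      using that res_Car[OF res_in_Car[OF that]]
      by (simp add: eqv_def Z_def restr_diff idf)
    obtain c y where y: "y \<in> augm" "a = scal c + y" using augm_decomp by blast
    have u': "u \<in> augm" using u sub by blast
    have ru: "res u \<in> U \<inter> Car" using cong[OF u eqv_sym[OF res_eqv[OF u']]] res_in_Car[OF u'] by simp
    from id[OF ru res_in_Car[OF y(1)]] obtain z where z: "z \<in> U" "z \<in> Car" "cls (res u * res y) = cls z"
      using ru by (auto simp: leavitt_ops res_in_Car[OF y(1)])
    have "res u * res y - z \<in> lpa_ideal E"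
      using z ru y(1) by (simp add: cls_eq Car_facts res_in_Car)
    then have "z \<approx> u * y"
      using z(2) by - (rule eqv_sym, simp add: eqv_def Z_def restr_diff restr_mult res_Car)
    then have "u * y \<in> U" using cong z by blast
    moreover have "scal c * u \<in> U" using fa.subspace_scale[OF sub(1) u] .
    ultimately show "u * a \<in> U"
      using fa.subspace_add[OF sub(1)] by (simp add: y(2) distrib_left single_Nil_commute)
  qed
next
  assume R: ?R
  show ?L
  proof (intro allI impI)
    fix W assume W: "lie_ideal (leavitt K E) W"
    let ?U = "{x \<in> augm. cls (res x) \<in> W}"
    have W': "W \<subseteq> cls ` Car" "cls 0 \<in> W"
      "\<And>x y. cls x \<in> W \<Longrightarrow> cls y \<in> W \<Longrightarrow> x \<in> Car \<Longrightarrow> y \<in> Car \<Longrightarrow> cls (x + y) \<in> W"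
      "\<And>x c. cls x \<in> W \<Longrightarrow> x \<in> Car \<Longrightarrow> cls (scal c * x) \<in> W"
      "\<And>x y. cls x \<in> W \<Longrightarrow> x \<in> Car \<Longrightarrow> y \<in> Car \<Longrightarrow> cls (x * y - y * x) \<in> W"
          apply (use W in \<open>auto simp: lie_ideal_def ksubspace_def leavitt_carrier leavitt_zero kcommutator_def\<close>)
        apply (metis leavitt_ops(1))
       apply (metis leavitt_ops(4))
      by (metis (no_types, lifting) imageI leavitt_ops(2,3) Car_facts(4))
    have sub: "fa.subspace ?U"
      unfolding fa.subspace_def
      by (auto simp: restr_zero restr_add restr_scale W' res_in_Car
          fa.subspace_0[OF subspace_augm] fa.subspace_add[OF subspace_augm] fa.subspace_scale[OF subspace_augm])
    have "lie_sub ?U"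
      unfolding lie_sub_def
    proof (intro conjI sub ballI allI subsetI)
      fix x assume "x \<in> Z"
      moreover from this have "x \<in> augm" using Z_augm by blast
      moreover from calculation have "cls (res x) = cls 0"
        using cls_eq[of "res x" 0] by (simp add: Z_def res_in_Car Car_facts)
      ultimately show "x \<in> ?U" using W' by simp
    next
      fix u a assume u: "u \<in> ?U"
      obtain c y where y: "y \<in> augm" "a = scal c + y" using augm_decomp by blast
      show "u * a - a * u \<in> ?U"
        unfolding lie_sub_commutator_scal[OF y(2)]
        using u y W'(5)[of "res u" "res y"]
        by (auto simp: restr_diff restr_mult res_in_Car intro!: fa.subspace_diff[OF subspace_augm] augm_mult)
    qed auto
    then have id: "u * a \<in> ?U" if "u \<in> ?U" for u a using R that by blast
    have idl: "a * u \<in> ?U" if "u \<in> ?U" for u a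
    proof -
      have "u * a - a * u \<in> ?U" using \<open>lie_sub ?U\<close> that unfolding lie_sub_def by blast
      from fa.subspace_diff[OF sub id[OF that, of a] this] show ?thesis by (simp only: diff_diff_eq2 add_diff_cancel_left')
    qed
    show "ring_ideal (leavitt K E) W"
      unfolding ring_ideal_def leavitt_carrier leavitt_zero
    proof (intro conjI ballI W')
      fix x y assume xy: "x \<in> W" "y \<in> W"
      then obtain x' y' where *: "x = cls x'" "y = cls y'" "x' \<in> Car" "y' \<in> Car" using W'(1) by blast
      then have "x' \<in> ?U" "y' \<in> ?U" using xy by (auto simp: Car_augm res_Car)
      then have "x' - y' \<in> ?U" by (rule fa.subspace_diff[OF sub])
      then show "kdiff (leavitt K E) x y \<in> W" using * by (simp add: leavitt_ops res_Car Car_facts)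
    next
      fix x y assume xy: "x \<in> W" "y \<in> cls ` Car"
      then obtain x' y' where *: "x = cls x'" "y = cls y'" "x' \<in> Car" "y' \<in> Car" using W'(1) by blast
      then have "x' \<in> ?U" using xy by (auto simp: Car_augm res_Car)
      then have "x' * y' \<in> ?U" "y' * x' \<in> ?U" using id idl by blast+
      then show "kmult (leavitt K E) x y \<in> W" "kmult (leavitt K E) y x \<in> W"
        using * by (simp_all add: leavitt_ops res_Car Car_facts)
    qed
  qed
qed

section \<open>The defining relations and products of paths with ghost paths\<close>

lemma rels_Z: "lpa_rels E \<subseteq> Z"
proof
  fix x :: "('v, 'e) lpa_gen list \<Rightarrow>\<^sub>0 'k" assume x: "x \<in> lpa_rels E"
  have wf: "wf_digraph E" by unfold_locales
  have "x \<in> Car" "x \<in> lpa_ideal E" using x kalg_ideal_lpa_ideal(2)[OF wf] lpa_rels_carrier[OF wf] by auto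
  then show "x \<in> Z" by (simp add: Z_def res_Car)
qed

lemma notin_gens: "g \<notin> lpa_gens E \<Longrightarrow> mon [g] \<approx> 0"
  by (simp add: eqv_def Z_def restr_mon idf)

lemma V_zero: "v \<notin> verts E \<Longrightarrow> V v \<approx> 0"
  by (rule notin_gens) (auto simp: lpa_gens_def)

lemma A_zero: "e \<notin> arcs E \<Longrightarrow> A e \<approx> 0"
  by (rule notin_gens) (auto simp: lpa_gens_def)

lemma G_zero: "e \<notin> arcs E \<Longrightarrow> G e \<approx> 0"
  by (rule notin_gens) (auto simp: lpa_gens_def)

lemma VV: "V v * V w \<approx> (if v = w then V v else 0)"
proof (cases "v \<in> verts E \<and> w \<in> verts E")
  case True
  then have "V v * V w - (if v = w then V v else 0) \<in> lpa_rels E" unfolding lpa_rels_def by blast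
  then show ?thesis using rels_Z by (auto simp: eqv_def)
next
  case False
  then show ?thesis using V_zero by (auto intro: eqv_zero_left eqv_zero_right eqv_trans[OF _ eqv_sym])
qed

lemma VA: "e \<in> arcs E \<Longrightarrow> V (tail E e) * A e \<approx> A e"
  and AV: "e \<in> arcs E \<Longrightarrow> A e * V (head E e) \<approx> A e"
  and VG: "e \<in> arcs E \<Longrightarrow> V (head E e) * G e \<approx> G e"
  and GV: "e \<in> arcs E \<Longrightarrow> G e * V (tail E e) \<approx> G e"
  unfolding eqv_def by (rule subsetD[OF rels_Z], unfold lpa_rels_def, blast)+

lemma GA: "e \<in> arcs E \<Longrightarrow> f \<in> arcs E \<Longrightarrow> G e * A f \<approx> (if e = f then V (head E e) else 0)"
  unfolding eqv_def by (rule subsetD[OF rels_Z], unfold lpa_rels_def, blast)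

lemma CK2: "regular_vertex E v \<Longrightarrow> V v \<approx> (\<Sum>e\<in>out_arcs E v. A e * G e)"
  unfolding eqv_def by (rule subsetD[OF rels_Z], unfold lpa_rels_def, blast)

lemma V_idem: "V v * V v \<approx> V v"
  using VV[of v v] by simp

text \<open>Inserting the two idempotents between the factors puts \<open>V u * V w\<close>, hence
  0, in the middle.\<close>

lemma orth: assumes "x * V u \<approx> x" "V w * y \<approx> y" "u \<noteq> w" shows "x * y \<approx> 0"
proof -
  have "x * y \<approx> (x * V u) * (V w * y)" by (intro eqv_mult eqv_sym[OF assms(1)] eqv_sym[OF assms(2)])
  also have "\<dots> = x * ((V u * V w) * y)" by (simp only: mult.assoc)
  also have "\<dots> \<approx> 0" using VV[of u w] assms(3) by - (rule eqv_zero_left, rule eqv_zero_right, simp)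
  finally show ?thesis .
qed

lemma VA_ne: "v \<noteq> tail E e \<Longrightarrow> V v * A e \<approx> 0"
  and VG_ne: "v \<noteq> head E e \<Longrightarrow> V v * G e \<approx> 0"
  and AV_ne: "v \<noteq> head E e \<Longrightarrow> A e * V v \<approx> 0"
  and GV_ne: "v \<noteq> tail E e \<Longrightarrow> G e * V v \<approx> 0"
  by (cases "e \<in> arcs E";
      auto intro: orth[OF V_idem VA] orth[OF V_idem VG] orth[OF AV V_idem] orth[OF GV V_idem]
        eqv_zero_left eqv_zero_right A_zero G_zero)+

text \<open>For the empty list these are the unit of the ambient free algebra and not a vertex.
  Paths therefore appear below as \<open>PA q * V w\<close> and ghost paths as
  \<open>V w * GH q\<close>, with the end vertex written out.\<close>

abbreviation PA :: "'e list \<Rightarrow> (('v, 'e) lpa_gen list \<Rightarrow>\<^sub>0 'k)" where "PA q \<equiv> mon (map Arc q)"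
abbreviation GH :: "'e list \<Rightarrow> (('v, 'e) lpa_gen list \<Rightarrow>\<^sub>0 'k)" where "GH q \<equiv> mon (map Ghost (rev q))"

lemma PA_Cons: "PA (e # q) = A e * PA q" and PA_append: "PA (q @ r) = PA q * PA r"
  and GH_Cons: "GH (e # q) = GH q * G e" and GH_append: "GH (q @ r) = GH r * GH q"
  by (simp_all add: mon_mult)

text \<open>An exchange of end vertices is the form that survives for \<open>q = []\<close>, since
  \<open>PA [] = 1\<close> absorbs no vertex.\<close>

lemma VP: "awalk u q w \<Longrightarrow> V u * PA q \<approx> PA q * V w"
proof (induction q arbitrary: u)
  case Nil
  then show ?case by (simp add: awalk_Nil_iff mon_Nil)
next
  case (Cons e q)
  then have e: "e \<in> arcs E" "u = tail E e" and q: "awalk (head E e) q w" by (auto simp: awalk_Cons_iff)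
  have "V u * PA (e # q) = (V u * A e) * PA q" by (simp only: PA_Cons mult.assoc)
  also have "\<dots> \<approx> A e * PA q" using VA[OF e(1)] e(2) by (intro eqv_right) simp
  also have "\<dots> \<approx> (A e * V (head E e)) * PA q" by (rule eqv_right, rule eqv_sym, rule AV[OF e(1)])
  also have "\<dots> = A e * (V (head E e) * PA q)" by (simp only: mult.assoc)
  also have "\<dots> \<approx> A e * (PA q * V w)" by (rule eqv_left, rule Cons.IH[OF q])
  also have "\<dots> = PA (e # q) * V w" by (simp only: PA_Cons mult.assoc)
  finally show ?case .
qed

lemma GP: "awalk u q w \<Longrightarrow> GH q * V u \<approx> V w * GH q"
proof (induction q arbitrary: u)
  case Nil
  then show ?case by (simp add: awalk_Nil_iff mon_Nil)
next
  case (Cons e q)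
  then have e: "e \<in> arcs E" "u = tail E e" and q: "awalk (head E e) q w" by (auto simp: awalk_Cons_iff)
  have "GH (e # q) * V u = GH q * (G e * V u)" by (simp only: GH_Cons mult.assoc)
  also have "\<dots> \<approx> GH q * G e" using GV[OF e(1)] e(2) by (intro eqv_left) simp
  also have "\<dots> \<approx> GH q * (V (head E e) * G e)" by (rule eqv_left, rule eqv_sym, rule VG[OF e(1)])
  also have "\<dots> = (GH q * V (head E e)) * G e" by (simp only: mult.assoc)
  also have "\<dots> \<approx> (V w * GH q) * G e" by (rule eqv_right, rule Cons.IH[OF q])
  also have "\<dots> = V w * GH (e # q)" by (simp only: GH_Cons mult.assoc)
  finally show ?case .
qed

lemma VP_idem: assumes "awalk u q w" shows "V u * (PA q * V w) \<approx> PA q * V w"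
proof -
  have "V u * (PA q * V w) = (V u * PA q) * V w" by (simp only: mult.assoc)
  also have "\<dots> \<approx> (PA q * V w) * V w" by (rule eqv_right[OF VP[OF assms]])
  also have "\<dots> = PA q * (V w * V w)" by (simp only: mult.assoc)
  also have "\<dots> \<approx> PA q * V w" using VV[of w w] by (intro eqv_left) simp
  finally show ?thesis .
qed

lemma VP_ne: "awalk u q w \<Longrightarrow> x \<noteq> u \<Longrightarrow> V x * (PA q * V w) \<approx> 0"
  by (rule orth[OF V_idem VP_idem])

lemma GP_idem: assumes "awalk u q w" shows "(V w * GH q) * V u \<approx> V w * GH q"
proof -
  have "(V w * GH q) * V u = V w * (GH q * V u)" by (simp only: mult.assoc)
  also have "\<dots> \<approx> V w * (V w * GH q)" by (rule eqv_left[OF GP[OF assms]])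
  also have "\<dots> = (V w * V w) * GH q" by (simp only: mult.assoc)
  also have "\<dots> \<approx> V w * GH q" using VV[of w w] by (intro eqv_right) simp
  finally show ?thesis .
qed

lemma GP_ne: "awalk u q w \<Longrightarrow> x \<noteq> u \<Longrightarrow> (V w * GH q) * V x \<approx> 0"
  by (rule orth[OF GP_idem V_idem not_sym])

lemma GH_PA: "awalk u q w \<Longrightarrow> GH q * (V u * PA q) \<approx> V w"
proof (induction q arbitrary: u)
  case Nil
  then show ?case by (simp add: awalk_Nil_iff mon_Nil)
next
  case (Cons e q)
  then have e: "e \<in> arcs E" "u = tail E e" and q: "awalk (head E e) q w" by (auto simp: awalk_Cons_iff)
  have "GH (e # q) * (V u * PA (e # q)) = GH q * (G e * (V u * A e)) * PA q" by (simp only: GH_Cons PA_Cons mult.assoc)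
  also have "\<dots> \<approx> GH q * (G e * A e) * PA q"
    using VA[OF e(1)] e(2) by (intro eqv_left eqv_right) simp
  also have "\<dots> \<approx> GH q * V (head E e) * PA q"
    using GA[OF e(1) e(1)] by (intro eqv_left eqv_right) simp
  also have "\<dots> = GH q * (V (head E e) * PA q)" by (simp only: mult.assoc)
  also have "\<dots> \<approx> V w" by (rule Cons.IH[OF q])
  finally show ?case .
qed

lemma ghost_path_longer:
  assumes "awalk d q x" "awalk x r w"
  shows "(V x * GH q) * (PA (q @ r) * V w) \<approx> PA r * V w"
proof -
  have "(V x * GH q) * (PA (q @ r) * V w) \<approx> ((GH q) * V d) * (PA (q @ r) * V w)"
    by (rule eqv_right, rule eqv_sym, rule GP[OF assms(1)])
  also have "\<dots> = GH q * (V d * PA q) * (PA r * V w)" by (simp only: PA_append mult.assoc)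
  also have "\<dots> \<approx> V x * (PA r * V w)" by (rule eqv_right, rule GH_PA[OF assms(1)])
  also have "\<dots> \<approx> PA r * V w" by (rule VP_idem[OF assms(2)])
  finally show ?thesis .
qed

text \<open>If neither path is an initial segment of the other, they start at different vertices or
  part at distinct arcs \<open>e\<close> and \<open>f\<close>, where \<open>G e * A f\<close>
  vanishes. The clause \<open>d = s\<close> matters because the empty list is a prefix of every
  list, whatever its vertex.\<close>

lemma ghost_path_zero:
  assumes "awalk d q x" "awalk s p w" "\<not> (\<exists>r. p = q @ r \<and> d = s)" "\<not> (\<exists>r. q = p @ r \<and> d = s)"
  shows "(V x * GH q) * (PA p * V w) \<approx> 0"
  using assms
proof (induction q arbitrary: d s p)
  case Nil
  then have "d = x" "d \<noteq> s" by (auto simp: awalk_Nil_iff)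
  then show ?case using VP_ne[OF Nil(2)] by (simp add: mon_Nil mult.assoc)
next
  case (Cons e q)
  then have e: "e \<in> arcs E" "d = tail E e" and q: "awalk (head E e) q x" by (auto simp: awalk_Cons_iff)
  show ?case
  proof (cases "d = s")
    case False
    then show ?thesis by (rule orth[OF GP_idem[OF Cons.prems(1)] VP_idem[OF Cons.prems(2)]])
  next
    case True
    with Cons.prems obtain f p' where p: "p = f # p'" by (cases p) auto
    with Cons.prems have f: "f \<in> arcs E" and p': "awalk (head E f) p' w" by (auto simp: awalk_Cons_iff)
    have *: "(V x * GH (e # q)) * (PA p * V w) = V x * GH q * ((G e * A f) * (PA p' * V w))"
      by (simp only: p GH_Cons PA_Cons mult.assoc)
    show ?thesis
    proof (cases "e = f")
      case False
      then have "G e * A f \<approx> 0" using GA[OF e(1) f] by simp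
      then show ?thesis unfolding * by - (rule eqv_zero_left, rule eqv_zero_right)
    next
      case ef: True
      have "V x * GH q * ((G e * A f) * (PA p' * V w)) \<approx> V x * GH q * (V (head E f) * (PA p' * V w))"
        using GA[OF e(1) f] ef by (intro eqv_left eqv_right) simp
      also have "\<dots> \<approx> V x * GH q * (PA p' * V w)"
        by (intro eqv_left VP_idem p')
      also have "\<dots> \<approx> 0"
        by (rule Cons.IH[OF q p']) (use Cons.prems True p ef in auto)
      finally show ?thesis unfolding * .
    qed
  qed
qed

end

section \<open>Paths leaving a finite set in an acyclic graph\<close>

text \<open>The paths from \<open>u\<close> up to their first vertex outside \<open>B\<close>. None
  of them is a proper prefix of another one.\<close>

definition exits :: "('v, 'e) pre_digraph \<Rightarrow> 'v set \<Rightarrow> 'v \<Rightarrow> 'e list set" where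
  "exits E B u = {q. q \<noteq> [] \<and> (\<forall>e\<in>set q. tail E e \<in> B) \<and> (\<exists>w. w \<notin> B \<and> pre_digraph.awalk E u q w)}"

text \<open>The finite set \<open>B\<close> takes the place of the ball in the definition of a
  p-commutator graph; \<open>p_commutator_graph_iff\<close> justifies this. Unlike a ball, it can be
  enlarged at will and moved to another graph.\<close>

definition vanishing :: "nat \<Rightarrow> ('v, 'e) pre_digraph \<Rightarrow> 'v \<Rightarrow> bool" where
  "vanishing p E u \<longleftrightarrow> (\<exists>B. finite B \<and> B \<subseteq> verts E \<and> u \<in> B \<and>
     (\<forall>w. p dvd card {q \<in> exits E B u. head E (last q) = w}))"

context wf_digraph
begin

lemma awalk_last_head: "awalk u q w \<Longrightarrow> q \<noteq> [] \<Longrightarrow> head G (last q) = w"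
  by (metis awalk_conv awalk_verts_conv last_snoc)

lemma exits_iff:
  "q \<in> exits G B u \<longleftrightarrow> q \<noteq> [] \<and> (\<forall>e\<in>set q. tail G e \<in> B) \<and> awalk u q (head G (last q)) \<and> head G (last q) \<notin> B"
  unfolding exits_def using awalk_last_head by blast

lemma exits_Cons:
  "e # q \<in> exits G B u \<longleftrightarrow> e \<in> arcs G \<and> tail G e = u \<and> u \<in> B \<and>
     (if head G e \<in> B then q \<in> exits G B (head G e) else q = [])"
proof (cases "q = []")
  case True
  then show ?thesis by (auto simp: exits_iff awalk_Cons_iff awalk_Nil_iff)
next
  case False
  then obtain f r where f: "q = f # r" by (cases q) auto
  then have "tail G f = head G e" if "awalk (head G e) q w" for w
    using that by (auto simp: awalk_Cons_iff)
  then show ?thesis using False f by (auto simp: exits_iff awalk_Cons_iff)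
qed

lemma exits_ne: "q \<in> exits G B y \<Longrightarrow> q \<noteq> []"
  by (simp add: exits_iff)

lemma exits_rec:
  "u \<in> B \<Longrightarrow> exits G B u =
     (\<Union>e\<in>out_arcs G u. (#) e ` (if head G e \<in> B then exits G B (head G e) else {[]}))"
proof -
  assume u: "u \<in> B"
  have "q \<in> exits G B u \<longleftrightarrow>
      q \<in> (\<Union>e\<in>out_arcs G u. (#) e ` (if head G e \<in> B then exits G B (head G e) else {[]}))" for q
    using u by (cases q) (auto simp: exits_Cons exits_iff[of "[]"] out_arcs_def split: if_splits)
  then show ?thesis by blast
qed

text \<open>The arcs between vertices of the finite set \<open>B\<close> form a finite acyclic
  relation, so its converse is well-founded: a claim about \<open>x\<close> may assume the claim for
  all heads that stay in \<open>B\<close>.\<close>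

lemma exit_induct [consumes 3, case_names step]:
  assumes acyc: "acyclic_digraph G" and B: "finite B" "x \<in> B"
    and step: "\<And>x. x \<in> B \<Longrightarrow> (\<And>e. e \<in> out_arcs G x \<Longrightarrow> head G e \<in> B \<Longrightarrow> P (head G e)) \<Longrightarrow> P x"
  shows "P x"
proof -
  let ?r = "arcs_ends G \<inter> B \<times> B"
  have "acyclic ?r"
    unfolding acyclic_def
  proof (intro allI notI)
    fix x assume "(x, x) \<in> ?r\<^sup>+"
    then have "(x, x) \<in> (arcs_ends G)\<^sup>+" by (rule trancl_mono) blast
    then obtain q where q: "awalk x q x" "q \<noteq> []" by (meson reachable1_awalk)
    then have "length q \<ge> 1" by (cases q) auto
    then show False using acyc q(1) unfolding acyclic_digraph_def by blast
  qed
  moreover have "finite ?r" using B by auto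
  ultimately have "wf (?r\<inverse>)" by (rule finite_acyclic_wf_converse[rotated])
  then show ?thesis using B(2)
  proof (induction x rule: wf_induct_rule)
    case (less x)
    show ?case
    proof (rule step[OF less.prems])
      fix e assume e: "e \<in> out_arcs G x" "head G e \<in> B"
      then have "(head G e, x) \<in> ?r\<inverse>" using less.prems
        by (auto simp: arcs_ends_conv out_arcs_def)
      then show "P (head G e)" using less.IH e by blast
    qed
  qed
qed

lemma finite_out: "regular_vertex G x \<Longrightarrow> finite (out_arcs G x)"
  and nonempty_out: "regular_vertex G x \<Longrightarrow> out_arcs G x \<noteq> {}"
  by (auto simp: regular_vertex_def infinite_emitter_def sink_vertex_def)

context
  fixes B
  assumes acyc: "acyclic_digraph G" and fin: "finite B" and reg: "\<And>x. x \<in> B \<Longrightarrow> regular_vertex G x"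
begin

lemma finite_exits: "x \<in> B \<Longrightarrow> finite (exits G B x)"
proof -
  assume x: "x \<in> B"
  show "finite (exits G B x)"
    using acyc fin x
  proof (induction rule: exit_induct)
    case (step x)
    then show ?case using finite_out[OF reg[OF step(1)]] by (subst exits_rec) auto
  qed
qed

lemma exits_nonempty: "x \<in> B \<Longrightarrow> exits G B x \<noteq> {}"
proof -
  assume x: "x \<in> B"
  show "exits G B x \<noteq> {}"
    using acyc fin x
  proof (induction rule: exit_induct)
    case (step x)
    then show ?case using nonempty_out[OF reg[OF step(1)]] by (subst exits_rec) auto
  qed
qed

lemma sum_exits_rec:
  assumes "x \<in> B"
  shows "(\<Sum>q\<in>exits G B x. (h q :: 'c :: comm_monoid_add)) =
    (\<Sum>e\<in>out_arcs G x. if head G e \<in> B then \<Sum>q\<in>exits G B (head G e). h (e # q) else h [e])"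
proof -
  have "(\<Sum>q\<in>exits G B x. h q) =
      (\<Sum>e\<in>out_arcs G x. sum h ((#) e ` (if head G e \<in> B then exits G B (head G e) else {[]})))"
    unfolding exits_rec[OF assms]
    by (rule sum.UNION_disjoint) (use finite_out[OF reg[OF assms]] finite_exits in auto)
  also have "\<dots> = (\<Sum>e\<in>out_arcs G x. if head G e \<in> B then \<Sum>q\<in>exits G B (head G e). h (e # q) else h [e])"
    by (intro sum.cong refl) (auto simp: sum.reindex)
  finally show ?thesis .
qed

text \<open>A discrete mean-value property: replacing a value by the sum over the heads, as long as
  these stay in \<open>B\<close>, leaves only values at the first vertices outside
  \<open>B\<close>.\<close>

lemma harmonic_exits:
  assumes harm: "\<And>x. x \<in> B \<Longrightarrow> (g x :: 'c :: comm_monoid_add) = (\<Sum>e\<in>out_arcs G x. g (head G e))"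
    and x: "x \<in> B"
  shows "g x = (\<Sum>q\<in>exits G B x. g (head G (last q)))"
  using acyc fin x
proof (induction rule: exit_induct)
  case (step x)
  have "(\<Sum>q\<in>exits G B x. g (head G (last q))) =
    (\<Sum>e\<in>out_arcs G x. if head G e \<in> B then \<Sum>q\<in>exits G B (head G e). g (head G (last (e # q))) else g (head G e))"
    using sum_exits_rec[OF step(1), of "\<lambda>q. g (head G (last q))"] by (simp cong: if_cong)
  also have "\<dots> = (\<Sum>e\<in>out_arcs G x. g (head G e))"
    using step(2) by (intro sum.cong refl) (auto intro!: sum.cong dest: exits_ne)
  finally show ?case using harm[OF step(1)] by simp
qed

end

text \<open>The number \<open>g x\<close> of paths from \<open>x\<close> that leave
  \<open>B'\<close> at \<open>w\<close> is harmonic on \<open>B'\<close>, hence on \<open>B\<close>.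
  Expanding \<open>g u\<close> over the exits of \<open>B\<close> gives a sum of terms
  \<open>g y\<close>, each weighted by the number of exit paths to \<open>y\<close>, and these
  weights are divisible by \<open>p\<close>.\<close>

lemma exits_dvd_mono:
  assumes acyc: "acyclic_digraph G" and fin: "finite B'" and reg: "\<And>x. x \<in> B' \<Longrightarrow> regular_vertex G x"
    and sub: "B \<subseteq> B'" and u: "u \<in> B"
    and dvd: "\<And>w. p dvd card {q \<in> exits G B u. head G (last q) = w}"
  shows "p dvd card {q \<in> exits G B' u. head G (last q) = w}"
proof -
  have B: "finite B" "\<And>x. x \<in> B \<Longrightarrow> regular_vertex G x" using fin reg sub finite_subset by blast+
  let ?f = "\<lambda>x. if x = w then 1 else 0 :: nat"
  \<comment> \<open>Outside \<open>B'\<close> the boundary values \<open>?f\<close> are used; with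
    them the recursion for exit paths holds at every vertex of \<open>B'\<close>, including those
    with arcs that leave \<open>B'\<close>.\<close>
  define g where "g x = (if x \<in> B' then \<Sum>q\<in>exits G B' x. ?f (head G (last q)) else ?f x)" for x
  have "g x = (\<Sum>e\<in>out_arcs G x. g (head G e))" if "x \<in> B'" for x
  proof -
    have "g x = (\<Sum>e\<in>out_arcs G x. if head G e \<in> B' then \<Sum>q\<in>exits G B' (head G e). ?f (head G (last (e # q))) else ?f (head G (last [e])))"
      unfolding g_def using that sum_exits_rec[OF acyc fin reg that, of "\<lambda>q. ?f (head G (last q))"] by simp
    also have "\<dots> = (\<Sum>e\<in>out_arcs G x. g (head G e))"
      by (intro sum.cong refl) (auto simp: g_def intro!: sum.cong dest: exits_ne)
    finally show ?thesis .
  qed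
  then have "g u = (\<Sum>q\<in>exits G B u. g (head G (last q)))"
    using sub by (intro harmonic_exits[OF acyc B _ u]) auto
  also have "\<dots> = (\<Sum>y\<in>(\<lambda>q. head G (last q)) ` exits G B u.
      \<Sum>q\<in>{q \<in> exits G B u. head G (last q) = y}. g (head G (last q)))"
    by (rule sum.image_gen[OF finite_exits[OF acyc B u]])
  also have "\<dots> = (\<Sum>y\<in>(\<lambda>q. head G (last q)) ` exits G B u. card {q \<in> exits G B u. head G (last q) = y} * g y)"
    by (intro sum.cong refl) simp
  finally have "p dvd g u" using dvd by (simp add: dvd_sum)
  moreover have "g u = card {q \<in> exits G B' u. head G (last q) = w}"
  proof -
    have "u \<in> B'" using u sub by blast
    then have "g u = (\<Sum>q\<in>exits G B' u. ?f (head G (last q)))" by (simp add: g_def)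
    also have "\<dots> = card {q \<in> exits G B' u. head G (last q) = w}"
      using finite_exits[OF acyc fin reg \<open>u \<in> B'\<close>] by (simp add: sum.If_cases Int_def)
    finally show ?thesis .
  qed
  ultimately show ?thesis by simp
qed

lemma path_dist_le: "path_dist G u v \<le> enat m \<longleftrightarrow> (\<exists>q. awalk u q v \<and> length q \<le> m)"
proof
  assume le: "path_dist G u v \<le> enat m"
  let ?S = "(\<lambda>q. enat (length q)) ` {q. awalk u q v}"
  have "?S \<noteq> {}"
  proof
    assume "?S = {}"
    then have "path_dist G u v = \<infinity>" by (simp only: path_dist_def Inf_enat_def refl if_True)
    then show False using le by simp
  qed
  then have "Inf ?S \<in> ?S" by (metis Inf_enat_def LeastI ex_in_conv)
  then obtain q where "awalk u q v" "path_dist G u v = enat (length q)" unfolding path_dist_def by auto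
  then show "\<exists>q. awalk u q v \<and> length q \<le> m" using le by auto
next
  assume "\<exists>q. awalk u q v \<and> length q \<le> m"
  then obtain q where q: "awalk u q v" "length q \<le> m" by blast
  have "path_dist G u v \<le> enat (length q)" unfolding path_dist_def by (rule INF_lower) (use q in simp)
  then show "path_dist G u v \<le> enat m" using q(2) by (meson enat_ord_simps(1) order_trans)
qed

lemma dist_ball_iff: "v \<in> dist_ball G u m \<longleftrightarrow> (\<exists>q. awalk u q v \<and> length q \<le> m)"
  unfolding dist_ball_def path_dist_le using awalk_last_in_verts by auto

lemma finite_dist_ball:
  assumes "\<And>x. x \<in> verts G \<Longrightarrow> regular_vertex G x"
  shows "finite (dist_ball G u m)"
proof (induction m arbitrary: u)
  case 0
  then show ?case by (rule finite_subset[of _ "{u}"]) (auto simp: dist_ball_iff awalk_Nil_iff)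
next
  case (Suc m)
  show ?case
  proof (cases "u \<in> verts G")
    case True
    have "v \<in> insert u (\<Union>e\<in>out_arcs G u. dist_ball G (head G e) m)" if "v \<in> dist_ball G u (Suc m)" for v
    proof -
      from that obtain q where "awalk u q v" "length q \<le> Suc m" by (auto simp: dist_ball_iff)
      then show ?thesis
        by (cases q) (auto simp: awalk_Cons_iff awalk_Nil_iff dist_ball_iff out_arcs_def)
    qed
    then have "dist_ball G u (Suc m) \<subseteq> insert u (\<Union>e\<in>out_arcs G u. dist_ball G (head G e) m)" by blast
    then show ?thesis
      by (rule finite_subset) (use Suc finite_out[OF assms[OF True]] in auto)
  next
    case False
    then have "dist_ball G u (Suc m) = {}" by (auto simp: dist_ball_iff dest: awalk_hd_in_verts)
    then show ?thesis by simp
  qed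
qed

lemma awalk_take: "awalk u (q @ r) w \<Longrightarrow> \<exists>x. awalk u q x \<and> awalk x r w"
  by (metis awalk_append_iff)

text \<open>The end of an exit path has distance exactly \<open>m + 1\<close>: the tail of its last
  arc is in the ball, and the end itself is not. The restriction to \<open>tl q\<close> loses
  nothing, since the first arc starts at \<open>u\<close>, which lies in the ball.\<close>

lemma exits_dist_ball:
  "{q \<in> exits G (dist_ball G u m) u. head G (last q) = w} =
    (if w \<in> verts G \<and> path_dist G u w = enat (m + 1)
     then {q. awalk u q w \<and> (\<forall>e\<in>set (tl q). tail G e \<in> dist_ball G u m)} else {})"
proof -
  let ?B = "dist_ball G u m"
  have 1: "w \<in> verts G \<and> path_dist G u w = enat (m + 1)" if q: "q \<in> exits G ?B u" "head G (last q) = w" for q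
  proof -
    have *: "q \<noteq> []" "awalk u q w" "w \<notin> ?B" "tail G (last q) \<in> ?B" using q by (auto simp: exits_iff)
    then obtain r where r: "awalk u r (tail G (last q))" "length r \<le> m" by (auto simp: dist_ball_iff)
    have "last q \<in> arcs G" using * last_in_set[of q] by blast
    then have "awalk u (r @ [last q]) w" using r q(2) by (auto simp: awalk_simps)
    then have "path_dist G u w \<le> enat (m + 1)" using r(2) by (subst path_dist_le) (intro exI[of _ "r @ [last q]"], simp)
    moreover have "\<not> path_dist G u w \<le> enat m" using *(2,3) awalk_last_in_verts by (auto simp: dist_ball_def)
    ultimately have "path_dist G u w = enat (m + 1)"
      by (cases "path_dist G u w") auto
    then show ?thesis using * awalk_last_in_verts by auto
  qed
  have 2: "q \<in> exits G ?B u \<and> head G (last q) = w"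
    if w: "path_dist G u w = enat (m + 1)" and q: "awalk u q w" "\<forall>e\<in>set (tl q). tail G e \<in> ?B" for q
  proof -
    have nw: "w \<notin> ?B" using w by (auto simp: dist_ball_def)
    have u: "u \<in> ?B" using q(1) by (auto simp: dist_ball_iff awalk_Nil_iff intro!: exI[of _ "[]"])
    then have "q \<noteq> []" using nw q(1) by (auto simp: awalk_Nil_iff)
    then show ?thesis using q nw u awalk_last_head[OF q(1)]
      by (cases q) (auto simp: exits_iff awalk_Cons_iff)
  qed
  have 3: "\<forall>e\<in>set (tl q). tail G e \<in> ?B" if "q \<in> exits G ?B u" for q
    using that by (cases q) (auto simp: exits_iff)
  have 4: "awalk u q (head G (last q))" if "q \<in> exits G ?B u" for q
    using that by (simp add: exits_iff)
  show ?thesis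
  proof (cases "w \<in> verts G \<and> path_dist G u w = enat (m + 1)")
    case True
    then have "{q \<in> exits G ?B u. head G (last q) = w} = {q. awalk u q w \<and> (\<forall>e\<in>set (tl q). tail G e \<in> ?B)}"
      using 2 3 4 by blast
    then show ?thesis unfolding if_P[OF True] .
  next
    case False
    then have "{q \<in> exits G ?B u. head G (last q) = w} = {}" using 1 by blast
    then show ?thesis unfolding if_not_P[OF False] .
  qed
qed

text \<open>A path from \<open>u\<close> only meets vertices that are reachable from
  \<open>u\<close>.\<close>

lemma exits_cong:
  assumes "\<And>x q. awalk u q x \<Longrightarrow> x \<in> B \<longleftrightarrow> x \<in> B'"
  shows "exits G B u = exits G B' u"
proof -
  have "tail G e \<in> B \<longleftrightarrow> tail G e \<in> B'" if q: "awalk u q w" "e \<in> set q" for q e w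
  proof -
    obtain r s where "q = r @ e # s" using q(2) by (meson split_list)
    then have "\<exists>x. awalk u r x \<and> awalk x (e # s) w" using awalk_take q(1) by blast
    then have "awalk u r (tail G e)" by (auto simp: awalk_Cons_iff)
    then show ?thesis using assms by blast
  qed
  then show ?thesis unfolding exits_def using assms by blast
qed

text \<open>A ball is one admissible choice of \<open>B\<close>. Conversely, \<open>B\<close> is
  united with a ball that contains all its vertices reachable from \<open>u\<close>: divisibility
  survives by \<open>exits_dvd_mono\<close>, and the unreachable vertices may be dropped by
  \<open>exits_cong\<close>.\<close>

lemma p_commutator_graph_iff:
  "p_commutator_graph p G \<longleftrightarrow> acyclic_digraph G \<and> (\<forall>v\<in>verts G. regular_vertex G v) \<and>
     (\<forall>u\<in>verts G. vanishing p G u)"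
proof -
  have "(\<exists>m. \<forall>w\<in>verts G. path_dist G u w = enat (m + 1) \<longrightarrow>
        p dvd card {q. awalk u q w \<and> (\<forall>e\<in>set (tl q). tail G e \<in> dist_ball G u m)}) \<longleftrightarrow> vanishing p G u"
    if acyc: "acyclic_digraph G" and reg: "\<forall>v\<in>verts G. regular_vertex G v" and u: "u \<in> verts G" for u
  proof
    assume "\<exists>m. \<forall>w\<in>verts G. path_dist G u w = enat (m + 1) \<longrightarrow>
        p dvd card {q. awalk u q w \<and> (\<forall>e\<in>set (tl q). tail G e \<in> dist_ball G u m)}"
    then obtain m where m: "\<And>w. w\<in>verts G \<Longrightarrow> path_dist G u w = enat (m + 1) \<Longrightarrow>
        p dvd card {q. awalk u q w \<and> (\<forall>e\<in>set (tl q). tail G e \<in> dist_ball G u m)}" by blast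
    have "p dvd card {q \<in> exits G (dist_ball G u m) u. head G (last q) = w}" for w
      unfolding exits_dist_ball using m by simp
    moreover have "u \<in> dist_ball G u m" using u by (auto simp: dist_ball_iff awalk_Nil_iff intro!: exI[of _ "[]"])
    moreover have "finite (dist_ball G u m)" by (rule finite_dist_ball) (use reg in blast)
    moreover have "dist_ball G u m \<subseteq> verts G" by (auto simp: dist_ball_def)
    ultimately show "vanishing p G u" unfolding vanishing_def by blast
  next
    assume "vanishing p G u"
    then obtain B where B: "finite B" "B \<subseteq> verts G" "u \<in> B"
      "\<And>w. p dvd card {q \<in> exits G B u. head G (last q) = w}" unfolding vanishing_def by blast
    define f where "f x = (SOME q. awalk u q x)" for x
    have f: "awalk u (f x) x" if "awalk u q x" for x q
      unfolding f_def using that by (rule someI)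
    \<comment> \<open>\<open>m\<close> bounds the lengths of chosen paths to the reachable vertices
      of \<open>B\<close>. For unreachable vertices \<open>f\<close> takes an arbitrary value, which
      can only make \<open>m\<close> larger.\<close>
    define m where "m = Max ((\<lambda>x. length (f x)) ` B)"
    have m: "x \<in> dist_ball G u m" if "awalk u q x" "x \<in> B" for q x
    proof -
      have "length (f x) \<le> m" unfolding m_def using B(1) that(2) by (intro Max_ge) auto
      then show ?thesis using f[OF that(1)] by (auto simp: dist_ball_iff)
    qed
    let ?B = "B \<union> dist_ball G u m"
    have "finite ?B" using B(1) finite_dist_ball reg by blast
    moreover have "regular_vertex G x" if "x \<in> ?B" for x using that B(2) reg by (auto simp: dist_ball_def)
    ultimately have "p dvd card {q \<in> exits G ?B u. head G (last q) = w}" for w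
      by (rule exits_dvd_mono[OF acyc _ _ _ B(3,4)]) auto
    moreover have "exits G ?B u = exits G (dist_ball G u m) u"
      by (rule exits_cong) (use m in auto)
    ultimately have dvd: "p dvd card {q \<in> exits G (dist_ball G u m) u. head G (last q) = w}" for w by simp
    show "\<exists>m. \<forall>w\<in>verts G. path_dist G u w = enat (m + 1) \<longrightarrow>
        p dvd card {q. awalk u q w \<and> (\<forall>e\<in>set (tl q). tail G e \<in> dist_ball G u m)}"
    proof (intro exI[of _ m] ballI impI)
      fix w assume "w \<in> verts G" "path_dist G u w = enat (m + 1)"
      then show "p dvd card {q. awalk u q w \<and> (\<forall>e\<in>set (tl q). tail G e \<in> dist_ball G u m)}"
        using dvd[of w] unfolding exits_dist_ball by simp
    qed
  qed
  then show ?thesis unfolding p_commutator_graph_def using wf_digraph_axioms by auto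
qed

end

section \<open>Embeddings that preserve the sets of emitted arcs\<close>

locale hereditary_embedding = G1: wf_digraph G1 + G2: wf_digraph G2
  for G1 :: "('v1, 'e1) pre_digraph" and G2 :: "('v2, 'e2) pre_digraph" +
  fixes f :: "'v1 \<Rightarrow> 'v2" and g :: "'e1 \<Rightarrow> 'e2"
  assumes inj_f: "inj_on f (verts G1)" and inj_g: "inj_on g (arcs G1)"
    and f_verts: "f ` verts G1 \<subseteq> verts G2"
    and ends: "\<And>e. e \<in> arcs G1 \<Longrightarrow> tail G2 (g e) = f (tail G1 e) \<and> head G2 (g e) = f (head G1 e)"
    and out: "\<And>x. x \<in> verts G1 \<Longrightarrow> out_arcs G2 (f x) = g ` out_arcs G1 x"
begin

text \<open>By \<open>out\<close>, every arc emitted by an image vertex comes from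
  \<open>G1\<close>, so a path that starts in the image lifts arc by arc.\<close>

lemma awalk_image:
  "u \<in> verts G1 \<Longrightarrow> G2.awalk (f u) q w \<longleftrightarrow> (\<exists>q' w'. q = map g q' \<and> w = f w' \<and> G1.awalk u q' w')"
proof (induction q arbitrary: u)
  case Nil
  then show ?case using f_verts by (auto simp: G1.awalk_Nil_iff G2.awalk_Nil_iff)
next
  case (Cons e q)
  show ?case
  proof
    assume "G2.awalk (f u) (e # q) w"
    then have e: "e \<in> out_arcs G2 (f u)" and q: "G2.awalk (head G2 e) q w"
      by (auto simp: G2.awalk_Cons_iff)
    from e out[OF Cons.prems] obtain e' where e': "e = g e'" "e' \<in> out_arcs G1 u" by blast
    then have a: "e' \<in> arcs G1" "tail G1 e' = u" "head G1 e' \<in> verts G1" by auto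
    then have "G2.awalk (f (head G1 e')) q w" using q e' ends by simp
    then obtain q' w' where "q = map g q'" "w = f w'" "G1.awalk (head G1 e') q' w'"
      using Cons.IH[OF a(3)] by blast
    then show "\<exists>q' w'. e # q = map g q' \<and> w = f w' \<and> G1.awalk u q' w'"
      using a e' by (intro exI[of _ "e' # q'"] exI[of _ w']) (auto simp: G1.awalk_Cons_iff)
  next
    assume "\<exists>q' w'. e # q = map g q' \<and> w = f w' \<and> G1.awalk u q' w'"
    then obtain e' q' w' where *: "e = g e'" "q = map g q'" "w = f w'" "G1.awalk u (e' # q') w'" by auto
    then have a: "e' \<in> arcs G1" "tail G1 e' = u" "G1.awalk (head G1 e') q' w'" by (auto simp: G1.awalk_Cons_iff)
    then have "e \<in> out_arcs G2 (f u)" using out[OF Cons.prems] * by auto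
    moreover have "G2.awalk (f (head G1 e')) q w" using Cons.IH[of "head G1 e'"] a * by auto
    ultimately show "G2.awalk (f u) (e # q) w" using a * ends by (auto simp: G2.awalk_Cons_iff)
  qed
qed

lemma exits_image:
  assumes u: "u \<in> verts G1"
  shows "exits G2 B (f u) = map g ` exits G1 {x \<in> verts G1. f x \<in> B} u"
proof -
  have tails: "(\<forall>e\<in>set (map g q). tail G2 e \<in> B) \<longleftrightarrow> (\<forall>e\<in>set q. tail G1 e \<in> {x \<in> verts G1. f x \<in> B})"
    if q: "G1.awalk u q w" for q w
  proof -
    have "e \<in> arcs G1" if "e \<in> set q" for e using q that unfolding G1.awalk_def by blast
    then have "tail G2 (g e) \<in> B \<longleftrightarrow> tail G1 e \<in> {x \<in> verts G1. f x \<in> B}" if "e \<in> set q" for e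
      using ends[of e] G1.tail_in_verts[of e] that by simp
    then show ?thesis by simp
  qed
  show ?thesis
  proof (intro subset_antisym subsetI)
    fix q assume "q \<in> exits G2 B (f u)"
    then obtain w where w: "q \<noteq> []" "\<forall>e\<in>set q. tail G2 e \<in> B" "w \<notin> B" "G2.awalk (f u) q w"
      by (auto simp: exits_def)
    then obtain q' w' where q': "q = map g q'" "w = f w'" "G1.awalk u q' w'" using awalk_image[OF u] by blast
    then have "q' \<in> exits G1 {x \<in> verts G1. f x \<in> B} u"
      unfolding exits_def using w tails[OF q'(3)] by auto
    then show "q \<in> map g ` exits G1 {x \<in> verts G1. f x \<in> B} u" using q' by blast
  next
    fix q assume "q \<in> map g ` exits G1 {x \<in> verts G1. f x \<in> B} u"
    then obtain q' w' where q': "q = map g q'" "q' \<noteq> []" "\<forall>e\<in>set q'. tail G1 e \<in> {x \<in> verts G1. f x \<in> B}"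
      "w' \<notin> {x \<in> verts G1. f x \<in> B}" "G1.awalk u q' w'"
      by (auto simp: exits_def)
    then have "f w' \<notin> B" using G1.awalk_last_in_verts by blast
    moreover have "G2.awalk (f u) q (f w')" using awalk_image[OF u] q' by blast
    ultimately show "q \<in> exits G2 B (f u)"
      unfolding exits_def using q' tails[OF q'(5)] by auto
  qed
qed

lemma inj_map_exits: "inj_on (map g) (exits G1 B u)"
proof (rule inj_on_subset[OF inj_on_mapI])
  show "inj_on g (\<Union> (set ` exits G1 B u))"
    by (rule inj_on_subset[OF inj_g]) (auto simp: exits_def G1.awalk_def)
qed simp

lemma card_exits_image:
  assumes u: "u \<in> verts G1" and w: "w \<in> verts G1"
  shows "card {q \<in> exits G2 B (f u). head G2 (last q) = f w} =
    card {q \<in> exits G1 {x \<in> verts G1. f x \<in> B} u. head G1 (last q) = w}"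
proof -
  have *: "head G2 (last (map g q)) = f w \<longleftrightarrow> head G1 (last q) = w" if "q \<in> exits G1 B' u" for q B'
  proof -
    have "q \<noteq> []" "last q \<in> arcs G1"
      using that last_in_set[of q] unfolding G1.exits_iff G1.awalk_def by blast+
    then show ?thesis using ends[of "last q"] inj_f w by (auto simp: last_map dest: inj_onD)
  qed
  have "{q \<in> exits G2 B (f u). head G2 (last q) = f w} =
      map g ` {q \<in> exits G1 {x \<in> verts G1. f x \<in> B} u. head G1 (last q) = w}"
    unfolding exits_image[OF u] using * by auto
  moreover have "inj_on (map g) {q \<in> exits G1 {x \<in> verts G1. f x \<in> B} u. head G1 (last q) = w}"
    by (rule inj_on_subset[OF inj_map_exits]) blast
  ultimately show ?thesis by (simp only: card_image)
qed

text \<open>The finite set is pulled back along \<open>f\<close> in one direction and pushed forward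
  in the other. Paths from \<open>f u\<close> never leave the image, so the exit counts correspond,
  and they are 0 at ends outside the image.\<close>

lemma vanishing_iff:
  assumes u: "u \<in> verts G1"
  shows "vanishing p G2 (f u) \<longleftrightarrow> vanishing p G1 u"
proof
  assume "vanishing p G2 (f u)"
  then obtain B where B: "finite B" "f u \<in> B" "\<And>w. p dvd card {q \<in> exits G2 B (f u). head G2 (last q) = w}"
    unfolding vanishing_def by blast
  let ?B = "{x \<in> verts G1. f x \<in> B}"
  have "finite ?B"
    by (rule finite_imageD[of f]) (auto intro: finite_subset[OF _ B(1)] inj_on_subset[OF inj_f])
  moreover have "p dvd card {q \<in> exits G1 ?B u. head G1 (last q) = w}" for w
  proof (cases "w \<in> verts G1")
    case True
    then show ?thesis using B(3)[of "f w"] card_exits_image[OF u True] by simp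
  next
    case False
    then have "{q \<in> exits G1 ?B u. head G1 (last q) = w} = {}"
      using G1.awalk_last_in_verts by (auto simp: G1.exits_iff)
    then show ?thesis by (simp only: card.empty dvd_0_right)
  qed
  ultimately show "vanishing p G1 u" unfolding vanishing_def using u B(2) by (intro exI[of _ ?B]) auto
next
  assume "vanishing p G1 u"
  then obtain B where B: "finite B" "B \<subseteq> verts G1" "u \<in> B" "\<And>w. p dvd card {q \<in> exits G1 B u. head G1 (last q) = w}"
    unfolding vanishing_def by blast
  have BB: "{x \<in> verts G1. f x \<in> f ` B} = B" using B(2) inj_f by (auto dest: inj_onD)
  have "p dvd card {q \<in> exits G2 (f ` B) (f u). head G2 (last q) = w}" for w
  proof (cases "w \<in> f ` verts G1")
    case True
    then obtain w' where "w = f w'" "w' \<in> verts G1" by blast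
    then show ?thesis using B(4) card_exits_image[OF u, of w' "f ` B"] BB by simp
  next
    case False
    have "head G2 (last q) \<in> f ` verts G1" if q: "q \<in> exits G2 (f ` B) (f u)" for q
    proof -
      have "G2.awalk (f u) q (head G2 (last q))" using q by (simp add: G2.exits_iff)
      then show ?thesis using awalk_image[OF u] G1.awalk_last_in_verts by blast
    qed
    then have "{q \<in> exits G2 (f ` B) (f u). head G2 (last q) = w} = {}" using False by blast
    then show ?thesis by (simp only: card.empty dvd_0_right)
  qed
  moreover have "f ` B \<subseteq> verts G2" using B(2) f_verts by blast
  ultimately show "vanishing p G2 (f u)"
    unfolding vanishing_def using B(1,3) by (intro exI[of _ "f ` B"]) simp
qed

lemma regular_iff:
  assumes x: "x \<in> verts G1" shows "regular_vertex G2 (f x) \<longleftrightarrow> regular_vertex G1 x"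
proof -
  have "finite (g ` out_arcs G1 x) \<longleftrightarrow> finite (out_arcs G1 x)"
    by (rule finite_image_iff, rule inj_on_subset[OF inj_g]) auto
  moreover have "f x \<in> verts G2" using x f_verts by blast
  ultimately show ?thesis using x
    unfolding regular_vertex_def sink_vertex_def infinite_emitter_def out[OF x] by simp
qed

lemma acyclic_image: "acyclic_digraph G2 \<Longrightarrow> acyclic_digraph G1"
proof -
  assume acyc: "acyclic_digraph G2"
  show "acyclic_digraph G1"
    unfolding acyclic_digraph_def
  proof
    assume "\<exists>u q. G1.awalk u q u \<and> 1 \<le> length q"
    then obtain u q where uq: "G1.awalk u q u" "1 \<le> length q" by blast
    then have "G2.awalk (f u) (map g q) (f u)" using awalk_image[OF G1.awalk_hd_in_verts[OF uq(1)]] by blast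
    then show False using acyc uq(2) unfolding acyclic_digraph_def by (metis length_map)
  qed
qed

end

section \<open>Ideals spanned by products of paths and ghost paths\<close>

lemma left_mult_closed:
  fixes S :: "('g list \<Rightarrow>\<^sub>0 'k::field) set"
  assumes S: "fa.subspace S" and gen: "\<And>g x. x \<in> S \<Longrightarrow> mon [g] * x \<in> S" and x: "x \<in> S"
  shows "a * x \<in> S"
proof (rule mon_induct[of "\<lambda>a. a * x \<in> S"])
  show "fa.subspace {a. a * x \<in> S}"
    using S by (auto simp: fa.subspace_def distrib_right mult.assoc)
  show "mon w * x \<in> S" for w
  proof (induction w)
    case (Cons g w)
    have "mon (g # w) = mon [g] * (mon w :: 'g list \<Rightarrow>\<^sub>0 'k)" by (simp add: mon_mult)
    then show ?case using gen[OF Cons] by (simp add: mult.assoc)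
  qed (use x in \<open>simp add: mon_Nil\<close>)
qed

lemma right_mult_closed:
  fixes S :: "('g list \<Rightarrow>\<^sub>0 'k::field) set"
  assumes S: "fa.subspace S" and gen: "\<And>g x. x \<in> S \<Longrightarrow> x * mon [g] \<in> S" and x: "x \<in> S"
  shows "x * a \<in> S"
proof (rule mon_induct[of "\<lambda>a. x * a \<in> S"])
  show "fa.subspace {a. x * a \<in> S}"
    using S by (auto simp: fa.subspace_def distrib_left single_Nil_left_commute)
  show "x * mon w \<in> S" for w
  proof (induction w rule: rev_induct)
    case (snoc g w)
    have "mon (w @ [g]) = mon w * (mon [g] :: 'g list \<Rightarrow>\<^sub>0 'k)" by (simp add: mon_mult)
    then show ?case using gen[OF snoc] by (simp add: mult.assoc)
  qed (use x in \<open>simp add: mon_Nil\<close>)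
qed

context lpa
begin

lemma awalk_end_unique: "awalk u q w \<Longrightarrow> awalk u q w' \<Longrightarrow> w = w'"
  by (metis awlast_if_cas awalk_def)

lemma awalk_split: "awalk u (q @ r) w \<Longrightarrow> awalk u q x \<Longrightarrow> awalk x r w"
  using awalk_take awalk_end_unique by blast

definition path_mon :: "'e list \<Rightarrow> 'v \<Rightarrow> 'e list \<Rightarrow> (('v, 'e) lpa_gen list \<Rightarrow>\<^sub>0 'k)" where
  "path_mon \<alpha> w \<beta> = PA \<alpha> * V w * GH \<beta>"

definition path_mons :: "'v set \<Rightarrow> (('v, 'e) lpa_gen list \<Rightarrow>\<^sub>0 'k) set" where
  "path_mons T = {path_mon \<alpha> w \<beta> | \<alpha> w \<beta>. w \<in> T \<and> (\<exists>u. awalk u \<alpha> w) \<and> (\<exists>u. awalk u \<beta> w)}"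

lemma path_monsI: "w \<in> T \<Longrightarrow> awalk u \<alpha> w \<Longrightarrow> awalk d \<beta> w \<Longrightarrow> path_mon \<alpha> w \<beta> \<in> path_mons T"
  unfolding path_mons_def by blast

text \<open>A letter prolongs \<open>\<alpha>\<close>, cancels its first arc, fixes the monomial or
  kills it. Only a ghost letter in front of an empty \<open>\<alpha>\<close> moves the middle
  vertex, from \<open>tail E e\<close> to \<open>head E e\<close>; closure of \<open>T\<close> under
  heads covers this case.\<close>

lemma gen_times_path_mon:
  assumes T: "\<And>e. e \<in> arcs E \<Longrightarrow> tail E e \<in> T \<Longrightarrow> head E e \<in> T" and m: "m \<in> path_mons T"
  shows "mon [g] * m \<approx> 0 \<or> (\<exists>m'\<in>path_mons T. mon [g] * m \<approx> m')"
proof -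
  from m obtain \<alpha> w \<beta> u d where m: "m = PA \<alpha> * V w * GH \<beta>" and w: "w \<in> T"
    and \<alpha>: "awalk u \<alpha> w" and \<beta>: "awalk d \<beta> w"
    unfolding path_mons_def path_mon_def by blast
  have mem: "PA \<alpha>' * V w' * GH \<beta>' \<in> path_mons T" if "w' \<in> T" "awalk u' \<alpha>' w'" "awalk d' \<beta>' w'" for \<alpha>' \<beta>' w' u' d'
    using that unfolding path_mons_def path_mon_def by blast
  show ?thesis
  proof (cases g)
    case (Vert x)
    show ?thesis
    proof (cases "x = u")
      case True
      have "mon [g] * m \<approx> m"
        unfolding m Vert mult.assoc[symmetric] True
        using eqv_right[OF VP_idem[OF \<alpha>], of "GH \<beta>"] by (simp only: mult.assoc)
      then show ?thesis using mem[OF w \<alpha> \<beta>] unfolding m by blast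
    next
      case False
      have "mon [g] * m \<approx> 0"
        unfolding m Vert using eqv_zero_right[OF VP_ne[OF \<alpha> False], of "GH \<beta>"] by (simp only: mult.assoc)
      then show ?thesis by blast
    qed
  next
    case (Arc e)
    show ?thesis
    proof (cases "e \<in> arcs E \<and> head E e = u")
      case True
      then have "awalk (tail E e) (e # \<alpha>) w" using \<alpha> by (simp add: awalk_Cons_iff)
      from mem[OF w this \<beta>] show ?thesis unfolding m Arc
        by (intro disjI2 bexI) (simp_all only: PA_Cons mult.assoc eqv_refl)
    next
      case False
      then have "mon [g] * m \<approx> 0"
      proof (cases "e \<in> arcs E")
        case True
        with False have "head E e \<noteq> u" by blast
        from eqv_zero_right[OF orth[OF AV[OF True] VP_idem[OF \<alpha>] this], of "GH \<beta>"] show ?thesis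
          unfolding m Arc by (simp only: mult.assoc)
      qed (use Arc A_zero eqv_zero_right in blast)
      then show ?thesis by blast
    qed
  next
    case (Ghost e)
    show ?thesis
    proof (cases "e \<in> arcs E")
      case False
      then show ?thesis using Ghost G_zero eqv_zero_right by blast
    next
      case e: True
      show ?thesis
      proof (cases \<alpha>)
        case Nil
        have m': "mon [g] * m = (G e * V w) * GH \<beta>" unfolding m Ghost Nil by (simp add: mon_Nil mult.assoc)
        show ?thesis
        proof (cases "tail E e = w")
          case True
          have "(G e * V w) * GH \<beta> \<approx> G e * GH \<beta>" using GV[OF e] True by (intro eqv_right) simp
          also have "\<dots> \<approx> (V (head E e) * G e) * GH \<beta>" by (rule eqv_right, rule eqv_sym, rule VG[OF e])
          also have "\<dots> = PA [] * V (head E e) * GH (\<beta> @ [e])"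
            by (simp add: mon_mult)
          finally have "mon [g] * m \<approx> PA [] * V (head E e) * GH (\<beta> @ [e])" unfolding m' .
          moreover have "PA [] * V (head E e) * GH (\<beta> @ [e]) \<in> path_mons T"
            by (rule mem) (use T w True e \<beta> in \<open>auto simp: awalk_simps\<close>)
          ultimately show ?thesis by blast
        next
          case False
          have "(G e * V w) * GH \<beta> \<approx> 0" by (rule eqv_zero_right, rule GV_ne) (use False in simp)
          then show ?thesis unfolding m' by blast
        qed
      next
        case (Cons f \<alpha>')
        then have f: "f \<in> arcs E" and \<alpha>': "awalk (head E f) \<alpha>' w" using \<alpha> by (auto simp: awalk_Cons_iff)
        have m': "mon [g] * m = (G e * A f) * (PA \<alpha>' * V w) * GH \<beta>"
          unfolding m Ghost Cons by (simp only: PA_Cons mult.assoc)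
        show ?thesis
        proof (cases "e = f")
          case True
          have "(G e * A f) * (PA \<alpha>' * V w) * GH \<beta> \<approx> V (head E f) * (PA \<alpha>' * V w) * GH \<beta>"
            using GA[OF e f] True by (intro eqv_right) simp
          also have "\<dots> \<approx> (PA \<alpha>' * V w) * GH \<beta>" by (rule eqv_right, rule VP_idem[OF \<alpha>'])
          finally show ?thesis using mem[OF w \<alpha>' \<beta>] unfolding m' by blast
        next
          case False
          have "(G e * A f) * (PA \<alpha>' * V w) * GH \<beta> \<approx> 0"
            using GA[OF e f] False by - (rule eqv_zero_right, rule eqv_zero_right, simp)
          then show ?thesis unfolding m' by blast
        qed
      qed
    qed
  qed
qed

text \<open>The mirror image of \<open>gen_times_path_mon\<close> under the involution that
  exchanges arcs and ghosts.\<close>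

lemma path_mon_times_gen:
  assumes T: "\<And>e. e \<in> arcs E \<Longrightarrow> tail E e \<in> T \<Longrightarrow> head E e \<in> T" and m: "m \<in> path_mons T"
  shows "m * mon [g] \<approx> 0 \<or> (\<exists>m'\<in>path_mons T. m * mon [g] \<approx> m')"
proof -
  from m obtain \<alpha> w \<beta> u d where m: "m = PA \<alpha> * V w * GH \<beta>" and w: "w \<in> T"
    and \<alpha>: "awalk u \<alpha> w" and \<beta>: "awalk d \<beta> w"
    unfolding path_mons_def path_mon_def by blast
  have mem: "PA \<alpha>' * V w' * GH \<beta>' \<in> path_mons T" if "w' \<in> T" "awalk u' \<alpha>' w'" "awalk d' \<beta>' w'" for \<alpha>' \<beta>' w' u' d'
    using that unfolding path_mons_def path_mon_def by blast
  show ?thesis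
  proof (cases g)
    case (Vert x)
    show ?thesis
    proof (cases "x = d")
      case True
      have "m * mon [g] \<approx> m"
        unfolding m Vert True
        using eqv_left[OF GP_idem[OF \<beta>], of "PA \<alpha>"] by (simp only: mult.assoc)
      then show ?thesis using mem[OF w \<alpha> \<beta>] unfolding m by blast
    next
      case False
      have "m * mon [g] \<approx> 0"
        unfolding m Vert using eqv_zero_left[OF GP_ne[OF \<beta> False], of "PA \<alpha>"] by (simp only: mult.assoc)
      then show ?thesis by blast
    qed
  next
    case (Ghost e)
    show ?thesis
    proof (cases "e \<in> arcs E \<and> head E e = d")
      case True
      then have "awalk (tail E e) (e # \<beta>) w" using \<beta> by (simp add: awalk_Cons_iff)
      from mem[OF w \<alpha> this] show ?thesis unfolding m Ghost
        by (intro disjI2 bexI) (simp_all only: GH_Cons mult.assoc eqv_refl)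
    next
      case False
      then have "m * mon [g] \<approx> 0"
      proof (cases "e \<in> arcs E")
        case True
        with False have "d \<noteq> head E e" by blast
        from eqv_zero_left[OF orth[OF GP_idem[OF \<beta>] VG[OF True] this], of "PA \<alpha>"] show ?thesis
          unfolding m Ghost by (simp only: mult.assoc)
      qed (use Ghost G_zero eqv_zero_left in blast)
      then show ?thesis by blast
    qed
  next
    case (Arc e)
    show ?thesis
    proof (cases "e \<in> arcs E")
      case False
      then show ?thesis using Arc A_zero eqv_zero_left by blast
    next
      case e: True
      show ?thesis
      proof (cases \<beta>)
        case Nil
        have m': "m * mon [g] = PA \<alpha> * (V w * A e)" unfolding m Arc Nil by (simp add: mon_Nil mult.assoc)
        show ?thesis
        proof (cases "tail E e = w")
          case True
          have "PA \<alpha> * (V w * A e) \<approx> PA \<alpha> * A e" using VA[OF e] True by (intro eqv_left) simp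
          also have "\<dots> \<approx> PA \<alpha> * (A e * V (head E e))" by (rule eqv_left, rule eqv_sym, rule AV[OF e])
          also have "\<dots> = PA (\<alpha> @ [e]) * V (head E e) * GH []"
            by (simp add: mon_mult)
          finally have "m * mon [g] \<approx> PA (\<alpha> @ [e]) * V (head E e) * GH []" unfolding m' .
          moreover have "PA (\<alpha> @ [e]) * V (head E e) * GH [] \<in> path_mons T"
            by (rule mem) (use T w True e \<alpha> in \<open>auto simp: awalk_simps\<close>)
          ultimately show ?thesis by blast
        next
          case False
          have "PA \<alpha> * (V w * A e) \<approx> 0" by (rule eqv_zero_left, rule VA_ne) (use False in simp)
          then show ?thesis unfolding m' by blast
        qed
      next
        case (Cons f \<beta>')
        then have f: "f \<in> arcs E" and \<beta>': "awalk (head E f) \<beta>' w" using \<beta> by (auto simp: awalk_Cons_iff)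
        have m': "m * mon [g] = PA \<alpha> * ((V w * GH \<beta>') * (G f * A e))"
          unfolding m Arc Cons by (simp only: GH_Cons mult.assoc)
        show ?thesis
        proof (cases "e = f")
          case True
          have "PA \<alpha> * ((V w * GH \<beta>') * (G f * A e)) \<approx> PA \<alpha> * ((V w * GH \<beta>') * V (head E f))"
            using GA[OF f e] True by (intro eqv_left) simp
          also have "\<dots> \<approx> PA \<alpha> * (V w * GH \<beta>')" by (rule eqv_left, rule GP_idem[OF \<beta>'])
          finally show ?thesis using mem[OF w \<alpha> \<beta>'] unfolding m' by (auto simp: mult.assoc)
        next
          case False
          have "PA \<alpha> * ((V w * GH \<beta>') * (G f * A e)) \<approx> 0"
            using GA[OF f e] False by - (rule eqv_zero_left, rule eqv_zero_left, simp)
          then show ?thesis unfolding m' by blast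
        qed
      qed
    qed
  qed
qed

text \<open>For \<open>T\<close> closed under heads this is the preimage of the ideal generated by
  the vertices in \<open>T\<close>.\<close>

definition path_ideal :: "'v set \<Rightarrow> (('v, 'e) lpa_gen list \<Rightarrow>\<^sub>0 'k) set" where
  "path_ideal T = fa.span (path_mons T \<union> Z)"

lemma subspace_path_ideal: "fa.subspace (path_ideal T)"
  unfolding path_ideal_def by (rule fa.subspace_span)

lemma Z_path_ideal: "x \<in> Z \<Longrightarrow> x \<in> path_ideal T"
  unfolding path_ideal_def by (intro fa.span_base) simp

lemma path_mons_path_ideal: "x \<in> path_mons T \<Longrightarrow> x \<in> path_ideal T"
  unfolding path_ideal_def by (intro fa.span_base) simp

lemma cong_mem: "fa.subspace S \<Longrightarrow> Z \<subseteq> S \<Longrightarrow> x \<approx> y \<Longrightarrow> y \<in> S \<Longrightarrow> x \<in> S"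
  using fa.subspace_add[of S "x - y" y] by (auto simp: eqv_def)

lemma path_ideal_cong: "x \<approx> y \<Longrightarrow> y \<in> path_ideal T \<Longrightarrow> x \<in> path_ideal T"
  using cong_mem[OF subspace_path_ideal] Z_path_ideal by blast

lemma path_ideal_mult:
  assumes T: "\<And>e. e \<in> arcs E \<Longrightarrow> tail E e \<in> T \<Longrightarrow> head E e \<in> T" and x: "x \<in> path_ideal T"
  shows "a * x \<in> path_ideal T" "x * a \<in> path_ideal T"
proof -
  have zero: "0 \<in> path_ideal T" by (rule fa.subspace_0[OF subspace_path_ideal])
  have L: "mon [g] * y \<in> path_ideal T" if "y \<in> path_ideal T" for g y
  proof -
    have "fa.subspace {y. mon [g] * y \<in> path_ideal T}"
      using subspace_path_ideal[of T] by (auto simp: fa.subspace_def distrib_left single_Nil_left_commute)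
    moreover have "path_mons T \<union> Z \<subseteq> {y. mon [g] * y \<in> path_ideal T}"
      using gen_times_path_mon[OF T, of _ g] path_ideal_cong zero path_mons_path_ideal Z_mult Z_path_ideal
      by blast
    ultimately have "path_ideal T \<subseteq> {y. mon [g] * y \<in> path_ideal T}"
      using fa.span_minimal unfolding path_ideal_def by blast
    then show ?thesis using that by blast
  qed
  have R: "y * mon [g] \<in> path_ideal T" if "y \<in> path_ideal T" for g y
  proof -
    have "fa.subspace {y. y * mon [g] \<in> path_ideal T}"
      using subspace_path_ideal[of T] by (auto simp: fa.subspace_def distrib_right mult.assoc)
    moreover have "path_mons T \<union> Z \<subseteq> {y. y * mon [g] \<in> path_ideal T}"
      using path_mon_times_gen[OF T, of _ g] path_ideal_cong zero path_mons_path_ideal Z_mult Z_path_ideal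
      by blast
    ultimately have "path_ideal T \<subseteq> {y. y * mon [g] \<in> path_ideal T}"
      using fa.span_minimal unfolding path_ideal_def by blast
    then show ?thesis using that by blast
  qed
  show "a * x \<in> path_ideal T" by (rule left_mult_closed[OF subspace_path_ideal L x])
  show "x * a \<in> path_ideal T" by (rule right_mult_closed[OF subspace_path_ideal R x])
qed

lemma gen_path_ideal: "mon [g] \<in> path_ideal (verts E)"
proof (cases "g \<in> lpa_gens E")
  case False
  then show ?thesis using notin_gens eqv_zero_iff Z_path_ideal by blast
next
  case True
  then consider v where "g = Vert v" "v \<in> verts E" | e where "g = Arc e" "e \<in> arcs E" | e where "g = Ghost e" "e \<in> arcs E"
    unfolding lpa_gens_def by blast
  then show ?thesis
  proof cases
    case 1
    then have "path_mon [] v [] \<in> path_mons (verts E)"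
      by (intro path_monsI[of _ _ v _ v]) (simp_all add: awalk_Nil_iff)
    from path_mons_path_ideal[OF this] show ?thesis using 1 by (simp add: path_mon_def mon_mult)
  next
    case 2
    then have "path_mon [e] (head E e) [] \<in> path_mons (verts E)"
      by (intro path_monsI[of _ _ "tail E e" _ "head E e"]) (simp_all add: awalk_simps)
    moreover have "mon [g] \<approx> path_mon [e] (head E e) []"
      using eqv_sym[OF AV[OF 2(2)]] 2 by (simp add: path_mon_def mon_mult)
    ultimately show ?thesis using path_mons_path_ideal path_ideal_cong by blast
  next
    case 3
    then have "path_mon [] (head E e) [e] \<in> path_mons (verts E)"
      by (intro path_monsI[of _ _ "head E e" _ "tail E e"]) (simp_all add: awalk_simps)
    moreover have "mon [g] \<approx> path_mon [] (head E e) [e]"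
      using eqv_sym[OF VG[OF 3(2)]] 3 by (simp add: path_mon_def mon_mult)
    ultimately show ?thesis using path_mons_path_ideal path_ideal_cong by blast
  qed
qed

lemma augm_path_ideal: "x \<in> augm \<Longrightarrow> x \<in> path_ideal (verts E)"
proof -
  assume x: "x \<in> augm"
  show ?thesis
  proof (rule subspace_mon[OF subspace_path_ideal])
    fix w assume "w \<in> Poly_Mapping.keys x"
    then have "w \<noteq> []" using x by (auto simp: augm_def in_keys_iff)
    then obtain g v where w: "w = g # v" by (cases w) auto
    have "mon [g] * mon v \<in> path_ideal (verts E)"
      by (rule path_ideal_mult(2)[OF _ gen_path_ideal]) simp
    then show "mon w \<in> path_ideal (verts E)" by (simp add: w mon_mult)
  qed
qed

lemma span_eqv_sum:
  assumes "y \<in> fa.span (f ` X \<union> Z)"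
  shows "\<exists>F c. finite F \<and> F \<subseteq> X \<and> y \<approx> (\<Sum>i\<in>F. scal (c i) * f i)"
proof -
  let ?P = "\<lambda>y. \<exists>F c. finite F \<and> F \<subseteq> X \<and> y \<approx> (\<Sum>i\<in>F. scal (c i) * f i)"
  have "fa.subspace {y. ?P y}"
    unfolding fa.subspace_def
  proof (intro conjI ballI allI)
    show "0 \<in> {y. ?P y}" by (intro CollectI exI[of _ "{}"]) simp
  next
    fix y y' assume "y \<in> {y. ?P y}" "y' \<in> {y. ?P y}"
    then obtain F c F' c' where F: "finite F" "F \<subseteq> X" "y \<approx> (\<Sum>i\<in>F. scal (c i) * f i)"
      and F': "finite F'" "F' \<subseteq> X" "y' \<approx> (\<Sum>i\<in>F'. scal (c' i) * f i)" by blast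
    define d where "d i = (if i \<in> F then c i else 0) + (if i \<in> F' then c' i else 0)" for i
    have "(\<Sum>i\<in>F. scal (c i) * f i) = (\<Sum>i\<in>F \<union> F'. scal (if i \<in> F then c i else 0) * f i)"
      using F(1) F'(1) by (intro sum.mono_neutral_cong_left) auto
    moreover have "(\<Sum>i\<in>F'. scal (c' i) * f i) = (\<Sum>i\<in>F \<union> F'. scal (if i \<in> F' then c' i else 0) * f i)"
      using F(1) F'(1) by (intro sum.mono_neutral_cong_left) auto
    ultimately have "y + y' \<approx> (\<Sum>i\<in>F \<union> F'. scal (d i) * f i)"
      using eqv_add[OF F(3) F'(3)] unfolding d_def by (simp only: fa.scale_left_distrib sum.distrib)
    then show "y + y' \<in> {y. ?P y}" using F F' by (intro CollectI exI[of _ "F \<union> F'"] exI[of _ d]) auto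
  next
    fix b y assume "y \<in> {y. ?P y}"
    then obtain F c where F: "finite F" "F \<subseteq> X" "y \<approx> (\<Sum>i\<in>F. scal (c i) * f i)" by blast
    have "scal b * y \<approx> (\<Sum>i\<in>F. scal (b * c i) * f i)"
      using eqv_left[OF F(3), of "scal b"] by (simp add: sum_distrib_left single_Nil_mult)
    then show "scal b * y \<in> {y. ?P y}" using F(1,2) by (intro CollectI exI[of _ F] exI[of _ "\<lambda>i. b * c i"]) auto
  qed
  moreover have "f ` X \<union> Z \<subseteq> {y. ?P y}"
  proof (intro Un_least subsetI)
    fix y assume "y \<in> f ` X"
    then obtain i where "i \<in> X" "y = f i" by blast
    then show "y \<in> {y. ?P y}"
      by (intro CollectI exI[of _ "{i}"] exI[of _ "\<lambda>_. 1"]) (simp add: single_Nil_one)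
  next
    fix y assume "y \<in> Z"
    then show "y \<in> {y. ?P y}"
      by (intro CollectI exI[of _ "{}"]) (simp add: eqv_zero_iff)
  qed
  ultimately have "fa.span (f ` X \<union> Z) \<subseteq> {y. ?P y}" by (rule fa.span_minimal[rotated])
  then show ?thesis using assms by blast
qed

end

section \<open>Lie ideals of graphs with vanishing exit counts\<close>

context lpa
begin

lemma acyclic_closed: "acyclic_digraph E \<Longrightarrow> awalk u q u \<Longrightarrow> q = []"
proof (rule ccontr)
  assume acyc: "acyclic_digraph E" and q: "awalk u q u" and ne: "q \<noteq> []"
  then have "length q \<ge> 1" by (cases q) auto
  then show False using acyc q unfolding acyclic_digraph_def by blast
qed

text \<open>If one of two paths with the same end \<open>w\<close> is an initial segment of the
  other, the remainder is a closed path at \<open>w\<close>, which is empty by acyclicity. So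
  distinct paths to \<open>w\<close> are orthogonal.\<close>

lemma ghost_path_same:
  assumes acyc: "acyclic_digraph E" and \<alpha>: "awalk s \<alpha> w" and \<beta>: "awalk d \<beta> w"
  shows "(V w * GH \<beta>) * (PA \<alpha> * V w) \<approx> (if \<alpha> = \<beta> then V w else 0)"
proof (cases "\<alpha> = \<beta>")
  case True
  have "w \<in> verts E" by (rule awalk_last_in_verts[OF \<alpha>])
  then have "awalk w [] w" by (simp add: awalk_Nil_iff)
  have "(V w * GH \<beta>) * (PA \<alpha> * V w) = (V w * GH \<beta>) * (PA (\<beta> @ []) * V w)" using True by simp
  also have "\<dots> \<approx> PA [] * V w" by (rule ghost_path_longer) fact+
  also have "\<dots> = V w" by (simp add: mon_mult)
  finally show ?thesis using True by simp
next
  case False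
  have 1: "\<not> (\<exists>r. \<alpha> = \<beta> @ r \<and> d = s)"
  proof
    assume "\<exists>r. \<alpha> = \<beta> @ r \<and> d = s"
    then obtain r where r: "\<alpha> = \<beta> @ r" "d = s" by blast
    then have "awalk w r w" using \<alpha> \<beta> awalk_split by blast
    then show False using acyclic_closed[OF acyc] r False by simp
  qed
  have 2: "\<not> (\<exists>r. \<beta> = \<alpha> @ r \<and> d = s)"
  proof
    assume "\<exists>r. \<beta> = \<alpha> @ r \<and> d = s"
    then obtain r where r: "\<beta> = \<alpha> @ r" "d = s" by blast
    then have "awalk w r w" using \<alpha> \<beta> awalk_split by blast
    then show False using acyclic_closed[OF acyc] r False by simp
  qed
  show ?thesis using ghost_path_zero[OF \<beta> \<alpha> 1 2] False by simp
qed

text \<open>The relation \<open>CK2\<close> is applied repeatedly, to each head that still lies in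
  \<open>B\<close>; \<open>exit_induct\<close> makes this terminate.\<close>

lemma expand_exits:
  assumes acyc: "acyclic_digraph E" and fin: "finite B" and reg: "\<And>x. x \<in> B \<Longrightarrow> regular_vertex E x" and x: "x \<in> B"
  shows "V x \<approx> (\<Sum>q\<in>exits E B x. path_mon q (head E (last q)) q)"
  using acyc fin x
proof (induction rule: exit_induct)
  case (step x)
  have "V x \<approx> (\<Sum>e\<in>out_arcs E x. A e * G e)" by (rule CK2[OF reg[OF step(1)]])
  also have "\<dots> \<approx> (\<Sum>e\<in>out_arcs E x. if head E e \<in> B
      then \<Sum>q\<in>exits E B (head E e). path_mon (e # q) (head E (last (e # q))) (e # q)
      else path_mon [e] (head E (last [e])) [e])"
  proof (rule eqv_sum)
    fix e assume e: "e \<in> out_arcs E x"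
    then have ea: "e \<in> arcs E" by simp
    have *: "A e * G e \<approx> A e * V (head E e) * G e" by (rule eqv_right, rule eqv_sym, rule AV[OF ea])
    show "A e * G e \<approx> (if head E e \<in> B
      then \<Sum>q\<in>exits E B (head E e). path_mon (e # q) (head E (last (e # q))) (e # q)
      else path_mon [e] (head E (last [e])) [e])"
    proof (cases "head E e \<in> B")
      case True
      have "A e * V (head E e) * G e \<approx>
          A e * (\<Sum>q\<in>exits E B (head E e). path_mon q (head E (last q)) q) * G e"
        by (intro eqv_left eqv_right step(2) e True)
      also have "\<dots> = (\<Sum>q\<in>exits E B (head E e). A e * path_mon q (head E (last q)) q * G e)"
        by (simp only: sum_distrib_left sum_distrib_right)
      also have "\<dots> = (\<Sum>q\<in>exits E B (head E e). path_mon (e # q) (head E (last (e # q))) (e # q))"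
      proof (intro sum.cong refl)
        fix q assume "q \<in> exits E B (head E e)"
        then have "q \<noteq> []" by (rule exits_ne)
        then have "last (e # q) = last q" by simp
        then show "A e * path_mon q (head E (last q)) q * G e = path_mon (e # q) (head E (last (e # q))) (e # q)"
          by (simp only: path_mon_def PA_Cons GH_Cons mult.assoc)
      qed
      finally show ?thesis using eqv_trans[OF *] True by simp
    next
      case False
      then show ?thesis using * by (simp add: path_mon_def)
    qed
  qed
  also have "\<dots> = (\<Sum>q\<in>exits E B x. path_mon q (head E (last q)) q)"
    by (rule sum_exits_rec[OF acyc fin reg step(1), symmetric])
  finally show ?case .
qed

lemma sum_ranges_zero:
  assumes fin: "finite Q" and dvd: "\<And>w. CHAR('k) dvd card {q \<in> Q. r q = w}"
  shows "(\<Sum>q\<in>Q. V (r q)) = 0"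
proof -
  have "(\<Sum>q\<in>Q. V (r q)) = (\<Sum>w\<in>r ` Q. \<Sum>q\<in>{q \<in> Q. r q = w}. V (r q))"
    by (rule sum.image_gen[OF fin])
  also have "\<dots> = (\<Sum>w\<in>r ` Q. 0)"
  proof (intro sum.cong refl)
    fix w
    have "(\<Sum>q\<in>{q \<in> Q. r q = w}. V (r q)) = (\<Sum>q\<in>{q \<in> Q. r q = w}. V w)" by (intro sum.cong) auto
    also have "\<dots> = scal (of_nat (card {q \<in> Q. r q = w})) * V w" by (rule fa.sum_constant_scale)
    also have "of_nat (card {q \<in> Q. r q = w}) = (0 :: 'k)" using dvd[of w] by (simp add: of_nat_eq_0_iff_char_dvd)
    finally show "(\<Sum>q\<in>{q \<in> Q. r q = w}. V (r q)) = 0" by simp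
  qed
  finally show ?thesis by simp
qed

text \<open>The products \<open>a q * b q\<close> add up to \<open>V x\<close> by
  \<open>expand_exits\<close>. The reversed product \<open>b q * a q\<close> is the vertex at the
  end of \<open>q\<close>, and these vertices add up to 0, because each occurs a multiple of
  \<open>CHAR('k)\<close> times.\<close>

lemma exit_commutators:
  assumes acyc: "acyclic_digraph E" and fin: "finite B" and reg: "\<And>x. x \<in> B \<Longrightarrow> regular_vertex E x" and x: "x \<in> B"
    and dvd: "\<And>w. CHAR('k) dvd card {q \<in> exits E B x. head E (last q) = w}"
  defines "a \<equiv> \<lambda>q. PA q * V (head E (last q))" and "b \<equiv> \<lambda>q. V (head E (last q)) * GH q"
  shows "V x \<approx> (\<Sum>q\<in>exits E B x. a q * b q - b q * a q)"
proof -
  let ?r = "\<lambda>q. head E (last q)"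
  have "V x \<approx> (\<Sum>q\<in>exits E B x. path_mon q (?r q) q)" by (rule expand_exits[OF acyc fin reg x])
  also have "\<dots> \<approx> (\<Sum>q\<in>exits E B x. (a q * b q - b q * a q) + V (?r q))"
  proof (rule eqv_sum)
    fix q assume "q \<in> exits E B x"
    then have w: "awalk x q (?r q)" by (simp add: exits_iff)
    have "(a q * b q - b q * a q) + V (?r q) \<approx> (PA q * V (?r q) * GH q - V (?r q)) + V (?r q)"
    proof (intro eqv_add eqv_diff)
      have "a q * b q = PA q * (V (?r q) * V (?r q)) * GH q" by (simp only: a_def b_def mult.assoc)
      also have "\<dots> \<approx> PA q * V (?r q) * GH q" using VV[of "?r q" "?r q"] by (intro eqv_left eqv_right) simp
      finally show "a q * b q \<approx> PA q * V (?r q) * GH q" .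
      show "b q * a q \<approx> V (?r q)" using ghost_path_same[OF acyc w w] by (simp add: a_def b_def)
    qed simp
    also have "\<dots> = path_mon q (?r q) q" by (simp add: path_mon_def)
    finally show "path_mon q (?r q) q \<approx> (a q * b q - b q * a q) + V (?r q)" by (rule eqv_sym)
  qed
  also have "\<dots> = (\<Sum>q\<in>exits E B x. a q * b q - b q * a q)"
    using sum_ranges_zero[OF finite_exits[OF acyc fin reg x] dvd] by (simp only: sum.distrib) simp
  finally show ?thesis .
qed

end

text \<open>The common form of the three cases: \<open>S\<close> is empty, or consists of an
  isolated vertex, or consists of a source that is an infinite emitter. Every path of positive
  length ends in \<open>H\<close>.\<close>

locale almost_p_commutator = lpa E K for E :: "('v, 'e) pre_digraph" and K :: "'k::field itself" +
  fixes H S :: "'v set" and v0 :: 'v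
  assumes acyc: "acyclic_digraph E"
    and verts_HS: "verts E = H \<union> S" and disj: "H \<inter> S = {}" and S: "S \<subseteq> {v0}"
    and heads: "\<And>e. e \<in> arcs E \<Longrightarrow> head E e \<in> H"
    and reg_H: "\<And>x. x \<in> H \<Longrightarrow> regular_vertex E x"
    and van: "\<And>x. x \<in> H \<Longrightarrow> vanishing (CHAR('k)) E x"
begin

lemma awalk_in_H: "awalk u q w \<Longrightarrow> u \<in> H \<Longrightarrow> w \<in> H"
proof (cases "q = []")
  case False
  assume q: "awalk u q w"
  then have "last q \<in> arcs E" using False last_in_set[of q] unfolding awalk_def by blast
  then show ?thesis using heads awalk_last_head[OF q False] by blast
qed (simp add: awalk_Nil_iff)

text \<open>Paths from \<open>x\<close> stay in \<open>H\<close>, so \<open>B\<close> may be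
  intersected with \<open>H\<close>; then \<open>exits_dvd_mono\<close> allows adding any finite
  part of \<open>H\<close>.\<close>

lemma van_large:
  assumes x: "x \<in> H" and F: "finite F"
  obtains B where "finite B" "B \<subseteq> H" "F \<inter> H \<subseteq> B" "x \<in> B"
    "\<And>w. CHAR('k) dvd card {q \<in> exits E B x. head E (last q) = w}"
proof -
  obtain B where B: "finite B" "x \<in> B" "\<And>w. CHAR('k) dvd card {q \<in> exits E B x. head E (last q) = w}"
    using van[OF x] unfolding vanishing_def by blast
  have "exits E (B \<inter> H) x = exits E B x"
    by (rule exits_cong) (use awalk_in_H x in auto)
  then have dvd: "CHAR('k) dvd card {q \<in> exits E (B \<inter> H) x. head E (last q) = w}" for w using B(3) by simp
  let ?B = "(B \<union> F) \<inter> H"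
  have "CHAR('k) dvd card {q \<in> exits E ?B x. head E (last q) = w}" for w
    by (rule exits_dvd_mono[OF acyc _ _ _ _ dvd]) (use B F x reg_H in auto)
  then show thesis by (intro that[of ?B]) (use B F x in auto)
qed

end

section \<open>A Lie ideal and the ideal generated by its vertices\<close>

locale lie_sub_space = almost_p_commutator E K H S v0
  for E :: "('v, 'e) pre_digraph" and K :: "'k::field itself" and H S v0 +
  fixes U :: "(('v, 'e) lpa_gen list \<Rightarrow>\<^sub>0 'k) set"
  assumes U: "lie_sub U"
begin

lemma sub_U: "fa.subspace U" and Z_U: "Z \<subseteq> U" and U_augm: "U \<subseteq> augm"
  and U_comm: "\<And>u a. u \<in> U \<Longrightarrow> u * a - a * u \<in> U"
  using U by (auto simp: lie_sub_def)

lemma U_comm': "u \<in> U \<Longrightarrow> a * u - u * a \<in> U"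
  using fa.subspace_neg[OF sub_U U_comm, of u a] by simp

lemma U_cong: "x \<in> U \<Longrightarrow> y \<approx> x \<Longrightarrow> y \<in> U"
  using cong_mem[OF sub_U Z_U] by blast

lemma U_comm_left: assumes "u \<in> U" "u * a \<approx> x" "a * u \<approx> 0" shows "x \<in> U"
  by (rule U_cong[OF U_comm[OF assms(1), of a]]) (use eqv_sym[OF eqv_diff[OF assms(2,3)]] in simp)

lemma U_comm_right: assumes "u \<in> U" "a * u \<approx> x" "u * a \<approx> 0" shows "x \<in> U"
  by (rule U_cong[OF U_comm'[OF assms(1), of a]]) (use eqv_sym[OF eqv_diff[OF assms(2,3)]] in simp)

definition T where "T = {w \<in> H. V w \<in> U}"

text \<open>\<open>exit_commutators\<close> writes \<open>V w\<close> as a sum of brackets of the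
  exit paths with their ghost paths, so it suffices that these paths lie in
  \<open>U\<close>.\<close>

lemma in_T:
  assumes w: "w \<in> H" and fin: "finite B" "B \<subseteq> H" "w \<in> B"
    and dvd: "\<And>x. CHAR('k) dvd card {q \<in> exits E B w. head E (last q) = x}"
    and mem: "\<And>q. q \<in> exits E B w \<Longrightarrow> PA q * V (head E (last q)) \<in> U"
  shows "w \<in> T"
proof -
  have "V w \<approx> (\<Sum>q\<in>exits E B w. (PA q * V (head E (last q))) * (V (head E (last q)) * GH q)
      - (V (head E (last q)) * GH q) * (PA q * V (head E (last q))))"
    by (rule exit_commutators[OF acyc fin(1) _ fin(3) dvd]) (use reg_H fin in blast)
  moreover have "\<dots> \<in> U" by (rule fa.subspace_sum[OF sub_U]) (rule U_comm[OF mem])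
  ultimately have "V w \<in> U" using U_cong by blast
  then show ?thesis using w by (simp add: T_def)
qed

lemma path_end_T:
  assumes \<alpha>: "awalk u \<alpha> w" "u \<noteq> w" and w: "V w \<in> U"
  shows "PA \<alpha> * V w \<in> U" "V w * GH \<alpha> \<in> U"
proof -
  have "(PA \<alpha> * V w) * V w \<approx> PA \<alpha> * V w"
    using eqv_left[OF V_idem[of w], of "PA \<alpha>"] by (simp only: mult.assoc)
  then show "PA \<alpha> * V w \<in> U" using VP_ne[OF \<alpha>(1), of w] \<alpha>(2) by (intro U_comm_right[OF w]) auto
  have "V w * (V w * GH \<alpha>) \<approx> V w * GH \<alpha>"
    using eqv_right[OF V_idem[of w], of "GH \<alpha>"] by (simp only: mult.assoc)
  then show "V w * GH \<alpha> \<in> U" using GP_ne[OF \<alpha>(1), of w] \<alpha>(2) by (intro U_comm_left[OF w]) auto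
qed

lemma T_hereditary:
  assumes e: "e \<in> arcs E" and T: "tail E e \<in> T"
  shows "head E e \<in> T"
proof -
  let ?w = "tail E e" and ?w' = "head E e"
  have w: "?w \<in> H" "V ?w \<in> U" and w': "?w' \<in> H" using T heads[OF e] by (auto simp: T_def)
  \<comment> \<open>\<open>B\<close> contains both ends of \<open>e\<close>, so the end
    \<open>?x\<close> of an exit path differs from both. Then the bracket of \<open>V ?w\<close>
    with the path \<open>e # q\<close> is that path, and the bracket of \<open>G e\<close> with the
    result is \<open>q\<close>: in each bracket the second product vanishes.\<close>
  obtain B where B: "finite B" "B \<subseteq> H" "{?w, ?w'} \<inter> H \<subseteq> B" "?w' \<in> B"
    "\<And>x. CHAR('k) dvd card {q \<in> exits E B ?w'. head E (last q) = x}"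
    using van_large[OF w', of "{?w, ?w'}"] by blast
  show ?thesis
  proof (rule in_T[OF w' B(1,2,4,5)])
    fix q assume q: "q \<in> exits E B ?w'"
    let ?x = "head E (last q)"
    have x: "?x \<notin> B" and aw: "awalk ?w' q ?x" using q by (auto simp: exits_iff)
    have ne: "?x \<noteq> ?w" "?x \<noteq> ?w'" using x B(3,4) w by auto
    have aw': "awalk ?w (e # q) ?x" using aw e by (simp add: awalk_Cons_iff)
    have *: "PA (e # q) * V ?x \<in> U"
      using eqv_zero_left[of "V ?x * V ?w" "PA (e # q)"] VV[of ?x ?w] ne
      by (intro U_comm_left[OF w(2) VP_idem[OF aw']]) (simp add: mult.assoc)
    have "G e * (PA (e # q) * V ?x) = (G e * A e) * (PA q * V ?x)" by (simp only: PA_Cons mult.assoc)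
    also have "\<dots> \<approx> V ?w' * (PA q * V ?x)" using GA[OF e e] by (intro eqv_right) simp
    also have "\<dots> \<approx> PA q * V ?x" by (rule VP_idem[OF aw])
    finally show "PA q * V ?x \<in> U"
      using eqv_zero_left[OF VG_ne[OF ne(2)], of "PA (e # q)"]
      by (intro U_comm_right[OF *]) (simp_all add: mult.assoc)
  qed
qed

lemma T_mult_left: "x \<in> path_ideal T \<Longrightarrow> a * x \<in> path_ideal T"
  and T_mult_right: "x \<in> path_ideal T \<Longrightarrow> x * a \<in> path_ideal T"
  by (rule path_ideal_mult; use T_hereditary in blast)+

text \<open>For non-empty \<open>\<alpha>\<close>, the path \<open>PA \<alpha> * V w\<close> is its
  own bracket with \<open>V w\<close>, because \<open>\<alpha>\<close> is not closed. Its product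
  with \<open>V w * GH \<beta>\<close> is a bracket plus the reversed product, and the latter is
  \<open>V w\<close> or 0 by \<open>ghost_path_same\<close>.\<close>

lemma path_ideal_T: "path_ideal T \<subseteq> U"
  unfolding path_ideal_def
proof (rule fa.span_minimal[OF _ sub_U], intro Un_least Z_U subsetI)
  fix m assume "m \<in> path_mons T"
  then obtain \<alpha> w \<beta> u d where m: "m = PA \<alpha> * V w * GH \<beta>" and w: "w \<in> T"
    and \<alpha>: "awalk u \<alpha> w" and \<beta>: "awalk d \<beta> w"
    unfolding path_mons_def path_mon_def by blast
  have wU: "V w \<in> U" using w by (simp add: T_def)
  have ne: "\<alpha> \<noteq> [] \<Longrightarrow> u \<noteq> w" "\<beta> \<noteq> [] \<Longrightarrow> d \<noteq> w"
    using \<alpha> \<beta> acyclic_closed[OF acyc] by blast+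
  show "m \<in> U"
  proof (cases "\<alpha> = []")
    case True
    then have "m = V w * GH \<beta>" by (simp add: m mon_Nil)
    then show ?thesis using wU ne(2) path_end_T(2)[OF \<beta>] by (cases "\<beta> = []") (auto simp: mon_Nil)
  next
    case False
    then have a: "PA \<alpha> * V w \<in> U" using ne path_end_T(1)[OF \<alpha>] wU by blast
    let ?b = "V w * GH \<beta>"
    have "?b * (PA \<alpha> * V w) \<in> U"
      by (rule U_cong[OF _ ghost_path_same[OF acyc \<alpha> \<beta>]]) (use wU fa.subspace_0[OF sub_U] in simp)
    then have "((PA \<alpha> * V w) * ?b - ?b * (PA \<alpha> * V w)) + ?b * (PA \<alpha> * V w) \<in> U"
      by (intro fa.subspace_add[OF sub_U] U_comm[OF a])
    then have "(PA \<alpha> * V w) * ?b \<in> U" by simp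
    moreover have "m \<approx> (PA \<alpha> * V w) * ?b"
      using eqv_sym[OF eqv_left[OF eqv_right[OF VV[of w w], of "GH \<beta>"], of "PA \<alpha>"]] by (simp add: m mult.assoc)
    ultimately show ?thesis by (rule U_cong)
  qed
qed

text \<open>All vertices on both paths lie in \<open>B \<union> S\<close>. The set \<open>S\<close>
  is kept apart because its vertex may emit infinitely many arcs, so that only \<open>B\<close> is
  available for expansions.\<close>

definition bounded_mons :: "'v set \<Rightarrow> (('v, 'e) lpa_gen list \<Rightarrow>\<^sub>0 'k) set" where
  "bounded_mons B = {path_mon \<alpha> x \<delta> | \<alpha> x \<delta>. x \<in> B \<union> S \<and> (\<exists>a. awalk a \<alpha> x) \<and> (\<exists>d. awalk d \<delta> x) \<and>
     (\<forall>e\<in>set \<alpha> \<union> set \<delta>. tail E e \<in> B \<union> S)}"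

lemma bounded_mons_mono: "B \<subseteq> B' \<Longrightarrow> bounded_mons B \<subseteq> bounded_mons B'"
  unfolding bounded_mons_def by blast

lemma augm_bounded:
  assumes "u \<in> augm"
  obtains B where "finite B" "B \<subseteq> H" "u \<in> fa.span (bounded_mons B \<union> Z)"
proof -
  let ?P = "\<lambda>u. \<exists>B. finite B \<and> B \<subseteq> H \<and> u \<in> fa.span (bounded_mons B \<union> Z)"
  have "fa.subspace {u. ?P u}"
    unfolding fa.subspace_def
  proof (intro conjI ballI allI)
    show "0 \<in> {u. ?P u}" using fa.span_zero by blast
  next
    fix x y assume "x \<in> {u. ?P u}" "y \<in> {u. ?P u}"
    then obtain B B' where B: "finite B" "B \<subseteq> H" "x \<in> fa.span (bounded_mons B \<union> Z)"
      and B': "finite B'" "B' \<subseteq> H" "y \<in> fa.span (bounded_mons B' \<union> Z)" by blast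
    have "fa.span (bounded_mons B \<union> Z) \<subseteq> fa.span (bounded_mons (B \<union> B') \<union> Z)"
      "fa.span (bounded_mons B' \<union> Z) \<subseteq> fa.span (bounded_mons (B \<union> B') \<union> Z)"
      using bounded_mons_mono[of B "B \<union> B'"] bounded_mons_mono[of B' "B \<union> B'"] by (intro fa.span_mono; blast)+
    then have "x + y \<in> fa.span (bounded_mons (B \<union> B') \<union> Z)" using B B' by (intro fa.span_add) blast+
    then show "x + y \<in> {u. ?P u}" using B B' by (intro CollectI exI[of _ "B \<union> B'"]) auto
  next
    fix c x assume "x \<in> {u. ?P u}"
    then show "scal c * x \<in> {u. ?P u}" using fa.span_scale by blast
  qed
  moreover have "path_mons (verts E) \<union> Z \<subseteq> {u. ?P u}"
  proof (intro Un_least subsetI)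
    fix m assume "m \<in> Z"
    then have "m \<in> fa.span (bounded_mons {} \<union> Z)" by (intro fa.span_base) simp
    then show "m \<in> {u. ?P u}" by (intro CollectI exI[of _ "{}"]) simp
  next
    fix m assume "m \<in> path_mons (verts E)"
    then obtain \<alpha> w \<beta> u d where m: "m = path_mon \<alpha> w \<beta>" and w: "w \<in> verts E"
      and \<alpha>: "awalk u \<alpha> w" and \<beta>: "awalk d \<beta> w"
      unfolding path_mons_def by blast
    let ?B = "insert w (tail E ` (set \<alpha> \<union> set \<beta>)) \<inter> H"
    have "e \<in> arcs E" if "e \<in> set \<alpha> \<union> set \<beta>" for e using that \<alpha> \<beta> unfolding awalk_def by blast
    then have "tail E e \<in> verts E" if "e \<in> set \<alpha> \<union> set \<beta>" for e using that tail_in_verts by blast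
    then have "\<forall>e\<in>set \<alpha> \<union> set \<beta>. tail E e \<in> ?B \<union> S" using verts_HS by blast
    moreover have "w \<in> ?B \<union> S" using w verts_HS by blast
    ultimately have "m \<in> bounded_mons ?B" unfolding bounded_mons_def m using \<alpha> \<beta> by blast
    then have "m \<in> fa.span (bounded_mons ?B \<union> Z)" by (intro fa.span_base) blast
    then show "m \<in> {u. ?P u}" by (intro CollectI exI[of _ ?B]) simp
  qed
  ultimately have "path_ideal (verts E) \<subseteq> {u. ?P u}" unfolding path_ideal_def by (rule fa.span_minimal[rotated])
  then have "?P u" using augm_path_ideal[OF assms] by (rule subsetD[THEN CollectD])
  then show thesis using that by (elim exE conjE)
qed

lemma bounded_induct:
  assumes u: "u \<in> fa.span (bounded_mons B \<union> Z)" and sub: "fa.subspace {u. P u}" and Z: "\<And>u. u \<in> Z \<Longrightarrow> P u"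
    and mons: "\<And>\<alpha> x \<delta> a d. x \<in> B \<union> S \<Longrightarrow> awalk a \<alpha> x \<Longrightarrow> awalk d \<delta> x \<Longrightarrow> a \<in> B \<union> S \<Longrightarrow> d \<in> B \<union> S \<Longrightarrow>
      \<forall>e\<in>set \<alpha> \<union> set \<delta>. tail E e \<in> B \<union> S \<Longrightarrow> P (PA \<alpha> * V x * GH \<delta>)"
  shows "P u"
proof -
  have start: "a \<in> B \<union> S" if "awalk a q x" "x \<in> B \<union> S" "\<forall>e\<in>set q. tail E e \<in> B \<union> S" for a q x
    using that by (cases q) (auto simp: awalk_simps)
  have "P m" if "m \<in> bounded_mons B" for m
  proof -
    from that obtain \<alpha> x \<delta> a d where "m = PA \<alpha> * V x * GH \<delta>" "x \<in> B \<union> S" "awalk a \<alpha> x" "awalk d \<delta> x"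
      "\<forall>e\<in>set \<alpha> \<union> set \<delta>. tail E e \<in> B \<union> S"
      unfolding bounded_mons_def path_mon_def by blast
    then show ?thesis using mons start by blast
  qed
  then have "fa.span (bounded_mons B \<union> Z) \<subseteq> {u. P u}" using Z by (intro fa.span_minimal sub) blast
  then show ?thesis using u by blast
qed

definition exits_to :: "'v set \<Rightarrow> 'v \<Rightarrow> 'e list set" where
  "exits_to B w = {\<alpha>. \<alpha> \<noteq> [] \<and> (\<exists>s. awalk s \<alpha> w) \<and> (\<forall>e\<in>set \<alpha>. tail E e \<in> B \<union> S)}"

lemma exits_toD: "\<alpha> \<in> exits_to B w \<Longrightarrow> \<alpha> \<noteq> [] \<and> (\<exists>s. awalk s \<alpha> w) \<and> (\<forall>e\<in>set \<alpha>. tail E e \<in> B \<union> S)"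
  by (simp add: exits_to_def)

text \<open>The product of the ghost of \<open>\<delta>\<close> with \<open>\<beta>\<close> survives
  only if one path is an initial segment of the other. Here \<open>\<beta>\<close> cannot be one of
  \<open>\<delta>\<close>, since \<open>\<delta>\<close> stays in \<open>B \<union> S\<close> and
  \<open>\<beta>\<close> ends outside; so \<open>\<delta>\<close> is cancelled and a path to
  \<open>w\<close> remains.\<close>

lemma bounded_times_exit:
  assumes u: "u \<in> fa.span (bounded_mons B \<union> Z)" and w: "w \<notin> B \<union> S" and \<beta>: "\<beta> \<in> exits_to B w"
  shows "u * (PA \<beta> * V w) \<in> fa.span ((\<lambda>\<alpha>. PA \<alpha> * V w) ` exits_to B w \<union> Z)" (is "_ \<in> ?W")
proof -
  have W: "fa.subspace ?W" "Z \<subseteq> ?W" "0 \<in> ?W"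
    by (rule fa.subspace_span, rule subsetI, rule fa.span_base, simp, rule fa.span_zero)
  obtain s where s: "\<beta> \<noteq> []" "awalk s \<beta> w" "\<forall>e\<in>set \<beta>. tail E e \<in> B \<union> S" using exits_toD[OF \<beta>] by blast
  show ?thesis
    using u
  proof (rule bounded_induct)
    show "fa.subspace {u. u * (PA \<beta> * V w) \<in> ?W}"
      using W(1) by (auto simp: fa.subspace_def distrib_right mult.assoc)
    show "m * (PA \<beta> * V w) \<in> ?W" if "m \<in> Z" for m using that Z_mult W(2) by blast
  next
    fix \<alpha> x \<delta> a d assume x: "x \<in> B \<union> S" and \<alpha>: "awalk a \<alpha> x" and \<delta>: "awalk d \<delta> x"
      and t: "\<forall>e\<in>set \<alpha> \<union> set \<delta>. tail E e \<in> B \<union> S"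
    have n2: "\<not> (\<exists>r. \<delta> = \<beta> @ r \<and> d = s)"
    proof
      assume "\<exists>r. \<delta> = \<beta> @ r \<and> d = s"
      then obtain r where r: "\<delta> = \<beta> @ r" "d = s" by blast
      then have aw: "awalk w r x" using \<delta> s(2) awalk_split by blast
      show False using aw x w t r by (cases r) (auto simp: awalk_simps)
    qed
    have m': "PA \<alpha> * V x * GH \<delta> * (PA \<beta> * V w) = PA \<alpha> * ((V x * GH \<delta>) * (PA \<beta> * V w))"
      by (simp only: mult.assoc)
    show "PA \<alpha> * V x * GH \<delta> * (PA \<beta> * V w) \<in> ?W"
    proof (cases "\<exists>r. \<beta> = \<delta> @ r \<and> d = s")
      case True
      then obtain r where r: "\<beta> = \<delta> @ r" "d = s" by blast
      then have aw: "awalk x r w" using \<delta> s(2) awalk_split by blast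
      have "r \<noteq> []" using aw x w by (auto simp: awalk_Nil_iff)
      moreover have "awalk a (\<alpha> @ r) w" using \<alpha> aw by auto
      ultimately have "\<alpha> @ r \<in> exits_to B w" using t s(3) r by (auto simp: exits_to_def)
      then have "PA (\<alpha> @ r) * V w \<in> ?W" by (intro fa.span_base) blast
      moreover have "PA \<alpha> * V x * GH \<delta> * (PA \<beta> * V w) \<approx> PA (\<alpha> @ r) * V w"
        unfolding m' using eqv_left[OF ghost_path_longer[OF \<delta> aw], of "PA \<alpha>"]
        by (simp only: r(1) PA_append mult.assoc)
      ultimately show ?thesis using cong_mem[OF W(1,2)] by blast
    next
      case False
      have "PA \<alpha> * V x * GH \<delta> * (PA \<beta> * V w) \<approx> 0"
        unfolding m' by (rule eqv_zero_left, rule ghost_path_zero[OF \<delta> s(2) False n2])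
      then show ?thesis using cong_mem[OF W(1,2) _ W(3)] by blast
    qed
  qed
qed

text \<open>
  If \<open>u \<beta> = \<Sum> c\<^sub>\<alpha> \<alpha>\<close> has a coefficient \<open>c\<^sub>\<alpha> \<noteq> 0\<close>, then \<open>[\<alpha>\<^sup>*, u \<beta>] = c\<^sub>\<alpha> w - u \<beta> \<alpha>\<^sup>*\<close>, whose bracket
  with a path \<open>q\<close> from \<open>w\<close> that leaves a large enough set is \<open>c\<^sub>\<alpha> q\<close>.
\<close>

lemma exit_product:
  assumes u: "u \<in> U" "u \<in> fa.span (bounded_mons B \<union> Z)" and fin: "finite B" "B \<subseteq> H"
    and w: "w \<in> H" "w \<notin> B \<union> S" and \<beta>: "\<beta> \<in> exits_to B w"
  shows "u * (PA \<beta> * V w) \<in> path_ideal T"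
proof -
  let ?y = "u * (PA \<beta> * V w)"
  obtain F c where F: "finite F" "F \<subseteq> exits_to B w" "?y \<approx> (\<Sum>\<alpha>\<in>F. scal (c \<alpha>) * (PA \<alpha> * V w))"
    using span_eqv_sum[OF bounded_times_exit[OF u(2) w(2) \<beta>]] by blast
  have wu: "V w * u \<approx> 0"
    using u(2)
  proof (rule bounded_induct)
    show "fa.subspace {u. V w * u \<approx> 0}"
      using subspace_Z by (auto simp: fa.subspace_def eqv_zero_iff distrib_left single_Nil_left_commute)
    fix \<alpha> x \<delta> a assume \<alpha>: "awalk a \<alpha> x" and a: "a \<in> B \<union> S"
    have "w \<noteq> a" using a w(2) by blast
    from eqv_zero_right[OF VP_ne[OF \<alpha> this], of "GH \<delta>"]
    show "V w * (PA \<alpha> * V x * GH \<delta>) \<approx> 0" by (simp add: mult.assoc)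
  qed (simp add: eqv_zero_iff Z_mult)
  have yU: "?y \<in> U"
    using eqv_zero_left[OF wu, of "PA \<beta>"]
    by (intro U_comm_left[OF u(1), of "PA \<beta> * V w"]) (simp_all add: mult.assoc)
  show ?thesis
  proof (cases "\<forall>\<alpha>\<in>F. c \<alpha> = 0")
    case True
    then have "?y \<approx> 0" using F(3) by simp
    then show ?thesis using Z_path_ideal eqv_zero_iff by blast
  next
    case False
    then obtain \<alpha> where \<alpha>: "\<alpha> \<in> F" "c \<alpha> \<noteq> 0" by blast
    then obtain s where s: "awalk s \<alpha> w" "\<alpha> \<noteq> []" "\<forall>e\<in>set \<alpha>. tail E e \<in> B \<union> S"
      using F(2) exits_toD by blast
    have sB: "s \<in> B \<union> S" using s by (cases \<alpha>) (auto simp: awalk_simps)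
    let ?g = "V w * GH \<alpha>"
    have gy: "?g * ?y \<approx> scal (c \<alpha>) * V w"
    proof -
      have "?g * ?y \<approx> ?g * (\<Sum>\<alpha>\<in>F. scal (c \<alpha>) * (PA \<alpha> * V w))" by (rule eqv_left[OF F(3)])
      also have "\<dots> = (\<Sum>\<alpha>'\<in>F. scal (c \<alpha>') * (?g * (PA \<alpha>' * V w)))"
        by (simp only: sum_distrib_left single_Nil_left_commute)
      also have "\<dots> \<approx> (\<Sum>\<alpha>'\<in>F. scal (c \<alpha>') * (if \<alpha>' = \<alpha> then V w else 0))"
      proof (intro eqv_sum eqv_left)
        fix \<alpha>' assume "\<alpha>' \<in> F"
        then obtain s' where "awalk s' \<alpha>' w" using F(2) exits_toD by blast
        from ghost_path_same[OF acyc this s(1)]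
        show "?g * (PA \<alpha>' * V w) \<approx> (if \<alpha>' = \<alpha> then V w else 0)" .
      qed
      also have "\<dots> = scal (c \<alpha>) * V w"
        using F(1) \<alpha>(1) by (simp add: if_distrib cong: if_cong)
      finally show ?thesis .
    qed
    have U1: "scal (c \<alpha>) * V w - ?y * ?g \<in> U"
      by (rule U_cong[OF U_comm'[OF yU, of ?g]]) (intro eqv_diff eqv_sym[OF gy] eqv_refl)
    obtain B2 where B2: "finite B2" "B2 \<subseteq> H" "B \<inter> H \<subseteq> B2" "w \<in> B2"
      "\<And>x. CHAR('k) dvd card {q \<in> exits E B2 w. head E (last q) = x}"
      using van_large[OF w(1) fin(1)] by blast
    have "w \<in> T"
    proof (rule in_T[OF w(1) B2(1,2,4,5)])
      fix q assume q: "q \<in> exits E B2 w"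
      let ?x = "head E (last q)"
      have x: "?x \<notin> B2" and aw: "awalk w q ?x" using q by (auto simp: exits_iff)
      have xH: "?x \<in> H" using awalk_in_H[OF aw w(1)] .
      have xne: "?x \<noteq> w" "?x \<notin> B \<union> S" using x B2(3,4) xH disj by auto
      let ?q = "PA q * V ?x"
      have 1: "(scal (c \<alpha>) * V w - ?y * ?g) * ?q \<approx> scal (c \<alpha>) * ?q - 0"
        unfolding left_diff_distrib
      proof (rule eqv_diff)
        show "(scal (c \<alpha>) * V w) * ?q \<approx> scal (c \<alpha>) * ?q"
          using eqv_left[OF VP_idem[OF aw], of "scal (c \<alpha>)"] by (simp add: mult.assoc)
        have "s \<noteq> w" using sB w by blast
        have "?g * ?q \<approx> 0" by (rule orth[OF GP_idem[OF s(1)] VP_idem[OF aw] \<open>s \<noteq> w\<close>])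
        then show "(?y * ?g) * ?q \<approx> 0" using eqv_zero_left[of "?g * ?q" ?y] by (simp add: mult.assoc)
      qed
      have 2: "?q * (scal (c \<alpha>) * V w - ?y * ?g) \<approx> 0 - 0"
        unfolding right_diff_distrib
      proof (rule eqv_diff)
        have "V ?x * V w \<approx> 0" using VV[of ?x w] xne by simp
        from eqv_zero_left[OF this, of "scal (c \<alpha>) * PA q"]
        show "?q * (scal (c \<alpha>) * V w) \<approx> 0" by (simp add: single_Nil_left_commute mult.assoc)
        have "V ?x * (PA \<alpha>' * V w) \<approx> 0" if \<alpha>'F: "\<alpha>' \<in> F" for \<alpha>'
        proof -
          obtain s' where s': "awalk s' \<alpha>' w" "\<alpha>' \<noteq> []" "\<forall>e\<in>set \<alpha>'. tail E e \<in> B \<union> S"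
            using F(2) \<alpha>'F exits_toD by blast
          have "s' \<in> B \<union> S" using s' by (cases \<alpha>') (auto simp: awalk_simps)
          then have "?x \<noteq> s'" using xne by blast
          then show ?thesis by (rule VP_ne[OF s'(1)])
        qed
        then have "(\<Sum>\<alpha>\<in>F. V ?x * (scal (c \<alpha>) * (PA \<alpha> * V w))) \<approx> (\<Sum>\<alpha>\<in>F. 0)"
          by (intro eqv_sum) (simp add: single_Nil_left_commute eqv_zero_left)
        then have "V ?x * ?y \<approx> 0"
          using eqv_trans[OF eqv_left[OF F(3), of "V ?x"]] by (simp add: sum_distrib_left)
        then have "PA q * ((V ?x * ?y) * ?g) \<approx> 0" by (intro eqv_zero_left[of _ "PA q"] eqv_zero_right[of _ ?g])
        then show "?q * (?y * ?g) \<approx> 0" by (simp only: mult.assoc)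
      qed
      have "scal (c \<alpha>) * ?q \<in> U" by (rule U_comm_left[OF U1, of ?q]) (use 1 2 in simp_all)
      then have "scal (inverse (c \<alpha>)) * (scal (c \<alpha>) * ?q) \<in> U" by (rule fa.subspace_scale[OF sub_U])
      then show "?q \<in> U" using \<alpha>(2) by (simp add: single_Nil_mult single_Nil_one)
    qed
    then have "V w \<in> path_ideal T"
      using path_mons_path_ideal[OF path_monsI[of w T w "[]" w "[]"]] w(1) verts_HS
      by (auto simp: awalk_Nil_iff path_mon_def mon_mult)
    then have "?y * V w \<in> path_ideal T" by (rule T_mult_left)
    moreover have "?y \<approx> ?y * V w"
    proof -
      have "u * (PA \<beta> * (V w * V w)) \<approx> u * (PA \<beta> * V w)" using VV[of w w] by (intro eqv_left) simp
      then show ?thesis by (simp add: eqv_sym mult.assoc)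
    qed
    ultimately show ?thesis using path_ideal_cong by blast
  qed
qed

text \<open>\<open>exit_product\<close> applies to paths that leave the support. If \<open>e\<close>
  ends in \<open>B\<close>, its head is expanded over the exit paths \<open>q\<close> of
  \<open>B\<close>, and each \<open>e # q\<close> is such a path.\<close>

lemma times_arc:
  assumes u: "u \<in> U" "u \<in> fa.span (bounded_mons B \<union> Z)" and fin: "finite B" "B \<subseteq> H"
    and e: "e \<in> arcs E" "tail E e \<in> B \<union> S"
  shows "u * A e \<in> path_ideal T"
proof (cases "head E e \<in> B")
  case False
  have h: "head E e \<in> H" by (rule heads[OF e(1)])
  then have "head E e \<notin> B \<union> S" using False disj by blast
  moreover have "[e] \<in> exits_to B (head E e)" using e arc_implies_awalk by (auto simp: exits_to_def)
  ultimately have "u * (PA [e] * V (head E e)) \<in> path_ideal T" by (rule exit_product[OF u fin h])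
  moreover have "u * A e \<approx> u * (PA [e] * V (head E e))"
    using eqv_sym[OF AV[OF e(1)]] by (intro eqv_left) simp
  ultimately show ?thesis using path_ideal_cong by blast
next
  case True
  have reg: "\<And>x. x \<in> B \<Longrightarrow> regular_vertex E x" using fin reg_H by blast
  let ?Q = "exits E B (head E e)" and ?r = "\<lambda>q. head E (last q)"
  have "u * A e \<approx> u * (A e * V (head E e))" using eqv_sym[OF AV[OF e(1)]] by (rule eqv_left)
  also have "\<dots> \<approx> u * (A e * (\<Sum>q\<in>?Q. path_mon q (?r q) q))"
    by (rule eqv_left, rule eqv_left, rule expand_exits[OF acyc fin(1) reg True])
  also have "\<dots> = (\<Sum>q\<in>?Q. (u * (PA (e # q) * V (?r q))) * GH q)"
    by (simp only: sum_distrib_left path_mon_def PA_Cons mult.assoc)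
  finally have *: "u * A e \<approx> (\<Sum>q\<in>?Q. (u * (PA (e # q) * V (?r q))) * GH q)" .
  have "(\<Sum>q\<in>?Q. (u * (PA (e # q) * V (?r q))) * GH q) \<in> path_ideal T"
  proof (rule fa.subspace_sum[OF subspace_path_ideal], rule T_mult_right)
    fix q assume q: "q \<in> ?Q"
    then have aw: "awalk (head E e) q (?r q)" and t: "\<forall>f\<in>set q. tail E f \<in> B" and nB: "?r q \<notin> B"
      by (auto simp: exits_iff)
    have h: "?r q \<in> H" using awalk_in_H[OF aw heads[OF e(1)]] .
    show "u * (PA (e # q) * V (?r q)) \<in> path_ideal T"
    proof (rule exit_product[OF u fin h])
      show "?r q \<notin> B \<union> S" using nB h disj by blast
      show "e # q \<in> exits_to B (?r q)" using aw t e unfolding exits_to_def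
        by (auto simp: awalk_Cons_iff)
    qed
  qed
  then show ?thesis using path_ideal_cong[OF *] by blast
qed

lemma times_vertex_zero:
  assumes u: "u \<in> fa.span (bounded_mons B \<union> Z)" and x: "x \<notin> B \<union> S"
  shows "u * V x \<approx> 0"
proof -
  show ?thesis
    using u
  proof (rule bounded_induct)
    show "fa.subspace {u. u * V x \<approx> 0}"
      using subspace_Z by (auto simp: fa.subspace_def eqv_zero_iff distrib_right mult.assoc)
    fix \<alpha> y \<delta> d assume \<delta>: "awalk d \<delta> y" and d: "d \<in> B \<union> S"
    have "x \<noteq> d" using d x by blast
    from eqv_zero_left[OF GP_ne[OF \<delta> this], of "PA \<alpha>"]
    show "PA \<alpha> * V y * GH \<delta> * V x \<approx> 0" by (simp add: mult.assoc)
  qed (simp add: eqv_zero_iff Z_mult)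
qed

lemma times_vertex:
  assumes u: "u \<in> U" "u \<in> fa.span (bounded_mons B \<union> Z)" and fin: "finite B" "B \<subseteq> H"
    and x: "x \<notin> S"
  shows "u * V x \<in> path_ideal T"
proof (cases "x \<in> B")
  case False
  then have "u * V x \<approx> 0" using times_vertex_zero[OF u(2)] x by blast
  then show ?thesis using Z_path_ideal eqv_zero_iff by blast
next
  case True
  then have reg: "regular_vertex E x" using fin reg_H by blast
  have "u * V x \<approx> u * (\<Sum>e\<in>out_arcs E x. A e * G e)" by (rule eqv_left[OF CK2[OF reg]])
  then have "u * V x \<approx> (\<Sum>e\<in>out_arcs E x. (u * A e) * G e)" by (simp add: sum_distrib_left mult.assoc)
  moreover have "(\<Sum>e\<in>out_arcs E x. (u * A e) * G e) \<in> path_ideal T"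
    by (rule fa.subspace_sum[OF subspace_path_ideal], rule T_mult_right, rule times_arc[OF u fin]) (use True in auto)
  ultimately show ?thesis using path_ideal_cong by blast
qed

lemma bounded_unit:
  assumes u: "u \<in> fa.span (bounded_mons B \<union> Z)" and fin: "finite B" "B \<subseteq> H"
  shows "u \<approx> u * (\<Sum>x\<in>B \<union> S. V x)"
proof -
  have S': "finite S" using S finite_subset by blast
  show ?thesis
    using u
  proof (rule bounded_induct)
    show "fa.subspace {u. u \<approx> u * (\<Sum>x\<in>B \<union> S. V x)}"
      unfolding fa.subspace_def by (auto simp: distrib_right mult.assoc intro: eqv_add eqv_left)
  next
    fix m assume "m \<in> Z"
    then have "m - m * (\<Sum>x\<in>B \<union> S. V x) \<in> Z" by (intro fa.subspace_diff[OF subspace_Z] Z_mult)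
    then show "m \<approx> m * (\<Sum>x\<in>B \<union> S. V x)" by (simp add: eqv_def)
  next
    fix \<alpha> y \<delta> d assume \<delta>: "awalk d \<delta> y" and d: "d \<in> B \<union> S"
    let ?m = "PA \<alpha> * V y * GH \<delta>"
    have "(\<Sum>x\<in>B \<union> S. ?m * V x) \<approx> (\<Sum>x\<in>B \<union> S. if x = d then ?m else 0)"
    proof (rule eqv_sum)
      fix x
      have "?m * V x = PA \<alpha> * ((V y * GH \<delta>) * V x)" by (simp only: mult.assoc)
      moreover have "(V y * GH \<delta>) * V x \<approx> (if x = d then V y * GH \<delta> else 0)"
        using GP_idem[OF \<delta>] GP_ne[OF \<delta>] by simp
      ultimately show "?m * V x \<approx> (if x = d then ?m else 0)"
        using eqv_left[of "(V y * GH \<delta>) * V x" "if x = d then V y * GH \<delta> else 0" "PA \<alpha>"]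
        by (simp add: mult.assoc split: if_splits)
    qed
    then show "?m \<approx> ?m * (\<Sum>x\<in>B \<union> S. V x)"
      using d S' fin(1) by (simp add: sum_distrib_left eqv_sym)
  qed
qed

text \<open>The vertex \<open>x\<close> need not be regular, so no expansion over its arcs is
  available. Instead, the sum of the vertices in \<open>B \<union> S\<close> is a right unit for
  \<open>u\<close>, and all summands but \<open>u * V x\<close> lie in the ideal.\<close>

lemma times_S:
  assumes u: "u \<in> U" "u \<in> fa.span (bounded_mons B \<union> Z)" and fin: "finite B" "B \<subseteq> H" and x: "x \<in> S"
  shows "u * V x - u \<in> path_ideal T"
proof -
  have S': "S = {x}" "x \<notin> B" using S x disj fin by auto
  have "u \<approx> u * V x + (\<Sum>y\<in>B. u * V y)"
    using bounded_unit[OF u(2) fin] S' fin by (simp add: sum_distrib_left distrib_left)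
  then have "u - u * V x \<approx> (u * V x + (\<Sum>y\<in>B. u * V y)) - u * V x" by (intro eqv_diff) auto
  then have "u - u * V x \<approx> (\<Sum>y\<in>B. u * V y)" by simp
  moreover have "(\<Sum>y\<in>B. u * V y) \<in> path_ideal T"
    by (intro fa.subspace_sum[OF subspace_path_ideal] times_vertex[OF u fin]) (use S' in auto)
  ultimately have "u - u * V x \<in> path_ideal T" using path_ideal_cong by blast
  then show ?thesis using fa.subspace_neg[OF subspace_path_ideal, of "u - u * V x"] by simp
qed

text \<open>Modulo \<open>path_ideal T\<close>, right multiplication by a letter sends
  \<open>u\<close> to \<open>u\<close> if the letter is a vertex in \<open>S\<close>, and to 0
  otherwise. Hence \<open>u * a\<close> lies in the span of \<open>u\<close> plus an ideal contained
  in \<open>U\<close>.\<close>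

lemma U_ideal:
  assumes u: "u \<in> U"
  shows "u * a \<in> U"
proof -
  obtain B where fin: "finite B" "B \<subseteq> H" and ub: "u \<in> fa.span (bounded_mons B \<union> Z)"
    using augm_bounded u U_augm by blast
  let ?J = "path_ideal T"
  \<comment> \<open>The sum of the line through \<open>u\<close> and the ideal \<open>?J\<close>,
    written as a single subspace so that \<open>right_mult_closed\<close> applies to it.\<close>
  let ?M = "{x. \<exists>c. x - scal c * u \<in> ?J}"
  have J: "fa.subspace ?J" by (rule subspace_path_ideal)
  have gen: "u * mon [g] \<in> ?M" for g
  proof -
    have "u * mon [g] - scal 0 * u \<in> ?J \<or> u * mon [g] - scal 1 * u \<in> ?J"
    proof (cases g)
      case (Vert x)
      then show ?thesis using times_vertex[OF u ub fin, of x] times_S[OF u ub fin, of x]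
        by (cases "x \<in> S") (auto simp: single_Nil_one)
    next
      case (Arc e)
      show ?thesis
      proof (cases "e \<in> arcs E")
        case False
        then have "u * A e \<approx> 0" using A_zero eqv_zero_left by blast
        then show ?thesis using Arc Z_path_ideal eqv_zero_iff by auto
      next
        case e: True
        show ?thesis
        proof (cases "tail E e \<in> B \<union> S")
          case True
          then show ?thesis using Arc times_arc[OF u ub fin e] by simp
        next
          case False
          have "u * A e \<approx> (u * V (tail E e)) * A e"
            using eqv_left[OF eqv_sym[OF VA[OF e]], of u] by (simp add: mult.assoc)
          also have "\<dots> \<approx> 0" by (rule eqv_zero_right, rule times_vertex_zero[OF ub False])
          finally show ?thesis using Arc Z_path_ideal eqv_zero_iff by auto
        qed
      qed
    next
      case (Ghost e)
      show ?thesis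
      proof (cases "e \<in> arcs E")
        case False
        then have "u * G e \<approx> 0" using G_zero eqv_zero_left by blast
        then show ?thesis using Ghost Z_path_ideal eqv_zero_iff by auto
      next
        case e: True
        have "u * G e \<approx> (u * V (head E e)) * G e"
          using eqv_left[OF eqv_sym[OF VG[OF e]], of u] by (simp add: mult.assoc)
        moreover have "head E e \<notin> S" using heads[OF e] disj by blast
        then have "(u * V (head E e)) * G e \<in> ?J"
          by (rule T_mult_right[OF times_vertex[OF u ub fin]])
        ultimately show ?thesis using Ghost path_ideal_cong by auto
      qed
    qed
    then show ?thesis by blast
  qed
  have M: "fa.subspace ?M"
    unfolding fa.subspace_def
  proof (intro conjI ballI allI)
    show "0 \<in> ?M" using fa.subspace_0[OF J] by (intro CollectI exI[of _ 0]) simp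
  next
    fix x y assume "x \<in> ?M" "y \<in> ?M"
    then obtain c d where "x - scal c * u \<in> ?J" "y - scal d * u \<in> ?J" by blast
    from fa.subspace_add[OF J this] have "x + y - scal (c + d) * u \<in> ?J"
      by (simp add: single_add algebra_simps)
    then show "x + y \<in> ?M" by blast
  next
    fix b x assume "x \<in> ?M"
    then obtain c where "x - scal c * u \<in> ?J" by blast
    from fa.subspace_scale[OF J this, of b] have "scal b * x - scal (b * c) * u \<in> ?J"
      by (simp add: right_diff_distrib single_Nil_mult)
    then show "scal b * x \<in> ?M" by blast
  qed
  have "x * mon [g] \<in> ?M" if x: "x \<in> ?M" for x g
  proof -
    obtain c where c: "x - scal c * u \<in> ?J" using x by blast
    obtain d where d: "u * mon [g] - scal d * u \<in> ?J" using gen by blast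
    have "(x - scal c * u) * mon [g] + scal c * (u * mon [g] - scal d * u) \<in> ?J"
      by (intro fa.subspace_add[OF J] fa.subspace_scale[OF J] d T_mult_right c)
    then have "x * mon [g] - scal (c * d) * u \<in> ?J"
      by (simp add: left_diff_distrib right_diff_distrib single_Nil_mult mult.assoc)
    then show ?thesis by blast
  qed
  moreover have "u \<in> ?M" using fa.subspace_0[OF J] by (intro CollectI exI[of _ 1]) (simp add: single_Nil_one)
  ultimately have "u * a \<in> ?M" by (rule right_mult_closed[OF M])
  then obtain c where "u * a - scal c * u \<in> ?J" by blast
  then have "(u * a - scal c * u) + scal c * u \<in> U"
    using path_ideal_T by (intro fa.subspace_add[OF sub_U] fa.subspace_scale[OF sub_U] u) blast
  then show ?thesis by simp
qed

end

context almost_p_commutator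
begin

theorem lie_sub_ideal: "lie_sub U \<Longrightarrow> u \<in> U \<Longrightarrow> u * a \<in> U"
  by (rule lie_sub_space.U_ideal) (unfold_locales, assumption+)

end

section \<open>Traces from branching systems\<close>

context lpa
begin

lemma lpa_relsE:
  assumes "x \<in> lpa_rels E"
  obtains v w where "v \<in> verts E" "w \<in> verts E" "x = V v * V w - (if v = w then V v else 0)"
  | e where "e \<in> arcs E" "x = V (tail E e) * A e - A e"
  | e where "e \<in> arcs E" "x = A e * V (head E e) - A e"
  | e where "e \<in> arcs E" "x = V (head E e) * G e - G e"
  | e where "e \<in> arcs E" "x = G e * V (tail E e) - G e"
  | e f where "e \<in> arcs E" "f \<in> arcs E" "x = G e * A f - (if e = f then V (head E e) else 0)"
  | v where "regular_vertex E v" "x = V v - (\<Sum>e\<in>out_arcs E v. A e * G e)"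
  using assms unfolding lpa_rels_def by (elim UnE CollectE exE conjE)

text \<open>An element of \<open>Z\<close> is its restriction, which lies in the ideal generated by
  the relations, plus a combination of words that contain a letter outside the graph. So two kinds
  of generators have to be tested.\<close>

lemma Z_minimal:
  assumes J: "fa.subspace J" and gen: "\<And>g x. x \<in> J \<Longrightarrow> mon [g] * x \<in> J" "\<And>g x. x \<in> J \<Longrightarrow> x * mon [g] \<in> J"
    and bad: "\<And>g. g \<notin> lpa_gens E \<Longrightarrow> mon [g] \<in> J" and rels: "\<And>x. x \<in> lpa_rels E \<Longrightarrow> x \<in> J"
  shows "Z \<subseteq> J"
proof
  note mult = left_mult_closed[OF J gen(1)] right_mult_closed[OF J gen(2)]
  fix x assume x: "x \<in> Z"
  have "kalg_ideal (free_kalg (lpa_gens E)) (J \<inter> Car)"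
    by (rule free_kalg_idealI)
      (simp_all add: fa.subspace_0[OF J] fa.subspace_add[OF J] fa.subspace_diff[OF J] fa.subspace_scale[OF J]
        mult Car_facts)
  moreover have "lpa_rels E \<subseteq> J \<inter> Car" using rels lpa_rels_carrier[OF wf_digraph_axioms] by blast
  ultimately have "lpa_ideal E \<subseteq> J" unfolding lpa_ideal_def kalg_ideal_gen_def by blast
  then have "res x \<in> J" using x by (auto simp: Z_def)
  moreover have "x - res x \<in> J"
  proof (rule mon_induct[of "\<lambda>x. x - res x \<in> J"])
    have "(x - res x) + (y - res y) \<in> J" if "x - res x \<in> J" "y - res y \<in> J" for x y
      using fa.subspace_add[OF J that] .
    moreover have "scal c * (x - res x) \<in> J" if "x - res x \<in> J" for x c using fa.subspace_scale[OF J that] .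
    ultimately show "fa.subspace {x. x - res x \<in> J}"
      using fa.subspace_0[OF J] by (simp add: fa.subspace_def restr_zero restr_add restr_scale algebra_simps)
    fix w
    show "mon w - res (mon w) \<in> J"
    proof (cases "set w \<subseteq> lpa_gens E")
      case False
      then obtain g a b where w: "w = a @ g # b" "g \<notin> lpa_gens E" by (meson split_list subsetI)
      have "mon w = mon a * (mon [g] * (mon b :: ('v, 'e) lpa_gen list \<Rightarrow>\<^sub>0 'k))" by (simp add: w mon_mult)
      then have "mon w \<in> J" using mult bad[OF w(2)] by simp
      then show ?thesis using False by (simp add: restr_mon)
    qed (use fa.subspace_0[OF J] in \<open>simp add: restr_mon\<close>)
  qed
  ultimately have "(x - res x) + res x \<in> J" by (rule fa.subspace_add[OF J, rotated])
  then show "x \<in> J" by simp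
qed

text \<open>The contexts \<open>a\<close> and \<open>b\<close> are there because
  \<open>\<Phi>\<close> need not be multiplicative: matrix coefficients and fixed-point counts are
  not, so each relation has to be respected inside every word.\<close>

lemma functional_vanish:
  fixes \<Phi> :: "('v, 'e) lpa_gen list \<Rightarrow> 'k"
  assumes zero: "\<And>w. \<not> set w \<subseteq> lpa_gens E \<Longrightarrow> \<Phi> w = 0"
    and VV: "\<And>a b v v'. v \<in> verts E \<Longrightarrow> v' \<in> verts E \<Longrightarrow>
      \<Phi> (a @ [Vert v, Vert v'] @ b) = (if v = v' then \<Phi> (a @ [Vert v] @ b) else 0)"
    and VA: "\<And>a b e. e \<in> arcs E \<Longrightarrow> \<Phi> (a @ [Vert (tail E e), Arc e] @ b) = \<Phi> (a @ [Arc e] @ b)"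
    and AV: "\<And>a b e. e \<in> arcs E \<Longrightarrow> \<Phi> (a @ [Arc e, Vert (head E e)] @ b) = \<Phi> (a @ [Arc e] @ b)"
    and VG: "\<And>a b e. e \<in> arcs E \<Longrightarrow> \<Phi> (a @ [Vert (head E e), Ghost e] @ b) = \<Phi> (a @ [Ghost e] @ b)"
    and GV: "\<And>a b e. e \<in> arcs E \<Longrightarrow> \<Phi> (a @ [Ghost e, Vert (tail E e)] @ b) = \<Phi> (a @ [Ghost e] @ b)"
    and GA: "\<And>a b e f. e \<in> arcs E \<Longrightarrow> f \<in> arcs E \<Longrightarrow>
      \<Phi> (a @ [Ghost e, Arc f] @ b) = (if e = f then \<Phi> (a @ [Vert (head E e)] @ b) else 0)"
    and CK: "\<And>a b v. regular_vertex E v \<Longrightarrow>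
      \<Phi> (a @ [Vert v] @ b) = (\<Sum>e\<in>out_arcs E v. \<Phi> (a @ [Arc e, Ghost e] @ b))"
    and x: "x \<in> Z"
  shows "linf \<Phi> x = 0"
proof -
  \<comment> \<open>The largest two-sided ideal contained in the kernel of
    \<open>linf \<Phi>\<close>.\<close>
  let ?J = "{x. \<forall>a b. linf \<Phi> (mon a * x * mon b) = 0}"
  note app = append_Cons append_Nil
  have lin: "linf \<Phi> (mon a * (mon w :: ('v, 'e) lpa_gen list \<Rightarrow>\<^sub>0 'k) * mon b) = \<Phi> (a @ w @ b)" for a w b
    by (simp add: mon_mult linf_mon)
  have gen: "(mon [g] :: ('v, 'e) lpa_gen list \<Rightarrow>\<^sub>0 'k) * mon [h] = mon [g, h]" for g h by (simp add: mon_mult)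
  have "Z \<subseteq> ?J"
  proof (rule Z_minimal)
    show "fa.subspace ?J"
      by (simp add: fa.subspace_def linf_zero linf_add linf_scale distrib_left distrib_right
          single_Nil_left_commute mult.assoc)
  next
    fix g x assume x: "x \<in> ?J"
    have "linf \<Phi> ((mon a * mon [g]) * x * mon b) = 0" "linf \<Phi> (mon a * x * (mon [g] * mon b)) = 0" for a b
      unfolding mon_mult using x by blast+
    then show "mon [g] * x \<in> ?J" "x * mon [g] \<in> ?J" by (simp_all add: mult.assoc)
  next
    fix g assume "g \<notin> lpa_gens E"
    then show "mon [g] \<in> ?J" by (simp only: lin mem_Collect_eq) (auto intro!: zero)
  next
    fix x :: "('v, 'e) lpa_gen list \<Rightarrow>\<^sub>0 'k" assume x: "x \<in> lpa_rels E"
    then have "linf \<Phi> (mon a * x * mon b) = 0" for a b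
      by (cases rule: lpa_relsE)
        (simp_all add: gen left_diff_distrib right_diff_distrib linf_diff lin sum_distrib_left sum_distrib_right
          linf_sum linf_zero VV[unfolded app] VA[unfolded app] AV[unfolded app] VG[unfolded app] GV[unfolded app]
          GA[unfolded app] CK[unfolded app] split: if_splits)
    then show "x \<in> ?J" by blast
  qed
  then have "linf \<Phi> (mon [] * x * mon []) = 0" using x by blast
  then show ?thesis by (simp add: mon_Nil)
qed

definition comms :: "(('v, 'e) lpa_gen list \<Rightarrow>\<^sub>0 'k) set" where
  "comms = fa.span ({x * y - y * x | x y. True} \<union> Z)"

text \<open>Bilinearity reduces commutators to those of words. A linear functional that vanishes on
  \<open>Z\<close> and is invariant under rotation of words therefore vanishes on
  \<open>comms\<close>.\<close>

lemma comms_induct: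
  assumes sub: "fa.subspace {x. P x}" and "\<And>x. x \<in> Z \<Longrightarrow> P x"
    and words: "\<And>a b. P (mon (a @ b) - mon (b @ a))" and x: "x \<in> comms"
  shows "P x"
proof -
  have sub': "P 0" "\<And>x y. P x \<Longrightarrow> P y \<Longrightarrow> P (x + y)" "\<And>c x. P x \<Longrightarrow> P (scal c * x)"
    using sub by (auto simp: fa.subspace_def)
  have 1: "P (mon a * y - y * mon a)" for a y
  proof (rule mon_induct[of "\<lambda>y. P (mon a * y - y * mon a)"])
    have "P (mon a * (x + y) - (x + y) * mon a)"
      if "P (mon a * x - x * mon a)" "P (mon a * y - y * mon a)" for x y
      using sub'(2)[OF that] by (simp add: algebra_simps)
    moreover have "P (mon a * (scal c * x) - (scal c * x) * mon a)" if "P (mon a * x - x * mon a)" for c x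
      using sub'(3)[OF that, of c] by (simp add: right_diff_distrib single_Nil_left_commute mult.assoc)
    ultimately show "fa.subspace {y. P (mon a * y - y * mon a)}" using sub'(1) by (simp add: fa.subspace_def)
    show "P (mon a * mon b - mon b * mon a)" for b using words by (simp add: mon_mult)
  qed
  have 2: "P (x * y - y * x)" for x y
  proof (rule mon_induct[of "\<lambda>x. P (x * y - y * x)"])
    have "P ((x + x') * y - y * (x + x'))"
      if "P (x * y - y * x)" "P (x' * y - y * x')" for x x'
      using sub'(2)[OF that] by (simp add: algebra_simps)
    moreover have "P ((scal c * x) * y - y * (scal c * x))" if "P (x * y - y * x)" for c x
      using sub'(3)[OF that, of c] by (simp add: right_diff_distrib single_Nil_left_commute mult.assoc)
    ultimately show "fa.subspace {x. P (x * y - y * x)}" using sub'(1) by (simp add: fa.subspace_def)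
  qed (rule 1)
  have "comms \<subseteq> {x. P x}"
    unfolding comms_def by (rule fa.span_minimal[OF _ sub]) (use 2 assms(2) in auto)
  then show ?thesis using x by blast
qed

end

text \<open>An algebraic branching system: the graph acts on \<open>X\<close> by partial injections,
  where \<open>ext e\<close> maps the points over the head of \<open>e\<close> to points over its
  tail. Surjectivity is demanded at regular vertices only, which matches \<open>CK2\<close>. Finite
  paths to a singular vertex and infinite paths are the two instances.\<close>

locale branching = lpa E K for E :: "('v, 'e) pre_digraph" and K :: "'k::field itself" +
  fixes X :: "'x set" and src :: "'x \<Rightarrow> 'v" and ext :: "'e \<Rightarrow> 'x \<Rightarrow> 'x"
  assumes src_verts: "x \<in> X \<Longrightarrow> src x \<in> verts E"
    and ext_X: "x \<in> X \<Longrightarrow> e \<in> arcs E \<Longrightarrow> src x = head E e \<Longrightarrow> ext e x \<in> X"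
    and src_ext: "x \<in> X \<Longrightarrow> e \<in> arcs E \<Longrightarrow> src x = head E e \<Longrightarrow> src (ext e x) = tail E e"
    and ext_inj: "ext e x = ext f y \<Longrightarrow> e = f \<and> x = y"
    and ext_onto: "x \<in> X \<Longrightarrow> regular_vertex E (src x) \<Longrightarrow>
      \<exists>e y. e \<in> arcs E \<and> y \<in> X \<and> src y = head E e \<and> x = ext e y"
begin

primrec act :: "('v, 'e) lpa_gen \<Rightarrow> 'x \<Rightarrow> 'x option" where
  "act (Vert v) x = (if x \<in> X \<and> src x = v then Some x else None)"
| "act (Arc e) x = (if x \<in> X \<and> e \<in> arcs E \<and> src x = head E e then Some (ext e x) else None)"
| "act (Ghost e) x = (if e \<in> arcs E \<and> (\<exists>y\<in>X. src y = head E e \<and> x = ext e y)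
     then Some (THE y. x = ext e y) else None)"

text \<open>The last letter acts first, as in a left module; \<open>None\<close> stands for
  0.\<close>

primrec wact :: "('v, 'e) lpa_gen list \<Rightarrow> 'x \<Rightarrow> 'x option" where
  "wact [] x = Some x"
| "wact (g # w) x = Option.bind (wact w x) (act g)"

lemma act_Ghost_iff: "act (Ghost e) x = Some y \<longleftrightarrow> e \<in> arcs E \<and> y \<in> X \<and> src y = head E e \<and> x = ext e y"
proof -
  have "(THE z. ext e y = ext e z) = y" for y using ext_inj by (intro the_equality) auto
  then show ?thesis by auto
qed

lemma act_Arc_iff: "act (Arc e) x = Some y \<longleftrightarrow> e \<in> arcs E \<and> x \<in> X \<and> src x = head E e \<and> y = ext e x"
  by auto

lemma act_Vert_iff: "act (Vert v) x = Some y \<longleftrightarrow> x \<in> X \<and> src x = v \<and> y = x"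
  by auto

lemmas act_iff = act_Vert_iff act_Arc_iff act_Ghost_iff
declare act.simps [simp del]

lemma act_X: "act g x = Some y \<Longrightarrow> y \<in> X"
  by (cases g) (auto simp: act_iff ext_X)

lemma act_gens: "act g x = Some y \<Longrightarrow> g \<in> lpa_gens E"
  by (cases g) (auto simp: act_iff lpa_gens_def src_verts)

lemma wact_append: "wact (a @ b) x = Option.bind (wact b x) (wact a)"
  by (induction a) auto

lemma wact_mid: "wact (a @ r @ b) x = Option.bind (wact b x) (\<lambda>z. Option.bind (wact r z) (wact a))"
  by (simp add: wact_append)

lemma wact_gens: "wact w x = Some y \<Longrightarrow> set w \<subseteq> lpa_gens E"
  by (induction w arbitrary: y) (auto simp: bind_eq_Some_conv dest: act_gens)

lemma wact_X: "wact w x = Some y \<Longrightarrow> x \<in> X \<Longrightarrow> y \<in> X"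
  by (induction w arbitrary: y) (auto simp: bind_eq_Some_conv dest: act_X)

lemma option_eqI: "(\<And>y. a = Some y \<longleftrightarrow> b = Some y) \<Longrightarrow> a = b"
  by (metis not_None_eq)

lemma wact_rels:
  "wact [Vert v, Vert v'] = (if v = v' then wact [Vert v] else (\<lambda>_. None))"
  "e \<in> arcs E \<Longrightarrow> wact [Vert (tail E e), Arc e] = wact [Arc e]"
  "e \<in> arcs E \<Longrightarrow> wact [Arc e, Vert (head E e)] = wact [Arc e]"
  "e \<in> arcs E \<Longrightarrow> wact [Vert (head E e), Ghost e] = wact [Ghost e]"
  "e \<in> arcs E \<Longrightarrow> wact [Ghost e, Vert (tail E e)] = wact [Ghost e]"
  "e \<in> arcs E \<Longrightarrow> f \<in> arcs E \<Longrightarrow>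
     wact [Ghost e, Arc f] = (if e = f then wact [Vert (head E e)] else (\<lambda>_. None))"
  by (rule ext, rule option_eqI,
      auto simp: bind_eq_Some_conv act_iff ext_X src_ext dest: ext_inj split: if_splits)+

lemma wact_mid_rels:
  "wact (a @ [Vert v, Vert v'] @ b) = (if v = v' then wact (a @ [Vert v] @ b) else (\<lambda>_. None))"
  "e \<in> arcs E \<Longrightarrow> wact (a @ [Vert (tail E e), Arc e] @ b) = wact (a @ [Arc e] @ b)"
  "e \<in> arcs E \<Longrightarrow> wact (a @ [Arc e, Vert (head E e)] @ b) = wact (a @ [Arc e] @ b)"
  "e \<in> arcs E \<Longrightarrow> wact (a @ [Vert (head E e), Ghost e] @ b) = wact (a @ [Ghost e] @ b)"
  "e \<in> arcs E \<Longrightarrow> wact (a @ [Ghost e, Vert (tail E e)] @ b) = wact (a @ [Ghost e] @ b)"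
  "e \<in> arcs E \<Longrightarrow> f \<in> arcs E \<Longrightarrow>
     wact (a @ [Ghost e, Arc f] @ b) = (if e = f then wact (a @ [Vert (head E e)] @ b) else (\<lambda>_. None))"
proof -
  show "wact (a @ [Vert v, Vert v'] @ b) = (if v = v' then wact (a @ [Vert v] @ b) else (\<lambda>_. None))"
    by (rule ext, cases "v = v'") (simp_all only: wact_mid wact_rels if_True if_False bind.bind_lzero bind_rzero simp_thms)
  show "wact (a @ [Ghost e, Arc f] @ b) = (if e = f then wact (a @ [Vert (head E e)] @ b) else (\<lambda>_. None))"
    if "e \<in> arcs E" "f \<in> arcs E"
    by (rule ext, unfold wact_mid wact_rels(6)[OF that], cases "e = f")
      (simp_all only: if_True if_False bind.bind_lzero bind_rzero simp_thms)
qed (rule ext, simp only: wact_append wact_rels)+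

lemma wact_CK2:
  assumes "regular_vertex E v" "x \<in> X"
  shows "wact [Vert v] x = Some y \<longleftrightarrow> (\<exists>e\<in>out_arcs E v. wact [Arc e, Ghost e] x = Some y)"
  using assms ext_onto[OF assms(2)] ext_inj src_ext
  by (fastforce simp: bind_eq_Some_conv act_iff)

lemma wact_CK2_unique:
  "wact [Arc e, Ghost e] x = Some y \<Longrightarrow> wact [Arc f, Ghost f] x = Some z \<Longrightarrow> e = f"
  using ext_inj by (fastforce simp: bind_eq_Some_conv act_iff)

definition matrix_coeff :: "'x \<Rightarrow> 'x \<Rightarrow> ('v, 'e) lpa_gen list \<Rightarrow> 'k" where
  "matrix_coeff y x w = (if wact w x = Some y then 1 else 0)"

text \<open>All relations but the last are equalities of partial maps. In \<open>CK2\<close> the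
  partial identity at \<open>v\<close> is the disjoint union of the partial maps of the words
  \<open>[Arc e, Ghost e]\<close>, so exactly one summand contributes where the left-hand side
  does.\<close>

lemma matrix_coeff_vanish:
  assumes x: "x \<in> X" and z: "z \<in> Z"
  shows "linf (matrix_coeff y x) z = 0"
proof (rule functional_vanish[OF _ _ _ _ _ _ _ _ z])
  show "matrix_coeff y x w = 0" if "\<not> set w \<subseteq> lpa_gens E" for w
    using that wact_gens by (auto simp: matrix_coeff_def)
next
  fix a b v assume v: "regular_vertex E v"
  show "matrix_coeff y x (a @ [Vert v] @ b) = (\<Sum>e\<in>out_arcs E v. matrix_coeff y x (a @ [Arc e, Ghost e] @ b))"
  proof (cases "wact b x")
    case None
    then show ?thesis by (simp add: matrix_coeff_def wact_append)
  next
    case (Some z)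
    then have z: "z \<in> X" using wact_X x by blast
    have *: "matrix_coeff y x (a @ r @ b) = (if \<exists>t. wact r z = Some t \<and> wact a t = Some y then 1 else 0)" for r
      using Some by (simp add: matrix_coeff_def wact_append bind_eq_Some_conv)
    show ?thesis
    proof (cases "\<exists>t. wact [Vert v] z = Some t \<and> wact a t = Some y")
      case True
      then obtain t where t: "wact [Vert v] z = Some t" "wact a t = Some y" by blast
      then obtain e where e: "e \<in> out_arcs E v" "wact [Arc e, Ghost e] z = Some t"
        using wact_CK2[OF v z] by blast
      have "(\<Sum>f\<in>out_arcs E v. matrix_coeff y x (a @ [Arc f, Ghost f] @ b)) =
          (\<Sum>f\<in>out_arcs E v. if f = e then 1 else 0)"
        unfolding * using e t wact_CK2_unique by (intro sum.cong refl if_cong) blast+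
      also have "\<dots> = 1" using finite_out[OF v] e by simp
      finally show ?thesis unfolding *[of "[Vert v]"] using True by (simp only: if_True)
    next
      case False
      then have "\<not> (\<exists>t. wact [Arc f, Ghost f] z = Some t \<and> wact a t = Some y)" if "f \<in> out_arcs E v" for f
        using wact_CK2[OF v z] that by blast
      then have "(\<Sum>f\<in>out_arcs E v. matrix_coeff y x (a @ [Arc f, Ghost f] @ b)) = 0"
        unfolding * by (intro sum.neutral ballI) (simp only: if_False)
      then show ?thesis unfolding *[of "[Vert v]"] using False by (simp only: if_False)
    qed
  qed
qed (simp_all only: matrix_coeff_def wact_mid_rels option.distinct if_False split: if_split, auto)

definition closed_under :: "'e set \<Rightarrow> 'x set \<Rightarrow> bool" where
  "closed_under D Y \<longleftrightarrow> (\<forall>e\<in>D. \<forall>y\<in>Y. \<forall>z. act (Arc e) y = Some z \<or> act (Ghost e) y = Some z \<longrightarrow> z \<in> Y)"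

definition arcs_of :: "('v, 'e) lpa_gen list \<Rightarrow> 'e set" where
  "arcs_of w = {e. Arc e \<in> set w \<or> Ghost e \<in> set w}"

lemma finite_arcs_of: "finite (arcs_of w)"
proof -
  have "arcs_of w = Arc -` set w \<union> Ghost -` set w" by (auto simp: arcs_of_def)
  then show ?thesis by (simp add: finite_vimageI inj_def)
qed

lemma closed_wact:
  assumes "closed_under D Y" shows "arcs_of w \<subseteq> D \<Longrightarrow> y \<in> Y \<Longrightarrow> wact w y = Some z \<Longrightarrow> z \<in> Y"
proof (induction w arbitrary: z)
  case (Cons g w)
  then obtain t where t: "wact w y = Some t" "act g t = Some z" by (auto simp: bind_eq_Some_conv)
  have "arcs_of w \<subseteq> D" using Cons.prems by (auto simp: arcs_of_def)
  then have "t \<in> Y" using Cons.IH Cons.prems(2) t(1) by blast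
  then show ?case using t(2) assms Cons.prems(1)
    by (cases g) (auto simp: closed_under_def arcs_of_def act_Vert_iff)
qed simp

text \<open>On a finite set that is stable under the letters of \<open>a\<close> and
  \<open>b\<close>, these two words exchange the fixed points of \<open>a @ b\<close> and
  \<open>b @ a\<close>. The set of arcs depends on \<open>x\<close>, since summing over all of a
  possibly infinite \<open>X\<close> makes no sense.\<close>

lemma trace_commutators:
  assumes x: "x \<in> comms"
  shows "\<exists>A. finite A \<and> (\<forall>Y. finite Y \<longrightarrow> Y \<subseteq> X \<longrightarrow> closed_under A Y \<longrightarrow>
    (\<Sum>y\<in>Y. linf (matrix_coeff y y) x) = 0)" (is "?P x")
proof (rule comms_induct[of ?P, OF _ _ _ x])
  have mono: "closed_under A Y" if "closed_under A' Y" "A \<subseteq> A'" for A A' Y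
    using that by (auto simp: closed_under_def)
  show "fa.subspace {x. ?P x}"
    unfolding fa.subspace_def
  proof (intro conjI ballI allI)
    show "0 \<in> {x. ?P x}" by (intro CollectI exI[of _ "{}"]) (simp add: linf_zero)
  next
    fix x y assume "x \<in> {x. ?P x}" "y \<in> {x. ?P x}"
    then obtain A B where A: "finite A" "\<And>Y. finite Y \<Longrightarrow> Y \<subseteq> X \<Longrightarrow> closed_under A Y \<Longrightarrow> (\<Sum>y\<in>Y. linf (matrix_coeff y y) x) = 0"
      and B: "finite B" "\<And>Y. finite Y \<Longrightarrow> Y \<subseteq> X \<Longrightarrow> closed_under B Y \<Longrightarrow> (\<Sum>z\<in>Y. linf (matrix_coeff z z) y) = 0"
      by blast
    show "x + y \<in> {x. ?P x}"
      using A B mono[of "A \<union> B" _ A] mono[of "A \<union> B" _ B]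
      by (intro CollectI exI[of _ "A \<union> B"]) (simp add: linf_add sum.distrib)
  next
    fix c x assume "x \<in> {x. ?P x}"
    then obtain A where A: "finite A" "\<And>Y. finite Y \<Longrightarrow> Y \<subseteq> X \<Longrightarrow> closed_under A Y \<Longrightarrow> (\<Sum>y\<in>Y. linf (matrix_coeff y y) x) = 0" by blast
    then show "scal c * x \<in> {x. ?P x}"
      by (intro CollectI exI[of _ A]) (simp add: linf_scale sum_distrib_left[symmetric])
  qed
next
  fix x assume "x \<in> Z"
  then show "?P x" using matrix_coeff_vanish by (intro exI[of _ "{}"]) (auto intro!: sum.neutral)
next
  fix a b
  let ?A = "arcs_of a \<union> arcs_of b"
  have "(\<Sum>y\<in>Y. linf (matrix_coeff y y) (mon (a @ b) - mon (b @ a))) = 0"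
    if Y: "finite Y" "Y \<subseteq> X" "closed_under ?A Y" for Y
  proof -
    let ?F = "\<lambda>a b. {y \<in> Y. wact (a @ b) y = Some y}"
    have "bij_betw (\<lambda>y. the (wact b y)) (?F a b) (?F b a)"
    proof (rule bij_betw_byWitness[where f' = "\<lambda>y. the (wact a y)"])
      have cl: "z \<in> Y" if "wact a y = Some z \<or> wact b y = Some z" "y \<in> Y" for y z
        using that closed_wact[OF Y(3), of a y z] closed_wact[OF Y(3), of b y z] by auto
      show "(\<lambda>y. the (wact b y)) ` ?F a b \<subseteq> ?F b a" "(\<lambda>y. the (wact a y)) ` ?F b a \<subseteq> ?F a b"
        by (auto simp: wact_append bind_eq_Some_conv intro: cl[OF disjI1] cl[OF disjI2])
    qed (auto simp: wact_append bind_eq_Some_conv)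
    then have "card (?F a b) = card (?F b a)" by (rule bij_betw_same_card)
    moreover have "(\<Sum>y\<in>Y. matrix_coeff y y (a @ b)) = of_nat (card (?F a b))" for a b
      unfolding matrix_coeff_def using Y(1) by (simp add: sum.If_cases Int_def)
    ultimately show ?thesis by (simp add: linf_diff linf_mon sum_subtractf)
  qed
  then show "?P (mon (a @ b) - mon (b @ a))"
    using finite_arcs_of by (intro exI[of _ ?A]) simp
qed

abbreviation conc :: "'e list \<Rightarrow> 'x \<Rightarrow> 'x" where "conc q x \<equiv> foldr ext q x"

lemma conc_X: "x \<in> X \<Longrightarrow> awalk u q (src x) \<Longrightarrow> conc q x \<in> X \<and> src (conc q x) = u"
  by (induction q arbitrary: u) (auto simp: awalk_simps ext_X src_ext)

text \<open>The point \<open>x\<close> does not begin with an arc of \<open>D\<close>, so the place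
  where the prefix ends can be recognised.\<close>

lemma conc_inj:
  assumes x: "\<And>e y. e \<in> D \<Longrightarrow> x \<noteq> ext e y"
  shows "set q \<subseteq> D \<Longrightarrow> set q' \<subseteq> D \<Longrightarrow> conc q x = conc q' x \<Longrightarrow> q = q'"
proof (induction q arbitrary: q')
  case Nil
  then show ?case using x by (cases q') auto
next
  case (Cons e q)
  then obtain f r where r: "q' = f # r" using x[of e "conc q x"] Cons.prems by (cases q') auto
  then have "e = f" "conc q x = conc r x" using Cons.prems ext_inj by auto
  then show ?case using Cons.IH[of r] Cons.prems r by auto
qed

lemma acyclic_distinct:
  assumes "acyclic_digraph E" "awalk u q w" shows "distinct q"
proof (rule ccontr)
  assume "\<not> distinct q"
  then obtain xs ys zs e where q: "q = xs @ [e] @ ys @ [e] @ zs" using not_distinct_decomp by blast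
  then obtain x where "awalk x (e # ys @ [e] @ zs) w" using assms(2) awalk_take[of u xs "[e] @ ys @ [e] @ zs" w] by auto
  then have x: "awalk (tail E e) ((e # ys) @ (e # zs)) w" by (auto simp: awalk_Cons_iff)
  then obtain y where y: "awalk (tail E e) (e # ys) y" "awalk y (e # zs) w" using awalk_take by blast
  then have "y = tail E e" by (auto simp: awalk_Cons_iff)
  then show False using y(1) acyclic_closed[OF assms(1)] by blast
qed

text \<open>The stable set consists of all paths with arcs in \<open>A\<close>, continued by
  \<open>x\<close>; by acyclicity it is finite. The trace of \<open>V u\<close> on it counts those
  that start at \<open>u\<close>. Any finite \<open>A\<close> that contains \<open>A0\<close> is
  allowed, so the caller can adapt it to the graph.\<close>

lemma trace_paths:
  assumes acyc: "acyclic_digraph E" and u: "V u \<in> comms"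
  shows "\<exists>A0. finite A0 \<and> (\<forall>A x. finite A \<longrightarrow> A0 \<subseteq> A \<longrightarrow> x \<in> X \<longrightarrow> (\<forall>e\<in>A. \<forall>y. x \<noteq> ext e y) \<longrightarrow>
    of_nat (card {q. awalk u q (src x) \<and> set q \<subseteq> A}) = (0 :: 'k))"
proof -
  obtain A0 where A0: "finite A0" "\<And>Y. finite Y \<Longrightarrow> Y \<subseteq> X \<Longrightarrow> closed_under A0 Y \<Longrightarrow>
    (\<Sum>y\<in>Y. linf (matrix_coeff y y) (V u)) = 0" using trace_commutators[OF u] by blast
  have main: "of_nat (card {q. awalk u q (src x) \<and> set q \<subseteq> A}) = (0 :: 'k)"
    if A: "finite A" "A0 \<subseteq> A" and x: "x \<in> X" "\<And>e y. e \<in> A \<Longrightarrow> x \<noteq> ext e y" for A x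
  proof -
    let ?Q = "{q. (\<exists>u. awalk u q (src x)) \<and> set q \<subseteq> A}"
    let ?Y = "(\<lambda>q. conc q x) ` ?Q"
    have "?Q \<subseteq> {q. set q \<subseteq> A \<and> distinct q}" using acyclic_distinct[OF acyc] by blast
    then have finQ: "finite ?Q" by (rule finite_subset) (rule finite_subset_distinct[OF A(1)])
    have "?Y \<subseteq> X" using conc_X[OF x(1)] by blast
    moreover have "closed_under A0 ?Y"
      unfolding closed_under_def
    proof (intro ballI allI impI)
      fix e y z assume e: "e \<in> A0" and y: "y \<in> ?Y" and z: "act (Arc e) y = Some z \<or> act (Ghost e) y = Some z"
      from y obtain q u where q: "awalk u q (src x)" "set q \<subseteq> A" "y = conc q x" by blast
      from z show "z \<in> ?Y"
      proof
        assume "act (Arc e) y = Some z"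
        then have *: "e \<in> arcs E" "src y = head E e" "z = ext e y" by (auto simp: act_Arc_iff)
        then have "awalk (tail E e) (e # q) (src x)" using q conc_X[OF x(1) q(1)] by (simp add: awalk_Cons_iff)
        moreover have "set (e # q) \<subseteq> A" using e A(2) q(2) by auto
        moreover have "z = conc (e # q) x" using * q(3) by simp
        ultimately show ?thesis by blast
      next
        assume "act (Ghost e) y = Some z"
        then have *: "e \<in> arcs E" "z \<in> X" "src z = head E e" "y = ext e z" by (auto simp: act_Ghost_iff)
        \<comment> \<open>A ghost arc of \<open>A\<close> removes nothing from \<open>x\<close>
          itself, as \<open>x\<close> begins with no arc of \<open>A\<close>.\<close>
        have "q \<noteq> []" using * q(3) x(2)[of e z] e A(2) by auto
        then obtain f r where r: "q = f # r" by (cases q) auto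
        then have "f = e" "z = conc r x" using * q(3) ext_inj[of f "conc r x" e z] by auto
        moreover have "awalk (head E f) r (src x)" "set r \<subseteq> A" using q r by (auto simp: awalk_Cons_iff)
        ultimately show ?thesis by blast
      qed
    qed
    ultimately have "(\<Sum>y\<in>?Y. linf (matrix_coeff y y) (V u)) = 0" using A0(2)[of ?Y] finQ by blast
    moreover have "linf (matrix_coeff y y) (V u) = (if src y = u then 1 else 0)" if "y \<in> ?Y" for y
      using that \<open>?Y \<subseteq> X\<close> by (auto simp: linf_mon matrix_coeff_def act_Vert_iff)
    ultimately have "(\<Sum>y\<in>?Y. if src y = u then 1 else 0) = (0 :: 'k)" by simp
    moreover have "(\<Sum>y\<in>?Y. if src y = u then 1 else 0) = (of_nat (card {y \<in> ?Y. src y = u}) :: 'k)"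
      using finQ by (simp add: sum.If_cases Int_def)
    moreover have "{y \<in> ?Y. src y = u} = (\<lambda>q. conc q x) ` {q. awalk u q (src x) \<and> set q \<subseteq> A}"
      using conc_X[OF x(1)] by auto
    moreover have "inj_on (\<lambda>q. conc q x) {q. awalk u q (src x) \<and> set q \<subseteq> A}"
      using conc_inj[of A x] x(2) by (intro inj_onI) blast
    ultimately show ?thesis by (simp add: card_image)
  qed
  show ?thesis
  proof (intro exI[of _ A0] conjI allI impI A0(1))
    fix A x assume "finite A" "A0 \<subseteq> A" "x \<in> X" "\<forall>e\<in>A. \<forall>y. x \<noteq> ext e y"
    then show "of_nat (card {q. awalk u q (src x) \<and> set q \<subseteq> A}) = (0 :: 'k)"
      by (intro main) auto
  qed
qed

end

context lpa
begin

text \<open>If \<open>w\<close> were singular, the finite paths that end in \<open>w\<close> would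
  form a branching system: the empty path is no extension, but it sits at \<open>w\<close>, where
  surjectivity is not demanded. With the empty path as end point, \<open>trace_paths\<close> counts
  the paths from \<open>w\<close> to \<open>w\<close>. There is exactly one, and 1 is not 0 in the
  field.\<close>

lemma comm_imp_regular:
  assumes acyc: "acyclic_digraph E" and w: "w \<in> verts E" and comm: "V w \<in> comms"
  shows "regular_vertex E w"
proof (rule ccontr)
  assume nr: "\<not> regular_vertex E w"
  let ?X = "{q. \<exists>u. awalk u q w}" and ?src = "\<lambda>q. if q = [] then w else tail E (hd q)"
  have src: "awalk u q w \<Longrightarrow> u = ?src q" for u q by (cases q) (auto simp: awalk_simps)
  have Cons: "\<exists>e y. e \<in> arcs E \<and> y \<in> ?X \<and> ?src y = head E e \<and> x = e # y"
    if "x \<in> ?X" "regular_vertex E (?src x)" for x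
  proof -
    have "x \<noteq> []" using that(2) nr by auto
    then obtain e q where q: "x = e # q" by (cases x) auto
    with that(1) have "e \<in> arcs E" "awalk (head E e) q w" by (auto simp: awalk_Cons_iff)
    then show ?thesis using src q by fastforce
  qed
  interpret list: branching E K ?X ?src "(#)"
  proof unfold_locales
    fix x assume "x \<in> ?X"
    then show "?src x \<in> verts E" using src awalk_hd_in_verts by fastforce
  next
    fix x e assume x: "x \<in> ?X" "e \<in> arcs E" "?src x = head E e"
    then obtain u where u: "awalk u x w" by blast
    then have "awalk (tail E e) (e # x) w" using src[OF u] x by (simp add: awalk_Cons_iff)
    then show "e # x \<in> ?X" by blast
  qed (use Cons in auto)
  obtain A0 where A0: "finite A0" "\<And>D x. finite D \<Longrightarrow> A0 \<subseteq> D \<Longrightarrow> x \<in> ?X \<Longrightarrow> (\<forall>e\<in>D. \<forall>y. x \<noteq> e # y) \<Longrightarrow>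
    of_nat (card {q. awalk w q (?src x) \<and> set q \<subseteq> D}) = (0 :: 'k)"
    using list.trace_paths[OF acyc comm] by blast
  have "awalk w [] w" using w by (simp add: awalk_Nil_iff)
  then have "of_nat (card {q. awalk w q w \<and> set q \<subseteq> A0}) = (0 :: 'k)"
    using A0(2)[OF A0(1) subset_refl, of "[]"] by auto
  moreover have "{q. awalk w q w \<and> set q \<subseteq> A0} = {[]}"
    using acyclic_closed[OF acyc] \<open>awalk w [] w\<close> by auto
  ultimately show False by simp
qed

section \<open>Infinite paths and the divisibility of exit counts\<close>

definition inf_paths :: "(nat \<Rightarrow> 'e) set" where
  "inf_paths = {x. \<forall>n. x n \<in> arcs E \<and> head E (x n) = tail E (x (Suc n))}"

lemma case_nat_inf_paths:
  assumes "x \<in> inf_paths" "e \<in> arcs E" "tail E (x 0) = head E e"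
  shows "case_nat e x \<in> inf_paths"
  unfolding inf_paths_def
proof (intro CollectI allI)
  fix n
  show "case_nat e x n \<in> arcs E \<and> head E (case_nat e x n) = tail E (case_nat e x (Suc n))"
    using assms by (cases n) (auto simp: inf_paths_def)
qed

lemma inf_paths_decomp: "x \<in> inf_paths \<Longrightarrow> x 0 \<in> arcs E \<and> (\<lambda>n. x (Suc n)) \<in> inf_paths \<and>
  tail E (x (Suc 0)) = head E (x 0) \<and> x = case_nat (x 0) (\<lambda>n. x (Suc n))"
  by (auto simp: inf_paths_def fun_eq_iff split: nat.split)

lemma case_nat_inj: "case_nat e x = case_nat f y \<Longrightarrow> e = f \<and> x = y"
  by (metis old.nat.simps(4,5) ext)

end

sublocale lpa \<subseteq> ip: branching E K "lpa.inf_paths E" "\<lambda>x. tail E (x 0)" "case_nat"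
proof unfold_locales
  fix x assume "x \<in> inf_paths"
  then show "tail E (x 0) \<in> verts E" by (simp add: inf_paths_def)
next
  fix x e assume "x \<in> inf_paths" "e \<in> arcs E" "tail E (x 0) = head E e"
  then show "case_nat e x \<in> inf_paths" by (rule case_nat_inf_paths)
next
  fix e f :: 'b and x y :: "nat \<Rightarrow> 'b" assume "case_nat e x = case_nat f y"
  then show "e = f \<and> x = y" by (rule case_nat_inj)
next
  fix x assume "x \<in> inf_paths"
  from inf_paths_decomp[OF this]
  show "\<exists>e y. e \<in> arcs E \<and> y \<in> inf_paths \<and> tail E (y 0) = head E e \<and> x = case_nat e y" by blast
qed simp

context lpa
begin

lemma inf_path_exists:
  assumes reg: "\<And>x. x \<in> H \<Longrightarrow> regular_vertex E x" and her: "\<And>e. e \<in> arcs E \<Longrightarrow> tail E e \<in> H \<Longrightarrow> head E e \<in> H"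
    and w: "w \<in> H"
  shows "\<exists>x\<in>inf_paths. tail E (x 0) = w"
proof -
  define out where "out v = (SOME e. e \<in> out_arcs E v)" for v
  have out: "out v \<in> arcs E \<and> tail E (out v) = v" if "v \<in> H" for v
  proof -
    have "\<exists>e. e \<in> out_arcs E v" using nonempty_out[OF reg[OF that]] by blast
    then have "out v \<in> out_arcs E v" unfolding out_def by (rule someI_ex)
    then show ?thesis by simp
  qed
  define vs where "vs n = ((\<lambda>v. head E (out v)) ^^ n) w" for n
  have vs: "vs n \<in> H" for n
    by (induction n) (use w out her in \<open>auto simp: vs_def\<close>)
  have step: "vs (Suc n) = head E (out (vs n))" for n by (simp add: vs_def)
  have "(\<lambda>n. out (vs n)) \<in> inf_paths"
    unfolding inf_paths_def using out[OF vs] step[symmetric] by simp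
  moreover have "tail E (out (vs 0)) = w" using out[OF w] by (simp add: vs_def)
  ultimately show ?thesis by (intro bexI[of _ "\<lambda>n. out (vs n)"])
qed

text \<open>Every exit vertex \<open>w\<close> lies in \<open>H\<close> and is the start of an
  infinite path \<open>x\<close>, because all vertices of \<open>H\<close> are regular. Since
  \<open>w\<close> lies outside the finite set, \<open>x\<close> begins with none of the arcs
  considered, and \<open>trace_paths\<close> yields the number of exit paths to
  \<open>w\<close>.\<close>

lemma comm_imp_vanishing:
  assumes acyc: "acyclic_digraph E" and HV: "H \<subseteq> verts E"
    and her: "\<And>e. e \<in> arcs E \<Longrightarrow> tail E e \<in> H \<Longrightarrow> head E e \<in> H"
    and comm: "\<And>x. x \<in> H \<Longrightarrow> V x \<in> comms" and u: "u \<in> H"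
  shows "vanishing (CHAR('k)) E u"
proof -
  have reg: "regular_vertex E x" if "x \<in> H" for x
    using comm_imp_regular[OF acyc _ comm[OF that]] HV that by blast
  obtain A0 where A0: "finite A0" "\<And>D x. finite D \<Longrightarrow> A0 \<subseteq> D \<Longrightarrow> x \<in> inf_paths \<Longrightarrow>
    (\<forall>e\<in>D. \<forall>y. x \<noteq> case_nat e y) \<Longrightarrow>
    of_nat (card {q. awalk u q (tail E (x 0)) \<and> set q \<subseteq> D}) = (0 :: 'k)"
    using ip.trace_paths[OF acyc comm[OF u]] by blast
  let ?B = "insert u (tail E ` A0 \<inter> H)"
  \<comment> \<open>\<open>?D\<close> contains all arcs emitted by \<open>?B\<close>, and its arcs
    with tail in \<open>H\<close> have their tail in \<open>?B\<close>. So for \<open>w\<close>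
    outside \<open>?B\<close> the paths from \<open>u\<close> to \<open>w\<close> with arcs in
    \<open>?D\<close> are exactly the exit paths of \<open>?B\<close> that end in
    \<open>w\<close>.\<close>
  let ?D = "A0 \<union> (\<Union>x\<in>?B. out_arcs E x)"
  have B: "finite ?B" "?B \<subseteq> H" using A0(1) u by auto
  then have D: "finite ?D" using A0(1) finite_out reg by blast
  have inH: "awalk x q w \<Longrightarrow> x \<in> H \<Longrightarrow> w \<in> H \<and> (\<forall>e\<in>set q. tail E e \<in> H)" for x q w
    by (induction q arbitrary: x) (use her in \<open>auto simp: awalk_simps\<close>)
  have "CHAR('k) dvd card {q \<in> exits E ?B u. head E (last q) = w}" for w
  proof (cases "{q \<in> exits E ?B u. head E (last q) = w} = {}")
    case True
    then show ?thesis by (simp only: card.empty dvd_0_right)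
  next
    case False
    then obtain q0 where "awalk u q0 w" "w \<notin> ?B" by (auto simp: exits_iff)
    then have w: "w \<in> H" "w \<notin> ?B" using inH u by blast+
    obtain x where x: "x \<in> inf_paths" "tail E (x 0) = w" using inf_path_exists[OF reg her w(1)] by blast
    have "x \<noteq> case_nat e y" if "e \<in> ?D" for e y
    proof
      assume "x = case_nat e y"
      then have "tail E e = w" using x(2) by simp
      then show False using that w by auto
    qed
    then have "of_nat (card {q. awalk u q w \<and> set q \<subseteq> ?D}) = (0 :: 'k)"
      using A0(2)[OF D _ x(1)] x(2) by blast
    moreover have "{q. awalk u q w \<and> set q \<subseteq> ?D} = {q \<in> exits E ?B u. head E (last q) = w}"
    proof (intro subset_antisym subsetI)
      fix q assume q: "q \<in> {q. awalk u q w \<and> set q \<subseteq> ?D}"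
      then have aw: "awalk u q w" by blast
      have "tail E e \<in> ?B" if "e \<in> set q" for e
      proof -
        have "tail E e \<in> H" "e \<in> ?D" using inH[OF aw u] that q by blast+
        then show ?thesis by auto
      qed
      moreover have "q \<noteq> []" using aw w by (auto simp: awalk_Nil_iff)
      ultimately show "q \<in> {q \<in> exits E ?B u. head E (last q) = w}"
        using aw w awalk_last_head[OF aw] by (simp add: exits_iff)
    next
      fix q assume "q \<in> {q \<in> exits E ?B u. head E (last q) = w}"
      then have q: "awalk u q w" "\<forall>e\<in>set q. tail E e \<in> ?B" by (auto simp: exits_iff)
      then have "set q \<subseteq> arcs E" unfolding awalk_def by blast
      then have "set q \<subseteq> ?D" using q(2) by auto
      then show "q \<in> {q. awalk u q w \<and> set q \<subseteq> ?D}" using q by blast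
    qed
    ultimately show ?thesis by (simp add: of_nat_eq_0_iff_char_dvd)
  qed
  then show ?thesis unfolding vanishing_def using B HV by (intro exI[of _ ?B]) blast
qed

subsection \<open>Fixed points of words of positive degree\<close>

primrec gen_deg :: "('v, 'e) lpa_gen \<Rightarrow> int" where
  "gen_deg (Vert v) = 0" | "gen_deg (Arc e) = 1" | "gen_deg (Ghost e) = - 1"

definition deg :: "('v, 'e) lpa_gen list \<Rightarrow> int" where
  "deg w = sum_list (map gen_deg w)"

lemma deg_append: "deg (a @ b) = deg a + deg b"
  by (simp add: deg_def)

text \<open>
  \<open>shape w = (m, \<alpha>)\<close> means that \<open>w\<close> acts, where it is defined, by deleting the first \<open>m\<close> arcs
  and prepending \<open>\<alpha>\<close>.
\<close>

primrec shape :: "('v, 'e) lpa_gen list \<Rightarrow> nat \<times> 'e list" where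
  "shape [] = (0, [])"
| "shape (g # w) = (case g of Vert v \<Rightarrow> shape w
     | Arc e \<Rightarrow> (fst (shape w), e # snd (shape w))
     | Ghost e \<Rightarrow> (if snd (shape w) = [] then (Suc (fst (shape w)), [])
         else (fst (shape w), tl (snd (shape w)))))"

lemma deg_shape: "int (length (snd (shape w))) - int (fst (shape w)) = deg w"
  by (induction w) (auto simp: deg_def length_greater_0_conv[symmetric] of_nat_diff
      split: lpa_gen.split simp del: length_greater_0_conv)

lemma conc_nth: "ip.conc a z n = (if n < length a then a ! n else z (n - length a))"
  by (induction a arbitrary: n) (auto split: nat.split)

lemma wact_shape: "ip.wact w y = Some y' \<Longrightarrow> y' = ip.conc (snd (shape w)) (\<lambda>n. y (n + fst (shape w)))"
proof (induction w arbitrary: y')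
  case (Cons g w)
  then obtain z where z: "ip.wact w y = Some z" "ip.act g z = Some y'" by (auto simp: bind_eq_Some_conv)
  have IH: "z = ip.conc (snd (shape w)) (\<lambda>n. y (n + fst (shape w)))" by (rule Cons.IH[OF z(1)])
  show ?case
  proof (cases g)
    case (Ghost e)
    then have z': "z = case_nat e y'" using z(2) by (simp add: ip.act_iff)
    then have y': "y' = (\<lambda>n. z (Suc n))" by simp
    show ?thesis
    proof (cases "snd (shape w)")
      case Nil
      then show ?thesis using Ghost IH y' by simp
    next
      case (Cons f r)
      then show ?thesis using Ghost IH y' by simp
    qed
  qed (use z(2) IH in \<open>auto simp: ip.act_iff\<close>)
qed simp

text \<open>A word of positive degree prepends more arcs than it deletes. A fixed point thus begins
  with the prepended arcs, and each later entry equals an entry with a smaller index, so the word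
  determines it.\<close>

lemma fixed_point_unique:
  assumes "deg w > 0" "ip.wact w y = Some y" "ip.wact w z = Some z"
  shows "y = z"
proof
  fix n
  let ?m = "fst (shape w)" and ?a = "snd (shape w)"
  have len: "?m < length ?a" using deg_shape[of w] assms(1) by linarith
  have y: "y = ip.conc ?a (\<lambda>n. y (n + ?m))" and z: "z = ip.conc ?a (\<lambda>n. z (n + ?m))"
    using wact_shape assms(2,3) by blast+
  show "y n = z n"
  proof (induction n rule: less_induct)
    case (less n)
    have "y n = (if n < length ?a then ?a ! n else y (n - length ?a + ?m))"
      using fun_cong[OF y, of n] unfolding conc_nth .
    moreover have "z n = (if n < length ?a then ?a ! n else z (n - length ?a + ?m))"
      using fun_cong[OF z, of n] unfolding conc_nth .
    moreover have "n - length ?a + ?m < n" if "\<not> n < length ?a" using that len by linarith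
    ultimately show ?case using less by (cases "n < length ?a") auto
  qed
qed

definition fixed :: "('v, 'e) lpa_gen list \<Rightarrow> (nat \<Rightarrow> 'e) set" where
  "fixed w = {y \<in> inf_paths. ip.wact w y = Some y}"

lemma fixed_mid_iff: "y \<in> fixed (a @ r @ b) \<longleftrightarrow> y \<in> inf_paths \<and>
    (\<exists>z t. ip.wact b y = Some z \<and> ip.wact r z = Some t \<and> ip.wact a t = Some y)"
  unfolding fixed_def ip.wact_mid by (simp only: mem_Collect_eq bind_eq_Some_conv) blast

lemma finite_fixed: "deg w > 0 \<Longrightarrow> finite (fixed w)" and card_fixed: "deg w > 0 \<Longrightarrow> card (fixed w) \<le> 1"
proof -
  assume d: "deg w > 0"
  have "fixed w = {} \<or> (\<exists>y. fixed w = {y})"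
    unfolding fixed_def using fixed_point_unique[OF d] by blast
  then show "finite (fixed w)" "card (fixed w) \<le> 1" by auto
qed

text \<open>For \<open>l > 0\<close> this is the degree-\<open>l\<close> part of a trace on all
  infinite paths. No finite stable set has to be chosen, since such words have at most one fixed
  point.\<close>

definition fix_count :: "int \<Rightarrow> ('v, 'e) lpa_gen list \<Rightarrow> 'k" where
  "fix_count l w = (if deg w = l then of_nat (card (fixed w)) else 0)"

text \<open>The relations are homogeneous, so both sides of each have the same degree in every
  context. For \<open>CK2\<close> the fixed points are distributed disjointly over the arcs emitted
  by \<open>v\<close>.\<close>

lemma fix_count_vanish:
  assumes l: "l > 0" and z: "z \<in> Z"
  shows "linf (fix_count l) z = 0"
proof (rule functional_vanish[OF _ _ _ _ _ _ _ _ z])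
  show "fix_count l w = 0" if "\<not> set w \<subseteq> lpa_gens E" for w
  proof -
    have "fixed w = {}" using that ip.wact_gens by (auto simp: fixed_def)
    then show ?thesis by (simp add: fix_count_def)
  qed
next
  fix a b v assume v: "regular_vertex E v"
  have deg: "deg (a @ [Arc e, Ghost e] @ b) = deg (a @ [Vert v] @ b)" for e by (simp add: deg_def)
  show "fix_count l (a @ [Vert v] @ b) = (\<Sum>e\<in>out_arcs E v. fix_count l (a @ [Arc e, Ghost e] @ b))"
  proof (cases "deg (a @ [Vert v] @ b) = l")
    case False
    then show ?thesis unfolding fix_count_def deg by simp
  next
    case True
    have "fixed (a @ [Vert v] @ b) = (\<Union>e\<in>out_arcs E v. fixed (a @ [Arc e, Ghost e] @ b))"
    proof (intro set_eqI)
      fix y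
      show "y \<in> fixed (a @ [Vert v] @ b) \<longleftrightarrow> y \<in> (\<Union>e\<in>out_arcs E v. fixed (a @ [Arc e, Ghost e] @ b))"
        unfolding UN_iff fixed_mid_iff using ip.wact_CK2[OF v] ip.wact_X by blast
    qed
    moreover have "card (\<Union>e\<in>out_arcs E v. fixed (a @ [Arc e, Ghost e] @ b)) =
        (\<Sum>e\<in>out_arcs E v. card (fixed (a @ [Arc e, Ghost e] @ b)))"
    proof (rule card_UN_disjoint[OF finite_out[OF v]])
      show "\<forall>e\<in>out_arcs E v. finite (fixed (a @ [Arc e, Ghost e] @ b))"
        using finite_fixed deg True l by auto
      show "\<forall>e\<in>out_arcs E v. \<forall>f\<in>out_arcs E v. e \<noteq> f \<longrightarrow>
          fixed (a @ [Arc e, Ghost e] @ b) \<inter> fixed (a @ [Arc f, Ghost f] @ b) = {}"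
      proof (intro ballI impI, rule ccontr)
        fix e f assume ef: "e \<noteq> f" "fixed (a @ [Arc e, Ghost e] @ b) \<inter> fixed (a @ [Arc f, Ghost f] @ b) \<noteq> {}"
        then obtain y where y: "y \<in> fixed (a @ [Arc e, Ghost e] @ b)" "y \<in> fixed (a @ [Arc f, Ghost f] @ b)" by blast
        obtain z t where z: "ip.wact b y = Some z" "ip.wact [Arc e, Ghost e] z = Some t"
          using y(1) unfolding fixed_mid_iff by blast
        obtain z' t' where z': "ip.wact b y = Some z'" "ip.wact [Arc f, Ghost f] z' = Some t'"
          using y(2) unfolding fixed_mid_iff by blast
        have "z' = z" using z(1) z'(1) by simp
        then show False using ip.wact_CK2_unique[OF z(2)] z'(2) ef(1) by blast
      qed
    qed
    ultimately show ?thesis unfolding fix_count_def deg using True by simp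
  qed
qed (auto simp only: fix_count_def fixed_def ip.wact_mid_rels deg_append deg_def list.map sum_list.Cons sum_list.Nil gen_deg.simps
    option.distinct split: if_split, auto simp: deg_def)

lemma fix_count_commutator: "fix_count l (a @ b) = fix_count l (b @ a)"
proof -
  have "bij_betw (\<lambda>y. the (ip.wact b y)) (fixed (a @ b)) (fixed (b @ a))"
  proof (rule bij_betw_byWitness[where f' = "\<lambda>y. the (ip.wact a y)"])
    show "(\<lambda>y. the (ip.wact b y)) ` fixed (a @ b) \<subseteq> fixed (b @ a)"
      "(\<lambda>y. the (ip.wact a y)) ` fixed (b @ a) \<subseteq> fixed (a @ b)"
      by (auto simp: fixed_def ip.wact_append bind_eq_Some_conv intro: ip.wact_X)
  qed (auto simp: fixed_def ip.wact_append bind_eq_Some_conv)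
  then have "card (fixed (a @ b)) = card (fixed (b @ a))" by (rule bij_betw_same_card)
  then show ?thesis by (simp add: fix_count_def deg_append add.commute)
qed

lemma fix_count_comms:
  assumes l: "l > 0" and x: "x \<in> comms" shows "linf (fix_count l) x = 0"
proof (rule comms_induct[OF _ _ _ x])
  show "fa.subspace {x. linf (fix_count l) x = 0}"
    by (simp add: fa.subspace_def linf_zero linf_add linf_scale)
  show "linf (fix_count l) (mon (a @ b) - mon (b @ a)) = 0" for a b
    by (simp add: linf_diff linf_mon fix_count_commutator[of l a b])
qed (rule fix_count_vanish[OF l])

lemma awalk_consec: "awalk u c w \<Longrightarrow> Suc i < length c \<Longrightarrow> head E (c ! i) = tail E (c ! Suc i)"
proof (induction c arbitrary: u i)
  case (Cons e c)
  then have c: "awalk (head E e) c w" by (simp add: awalk_Cons_iff)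
  show ?case
  proof (cases i)
    case 0
    then obtain f r where "c = f # r" using Cons.prems by (cases c) auto
    then show ?thesis using c 0 by (simp add: awalk_Cons_iff)
  next
    case (Suc j)
    then show ?thesis using Cons.IH[OF c, of j] Cons.prems by simp
  qed
qed simp

lemma wact_path: "y \<in> inf_paths \<Longrightarrow> awalk u q (tail E (y 0)) \<Longrightarrow> ip.wact (map Arc q) y = Some (ip.conc q y)"
proof (induction q arbitrary: u)
  case (Cons e q)
  then have e: "e \<in> arcs E" and q: "awalk (head E e) q (tail E (y 0))" by (auto simp: awalk_Cons_iff)
  have "ip.conc q y \<in> inf_paths" "tail E (ip.conc q y 0) = head E e"
    using ip.conc_X[OF Cons.prems(1) q] by auto
  then have "ip.act (Arc e) (ip.conc q y) = Some (ip.conc (e # q) y)" using e by (simp add: ip.act_Arc_iff)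
  then show ?case using Cons.IH[OF Cons.prems(1) q] by simp
qed simp

text \<open>The periodic path that repeats \<open>c\<close> is the only fixed point. The count is
  therefore exactly 1, which is non-zero in every characteristic.\<close>

lemma fix_count_cycle:
  assumes c: "awalk u c u" "c \<noteq> []"
  shows "fix_count (int (length c)) (map Arc c) = 1"
proof -
  let ?l = "length c"
  let ?y = "\<lambda>n. c ! (n mod ?l)"
  have l: "?l > 0" using c(2) by simp
  have "set c \<subseteq> arcs E" using c(1) unfolding awalk_def by blast
  then have arcs: "c ! (n mod ?l) \<in> arcs E" for n using l nth_mem[of "n mod ?l" c] by auto
  have u0: "tail E (c ! 0) = u" using c by (cases c) (auto simp: awalk_Cons_iff)
  have ul: "head E (c ! (?l - 1)) = u" using awalk_last_head[OF c] last_conv_nth[OF c(2)] by simp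
  have "head E (?y n) = tail E (?y (Suc n))" for n
  proof (cases "Suc (n mod ?l) = ?l")
    case True
    then have "?y (Suc n) = c ! 0" "n mod ?l = ?l - 1" by (auto simp: mod_Suc)
    then show ?thesis using u0 ul by simp
  next
    case False
    then have "Suc n mod ?l = Suc (n mod ?l)" by (simp add: mod_Suc)
    moreover have "Suc (n mod ?l) < ?l" using False l mod_less_divisor[of ?l n] by linarith
    ultimately show ?thesis using awalk_consec[OF c(1), of "n mod ?l"] by simp
  qed
  then have y: "?y \<in> inf_paths" using arcs by (simp add: inf_paths_def)
  have "ip.conc c ?y = ?y"
  proof
    fix n show "ip.conc c ?y n = ?y n"
      by (cases "n < ?l") (auto simp: conc_nth le_mod_geq)
  qed
  then have "ip.wact (map Arc c) ?y = Some ?y"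
    using wact_path[OF y, of u c] c(1) u0 by simp
  then have "?y \<in> fixed (map Arc c)" using y by (simp add: fixed_def)
  moreover have deg: "deg (map Arc c) = int ?l" by (simp add: deg_def comp_def sum_list_triv)
  then have "finite (fixed (map Arc c))" "card (fixed (map Arc c)) \<le> 1"
    using finite_fixed card_fixed l by auto
  ultimately have "card (fixed (map Arc c)) = 1" by (metis One_nat_def card_0_eq empty_iff le_antisym less_one not_le not_less_eq_eq)
  then show ?thesis using deg by (simp add: fix_count_def)
qed

end

section \<open>The commutator ideal and the exceptional vertex\<close>

context hereditary_embedding
begin

text \<open>The last arc of a closed path ends in the image, so the path starts there as well and
  lifts to \<open>G1\<close>.\<close>

lemma acyclic_transfer:
  assumes heads: "\<And>e. e \<in> arcs G2 \<Longrightarrow> head G2 e \<in> f ` verts G1" and acyc: "acyclic_digraph G1"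
  shows "acyclic_digraph G2"
  unfolding acyclic_digraph_def
proof
  assume "\<exists>u q. G2.awalk u q u \<and> 1 \<le> length q"
  then obtain u q where q: "G2.awalk u q u" "q \<noteq> []" by fastforce
  then have "last q \<in> arcs G2" using last_in_set[of q] unfolding G2.awalk_def by blast
  then have "u \<in> f ` verts G1" using heads[of "last q"] G2.awalk_last_head[OF q] by simp
  then obtain x where x: "u = f x" "x \<in> verts G1" by blast
  then obtain q' w where q': "q = map g q'" "u = f w" "G1.awalk x q' w" using awalk_image[OF x(2)] q(1) by blast
  then have "w = x" using x inj_f G1.awalk_last_in_verts[OF q'(3)] by (auto dest: inj_onD)
  moreover have "1 \<le> length q'" using q(2) q'(1) by (cases q') auto
  ultimately show False using acyc q'(3) unfolding acyclic_digraph_def by blast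
qed

end

section \<open>The graph on H and the porcupine graph\<close>

definition induced_on :: "('v, 'e) pre_digraph \<Rightarrow> 'v set \<Rightarrow> ('v, 'e) pre_digraph" where
  "induced_on E H = E\<lparr>verts := H, arcs := {e \<in> arcs E. tail E e \<in> H}\<rparr>"

context wf_digraph
begin

lemma induced_on_embedding:
  assumes "H \<subseteq> verts G" "\<And>e. e \<in> arcs G \<Longrightarrow> head G e \<in> H"
  shows "hereditary_embedding (induced_on G H) G id id"
  by unfold_locales (use assms in \<open>auto simp: induced_on_def out_arcs_def\<close>)

lemma wf_porcupine:
  assumes "\<And>e. e \<in> arcs G \<Longrightarrow> head G e \<in> H"
  shows "wf_digraph (porcupine G H v)"
  by unfold_locales (use assms in \<open>auto simp: porcupine_def\<close>)

lemma porcupine_embedding: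
  assumes "H \<subseteq> verts G" "\<And>e. e \<in> arcs G \<Longrightarrow> head G e \<in> H"
  shows "hereditary_embedding (induced_on G H) (porcupine G H v) Inl Inl"
proof -
  interpret P: wf_digraph "porcupine G H v" by (rule wf_porcupine[OF assms(2)])
  interpret I: hereditary_embedding "induced_on G H" G id id by (rule induced_on_embedding[OF assms])
  show ?thesis
    by unfold_locales (auto simp: induced_on_def porcupine_def out_arcs_def)
qed

lemma porcupine_out_Inr: "e \<in> out_arcs G v \<Longrightarrow> out_arcs (porcupine G H v) (Inr e) = {Inr e}"
  by (auto simp: porcupine_def out_arcs_def)

text \<open>The graph on \<open>H\<close> embeds into \<open>G\<close> and into the porcupine graph
  with all its emitted arcs, so the conditions at vertices of \<open>H\<close> agree. Each
  additional vertex emits a single arc, which ends in \<open>H\<close>, and inherits its conditions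
  from there.\<close>

lemma p_commutator_porcupine_iff:
  assumes H: "H \<subseteq> verts G" "\<And>e. e \<in> arcs G \<Longrightarrow> head G e \<in> H"
  shows "p_commutator_graph p (porcupine G H v) \<longleftrightarrow>
    acyclic_digraph G \<and> (\<forall>x\<in>H. regular_vertex G x) \<and> (\<forall>x\<in>H. vanishing p G x)"
proof -
  let ?P = "porcupine G H v" and ?I = "induced_on G H"
  interpret P: wf_digraph ?P by (rule wf_porcupine[OF H(2)])
  interpret I: hereditary_embedding ?I G id id by (rule induced_on_embedding[OF H])
  interpret J: hereditary_embedding ?I ?P Inl Inl by (rule porcupine_embedding[OF H])
  have vI: "verts ?I = H" by (simp add: induced_on_def)
  have vP: "verts ?P = Inl ` H \<union> Inr ` out_arcs G v" by (simp add: porcupine_def)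
  have heads: "head ?P e \<in> Inl ` verts ?I" if "e \<in> arcs ?P" for e
    using that H(2) by (auto simp: porcupine_def vI)
  have headsI: "head G e \<in> id ` verts ?I" if "e \<in> arcs G" for e
    using H(2)[OF that] by (simp add: vI)
  have acyc: "acyclic_digraph ?P \<longleftrightarrow> acyclic_digraph G"
    using J.acyclic_transfer[OF heads] J.acyclic_image I.acyclic_image I.acyclic_transfer[OF headsI] by blast
  have reg: "regular_vertex ?P (Inl x) \<longleftrightarrow> regular_vertex G x" if "x \<in> H" for x
    using J.regular_iff[of x] I.regular_iff[of x] that unfolding vI by simp
  have van: "vanishing p ?P (Inl x) \<longleftrightarrow> vanishing p G x" if "x \<in> H" for x
    using J.vanishing_iff[of x p] I.vanishing_iff[of x p] that unfolding vI by simp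
  have reg': "regular_vertex ?P (Inr e)" if "e \<in> out_arcs G v" for e
    using porcupine_out_Inr[OF that, of H] that vP
    by (simp add: regular_vertex_def sink_vertex_def infinite_emitter_def)
  have van': "vanishing p ?P (Inr e)" if e: "e \<in> out_arcs G v" and va: "vanishing p ?P (Inl (head G e))" for e
  proof -
    let ?h = "Inl (head G e) :: 'a + 'b"
    obtain B where B: "finite B" "B \<subseteq> verts ?P" "?h \<in> B"
      "\<And>w. p dvd card {q \<in> exits ?P B ?h. head ?P (last q) = w}"
      using va unfolding vanishing_def by blast
    \<comment> \<open>\<open>Inr e\<close> is not reachable from \<open>?h\<close>, so adding it to
      \<open>B\<close> does not change the exit paths from \<open>?h\<close>. The exit paths from
      \<open>Inr e\<close> are these with one arc put in front, which keeps their ends.\<close>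
    let ?B = "insert (Inr e) B"
    have h: "head ?P (Inr e) = ?h" by (simp add: porcupine_def)
    have hH: "head G e \<in> verts ?I" using H(2) e unfolding vI by simp
    have "x \<noteq> Inr e" if "P.awalk ?h q x" for x q
      using J.awalk_image[OF hH, of q x] that by auto
    then have eB: "exits ?P ?B ?h = exits ?P B ?h" by (intro P.exits_cong) auto
    have ex: "exits ?P ?B (Inr e) = (#) (Inr e) ` exits ?P B ?h"
      unfolding P.exits_rec[OF insertI1[of "Inr e" B]] porcupine_out_Inr[OF e]
      by (simp only: UN_insert UN_empty Un_empty_right h eB if_P[OF insertI2[OF B(3)]])
    have "card {q \<in> exits ?P ?B (Inr e). head ?P (last q) = w} =
        card {q \<in> exits ?P B ?h. head ?P (last q) = w}" for w
    proof -
      have "{q \<in> exits ?P ?B (Inr e). head ?P (last q) = w} =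
          (#) (Inr e) ` {q \<in> exits ?P B ?h. head ?P (last q) = w}"
        unfolding ex by (auto simp: P.exits_ne)
      then show ?thesis by (simp add: card_image)
    qed
    then have "p dvd card {q \<in> exits ?P ?B (Inr e). head ?P (last q) = w}" for w using B(4) by simp
    then show ?thesis unfolding vanishing_def using B(1,2) e vP by (intro exI[of _ ?B]) auto
  qed
  have "(\<forall>x\<in>verts ?P. regular_vertex ?P x) \<longleftrightarrow> (\<forall>x\<in>H. regular_vertex G x)"
    unfolding vP using reg reg' by auto
  moreover have "(\<forall>x\<in>verts ?P. vanishing p ?P x) \<longleftrightarrow> (\<forall>x\<in>H. vanishing p G x)"
    unfolding vP using van van' H(2) by auto
  ultimately show ?thesis unfolding P.p_commutator_graph_iff acyc by blast
qed

end

context lpa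
begin

section \<open>Subspaces between the commutators and the whole algebra\<close>

lemma mon_augm: "w \<noteq> [] \<Longrightarrow> mon w \<in> augm"
  by (simp add: augm_def lookup_single when_def)

lemma subspace_comms: "fa.subspace comms"
  unfolding comms_def by (rule fa.subspace_span)

lemma Z_comms: "Z \<subseteq> comms"
  unfolding comms_def using fa.span_superset by blast

lemma commutator_comms: "x * y - y * x \<in> comms"
  unfolding comms_def by (rule fa.span_base) blast

lemma comms_augm: "comms \<subseteq> augm"
proof
  fix x assume x: "x \<in> comms"
  show "x \<in> augm"
  proof (rule comms_induct[OF _ _ _ x])
    show "fa.subspace {x. x \<in> augm}" using subspace_augm by simp
    show "x \<in> augm" if "x \<in> Z" for x using that Z_augm by blast
    show "mon (a @ b) - mon (b @ a) \<in> augm" for a b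
      by (auto simp: augm_def lookup_minus lookup_single when_def)
  qed
qed

definition comms_line :: "(('v, 'e) lpa_gen list \<Rightarrow>\<^sub>0 'k) \<Rightarrow> (('v, 'e) lpa_gen list \<Rightarrow>\<^sub>0 'k) set" where
  "comms_line s = {x. \<exists>c. x - scal c * s \<in> comms}"

lemma comms_line_iff: "x \<in> comms_line s \<longleftrightarrow> (\<exists>c. x - scal c * s \<in> comms)"
  by (simp add: comms_line_def)

lemma subspace_shifted:
  assumes C: "fa.subspace C"
  shows "fa.subspace {x. \<exists>c. x - scal c * s \<in> (C :: (('v, 'e) lpa_gen list \<Rightarrow>\<^sub>0 'k) set)}" (is "fa.subspace ?M")
  unfolding fa.subspace_def
proof (intro conjI ballI allI)
  show "0 \<in> ?M" using fa.subspace_0[OF C] by (intro CollectI exI[of _ 0]) simp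
next
  fix x y assume "x \<in> ?M" "y \<in> ?M"
  then obtain c d where "x - scal c * s \<in> C" "y - scal d * s \<in> C" by blast
  from fa.subspace_add[OF C this] have "x + y - scal (c + d) * s \<in> C"
    by (simp add: single_add algebra_simps)
  then show "x + y \<in> ?M" by blast
next
  fix b x assume "x \<in> ?M"
  then obtain c where "x - scal c * s \<in> C" by blast
  from fa.subspace_scale[OF C this, of b] have "scal b * x - scal (b * c) * s \<in> C"
    by (simp add: right_diff_distrib single_Nil_mult)
  then show "scal b * x \<in> ?M" by blast
qed

lemma comms_sub_line: "comms \<subseteq> comms_line s"
  unfolding comms_line_def by (intro subsetI CollectI exI[of _ 0]) simp

text \<open>Every bracket lies in \<open>comms\<close>, so any subspace of \<open>augm\<close> that
  contains \<open>comms\<close> is a Lie ideal.\<close>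

lemma lie_sub_comms_line:
  assumes s: "s \<in> augm" shows "lie_sub (comms_line s)"
  unfolding lie_sub_def
proof (intro conjI ballI allI)
  show "fa.subspace (comms_line s)" unfolding comms_line_def by (rule subspace_shifted[OF subspace_comms])
  show "Z \<subseteq> comms_line s" using Z_comms comms_sub_line by blast
  show "comms_line s \<subseteq> augm"
  proof
    fix x assume "x \<in> comms_line s"
    then obtain c where "x - scal c * s \<in> comms" by (auto simp: comms_line_iff)
    then have "(x - scal c * s) + scal c * s \<in> augm"
      using comms_augm by (intro fa.subspace_add[OF subspace_augm] fa.subspace_scale[OF subspace_augm] s) blast
    then show "x \<in> augm" by simp
  qed
  show "u * a - a * u \<in> comms_line s" for u a using commutator_comms comms_sub_line by blast
qed

lemma self_comms_line: "s \<in> comms_line s"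
  unfolding comms_line_iff using fa.subspace_0[OF subspace_comms]
  by (intro exI[of _ 1]) (simp add: single_Nil_one)

lemma augm_minimal:
  assumes W: "fa.subspace W" and left: "\<And>g x. x \<in> W \<Longrightarrow> mon [g] * x \<in> W" and gens: "\<And>g. mon [g] \<in> W"
  shows "augm \<subseteq> W"
proof
  fix x assume x: "x \<in> augm"
  show "x \<in> W"
  proof (rule subspace_mon[OF W])
    fix w assume "w \<in> Poly_Mapping.keys x"
    then have "w \<noteq> []" using x by (auto simp: augm_def in_keys_iff)
    then obtain v g where w: "w = v @ [g]" by (cases w rule: rev_cases) auto
    have "mon v * mon [g] \<in> W" by (rule left_mult_closed[OF W left gens])
    then show "mon w \<in> W" by (simp add: w mon_mult)
  qed
qed

context
  assumes R: "\<And>U u a. lie_sub U \<Longrightarrow> u \<in> U \<Longrightarrow> u * a \<in> U"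
begin

lemma R_left: assumes U: "lie_sub U" "u \<in> U" shows "a * u \<in> U"
proof -
  have sub: "fa.subspace U" "u * a - a * u \<in> U" using U by (auto simp: lie_sub_def)
  from fa.subspace_diff[OF sub(1) R[OF U, of a] sub(2)] show ?thesis by simp
qed

lemma lie_sub_comms: "lie_sub comms"
proof -
  have "comms_line 0 = comms" by (simp add: comms_line_def)
  then show ?thesis using lie_sub_comms_line[of 0] fa.subspace_0[OF subspace_augm] by simp
qed

lemma comms_cong: "x \<approx> y \<Longrightarrow> y \<in> comms \<Longrightarrow> x \<in> comms"
  by (rule cong_mem[OF subspace_comms Z_comms])

text \<open>As \<open>?U\<close> is an ideal, multiplying \<open>?s\<close> by \<open>V v\<close>
  puts \<open>V v\<close> into it; so \<open>V v - scal c * ?s\<close> lies in \<open>comms\<close>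
  for some \<open>c\<close>. If \<open>c\<close> is not 0, multiplication by \<open>V w\<close>
  leaves a non-zero multiple of \<open>V w\<close> in the ideal \<open>comms\<close>.\<close>

lemma vertex_pair:
  assumes "v \<noteq> w" shows "V v \<in> comms \<or> V w \<in> comms"
proof -
  let ?s = "V v + V w" and ?U = "comms_line (V v + V w)"
  have s: "?s \<in> augm" by (intro fa.subspace_add[OF subspace_augm] mon_augm) auto
  have U: "lie_sub ?U" by (rule lie_sub_comms_line[OF s])
  then have sub: "fa.subspace ?U" "Z \<subseteq> ?U" by (auto simp: lie_sub_def)
  have "?s * V v \<in> ?U" by (rule R[OF U self_comms_line])
  moreover have "?s * V v \<approx> V v + 0"
    unfolding distrib_right using VV[of v v] VV[of w v] assms by (intro eqv_add) auto
  then have "V v \<approx> ?s * V v" by (simp add: eqv_sym)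
  ultimately have "V v \<in> ?U" using cong_mem[OF sub] by blast
  then obtain c where c: "V v - scal c * ?s \<in> comms" by (auto simp: comms_line_iff)
  show ?thesis
  proof (cases "c = 0")
    case True
    then show ?thesis using c by simp
  next
    case False
    have "(V v - scal c * ?s) * V w \<in> comms" by (rule R[OF lie_sub_comms c])
    moreover have "(V v - scal c * ?s) * V w \<approx> 0 - scal c * (0 + V w)"
      unfolding left_diff_distrib distrib_right mult.assoc
      using VV[of v w] VV[of w w] assms by (intro eqv_diff eqv_left eqv_add) auto
    then have "- (scal c * V w) \<approx> (V v - scal c * ?s) * V w" by (simp add: eqv_sym)
    ultimately have "- (scal c * V w) \<in> comms" using comms_cong by blast
    from fa.subspace_scale[OF subspace_comms this, of "- inverse c"]
    have "V w \<in> comms" using False by (simp add: single_uminus[symmetric] single_Nil_mult single_Nil_one)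
    then show ?thesis ..
  qed
qed

lemma exceptional_vertex: "\<exists>v0. \<forall>v. v \<noteq> v0 \<longrightarrow> V v \<in> comms"
proof (cases "\<forall>v. V v \<in> comms")
  case False
  then obtain v0 where "V v0 \<notin> comms" by blast
  then show ?thesis using vertex_pair by blast
qed auto

text \<open>The right-hand side is an ideal by hypothesis and contains all vertices, hence all arcs
  and ghosts.\<close>

lemma augm_comms_line:
  assumes v0: "\<And>v. v \<noteq> v0 \<Longrightarrow> V v \<in> comms"
  shows "augm \<subseteq> comms_line (V v0)"
proof -
  have U: "lie_sub (comms_line (V v0))" by (rule lie_sub_comms_line[OF mon_augm]) simp
  then have sub: "fa.subspace (comms_line (V v0))" "Z \<subseteq> comms_line (V v0)" by (auto simp: lie_sub_def)
  have V: "V v \<in> comms_line (V v0)" for v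
    using self_comms_line comms_sub_line v0 by (cases "v = v0") auto
  show ?thesis
  proof (rule augm_minimal[OF sub(1) R_left[OF U]])
    fix g show "mon [g] \<in> comms_line (V v0)"
    proof (cases g)
      case (Arc e)
      show ?thesis
      proof (cases "e \<in> arcs E")
        case True
        show ?thesis unfolding Arc
          by (rule cong_mem[OF sub eqv_sym[OF AV[OF True]] R_left[OF U V]])
      qed (use Arc A_zero sub in \<open>auto simp: eqv_zero_iff\<close>)
    next
      case (Ghost e)
      show ?thesis
      proof (cases "e \<in> arcs E")
        case True
        show ?thesis unfolding Ghost
          by (rule cong_mem[OF sub eqv_sym[OF VG[OF True]] R[OF U V]])
      qed (use Ghost G_zero sub in \<open>auto simp: eqv_zero_iff\<close>)
    qed (use V in simp)
  qed
qed

lemma necessity_acyclic: "acyclic_digraph E"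
proof (rule ccontr)
  assume "\<not> acyclic_digraph E"
  then obtain u c where "awalk u c u" "length c \<ge> 1" unfolding acyclic_digraph_def by blast
  then have c: "awalk u c u" "c \<noteq> []" by auto
  obtain v0 where v0: "\<And>v. v \<noteq> v0 \<Longrightarrow> V v \<in> comms" using exceptional_vertex by blast
  let ?l = "int (length c)"
  have l: "?l > 0" using c(2) by simp
  have "PA c \<in> comms_line (V v0)" using augm_comms_line[OF v0] mon_augm[of "map Arc c"] c(2) by auto
  then obtain k where "PA c - scal k * V v0 \<in> comms" by (auto simp: comms_line_iff)
  from fix_count_comms[OF l this]
  have "fix_count ?l (map Arc c) = k * fix_count ?l [Vert v0]"
    by (simp add: linf_diff linf_scale linf_mon)
  moreover have "fix_count ?l [Vert v0] = 0" using l by (simp add: fix_count_def deg_def)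
  ultimately show False using fix_count_cycle[OF c] by simp
qed

lemma loopless_arc:
  assumes "e \<in> arcs E" shows "tail E e \<noteq> head E e"
proof
  assume "tail E e = head E e"
  then have "awalk (tail E e) [e] (tail E e)" using arc_implies_awalk[OF assms] by simp
  then show False using acyclic_closed[OF necessity_acyclic] by blast
qed

lemma arc_comms: "e \<in> arcs E \<Longrightarrow> A e \<in> comms"
proof -
  assume e: "e \<in> arcs E"
  have "V (tail E e) * A e - A e * V (tail E e) \<approx> A e - 0"
    by (intro eqv_diff VA[OF e] AV_ne loopless_arc[OF e])
  then have "A e \<approx> V (tail E e) * A e - A e * V (tail E e)" by (simp add: eqv_sym)
  then show ?thesis using comms_cong commutator_comms by blast
qed

text \<open>With \<open>regular_comms\<close> this locates the exceptional vertex: a vertex outside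
  \<open>comms\<close> receives no arc and is not regular.\<close>

lemma head_comms: "e \<in> arcs E \<Longrightarrow> V (head E e) \<in> comms"
proof -
  assume e: "e \<in> arcs E"
  have "V (head E e) \<approx> G e * A e" using GA[OF e e] by (simp add: eqv_sym)
  then show ?thesis using comms_cong R_left[OF lie_sub_comms arc_comms[OF e]] by blast
qed

lemma regular_comms: "regular_vertex E v \<Longrightarrow> V v \<in> comms"
proof -
  assume v: "regular_vertex E v"
  have "(\<Sum>e\<in>out_arcs E v. A e * G e) \<in> comms"
    by (rule fa.subspace_sum[OF subspace_comms], rule R[OF lie_sub_comms], rule arc_comms) simp
  then show ?thesis using comms_cong[OF CK2[OF v]] by blast
qed

end

text \<open>Over a single letter all words commute already in the free algebra. In
  \<open>necessity\<close> this excludes that no vertex lies in \<open>comms\<close>: the heads of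
  all arcs lie there, so the graph would have no arcs and at most one vertex.\<close>

lemma commutative_trivial:
  assumes "arcs E = {}" "verts E \<subseteq> {v}"
  shows "commutative_kalg (leavitt K E)"
proof -
  have gens: "lpa_gens E \<subseteq> {Vert v}" using assms by (auto simp: lpa_gens_def)
  have comm: "a @ b = b @ a" if "a \<in> lists (lpa_gens E)" "b \<in> lists (lpa_gens E)" for a b
  proof -
    have "a = replicate (length a) (Vert v)" "b = replicate (length b) (Vert v)"
      using that gens by (auto intro!: replicate_eqI)
    then show ?thesis by (metis add.commute replicate_add)
  qed
  have "x * y = y * x" if "x \<in> Car" "y \<in> Car" for x y
  proof -
    have "x * mon b = mon b * x" if b: "b \<in> lists (lpa_gens E)" for b
    proof (rule mon_induct[of "\<lambda>x. x * mon b = mon b * x"])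
      show "fa.subspace {x. x * mon b = mon b * x}"
        by (simp add: fa.subspace_def distrib_left distrib_right single_Nil_left_commute mult.assoc)
      show "mon a * mon b = mon b * mon a" if "a \<in> Poly_Mapping.keys x" for a
      proof -
        have "a \<in> lists (lpa_gens E)" using that \<open>x \<in> Car\<close> unfolding Car_iff by blast
        from comm[OF this b] show ?thesis by (simp only: mon_mult)
      qed
    qed
    then have *: "x * mon b = mon b * x" if "b \<in> Poly_Mapping.keys y" for b
      using that \<open>y \<in> Car\<close> unfolding Car_iff by blast
    show ?thesis
    proof (rule mon_induct[of "\<lambda>y. x * y = y * x"])
      show "fa.subspace {y. x * y = y * x}"
        by (simp add: fa.subspace_def distrib_left distrib_right single_Nil_left_commute mult.assoc)
    qed (rule *)
  qed
  then show ?thesis unfolding commutative_kalg_def leavitt_carrier by (auto simp: leavitt_ops)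
qed

theorem necessity:
  assumes R: "\<And>U u a. lie_sub U \<Longrightarrow> u \<in> U \<Longrightarrow> u * a \<in> U" and nc: "\<not> commutative_kalg (leavitt K E)"
  shows "CHAR('k) > 0 \<and>
    (p_commutator_graph (CHAR('k)) E \<or> (\<exists>F v. p_commutator_plus_isolated (CHAR('k)) E F v) \<or>
     (\<exists>H v. p_commutator_porcupine (CHAR('k)) E H v))"
proof -
  note acyc = necessity_acyclic[OF R]
  obtain v0 where v0: "\<And>v. v \<noteq> v0 \<Longrightarrow> V v \<in> comms" using exceptional_vertex[OF R] by blast
  define H where "H = {v \<in> verts E. V v \<in> comms}"
  have HV: "H \<subseteq> verts E" and HS: "verts E = H \<union> (verts E - H)" and S: "verts E - H \<subseteq> {v0}"
    using v0 by (auto simp: H_def)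
  have heads: "head E e \<in> H" if "e \<in> arcs E" for e using head_comms[OF R that] that by (simp add: H_def)
  have reg: "regular_vertex E x" if "x \<in> H" for x using comm_imp_regular[OF acyc] that by (simp add: H_def)
  have van: "vanishing (CHAR('k)) E x" if "x \<in> H" for x
    by (rule comm_imp_vanishing[OF acyc HV heads _ that]) (simp_all add: H_def)
  interpret almost_p_commutator E K H "verts E - H" v0
    by unfold_locales (use acyc HV S heads reg van in auto)
  have "H \<noteq> {}"
  proof
    assume "H = {}"
    then have "arcs E = {}" "verts E \<subseteq> {v0}" using heads S by auto
    then show False using commutative_trivial nc by blast
  qed
  then obtain x where x: "x \<in> H" by blast
  have "\<exists>B. finite B \<and> B \<subseteq> H \<and> x \<in> B \<and> (\<forall>w. CHAR('k) dvd card {q \<in> exits E B x. head E (last q) = w})"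
    by (rule van_large[OF x finite.emptyI]) (intro exI conjI allI)
  then obtain B where B: "finite B" "B \<subseteq> H" "x \<in> B"
    "\<And>w. CHAR('k) dvd card {q \<in> exits E B x. head E (last q) = w}" by (elim exE conjE) blast
  have regB: "\<And>x. x \<in> B \<Longrightarrow> regular_vertex E x" using B(2) reg by blast
  obtain q where q: "q \<in> exits E B x" using exits_nonempty[OF acyc B(1) regB B(3)] by blast
  \<comment> \<open>Characteristic 0 would mean that 0 divides the number of exit paths with the
    same end as \<open>q\<close>, so that this number is 0; but \<open>q\<close> is one of
    them.\<close>
  have "CHAR('k) \<noteq> 0"
  proof
    assume "CHAR('k) = 0"
    then have "card {r \<in> exits E B x. head E (last r) = head E (last q)} = 0" using B(4)[of "head E (last q)"] by simp
    then show False using finite_exits[OF acyc B(1) regB B(3)] q by auto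
  qed
  moreover have "p_commutator_graph (CHAR('k)) E \<or> (\<exists>F v. p_commutator_plus_isolated (CHAR('k)) E F v) \<or>
     (\<exists>H v. p_commutator_porcupine (CHAR('k)) E H v)"
  proof (cases "verts E = H")
    case True
    then show ?thesis unfolding p_commutator_graph_iff using acyc reg van by blast
  next
    case False
    then have v: "v0 \<in> verts E" "v0 \<notin> H" and V: "verts E = H \<union> {v0}" using HV S by auto
    have nreg: "\<not> regular_vertex E v0" using regular_comms[OF R] v by (auto simp: H_def)
    have in_v: "in_arcs E v0 = {}" using heads v(2) by (auto simp: in_arcs_def)
    show ?thesis
    \<comment> \<open>The vertex \<open>v0\<close> is not regular: as a sink it is isolated and
      leads to the second case, as an infinite emitter it leads to the third.\<close>
    proof (cases "sink_vertex E v0")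
      case True
      let ?F = "induced_on E H"
      interpret I: hereditary_embedding ?F E id id by (rule induced_on_embedding[OF HV heads])
      have vF: "verts ?F = H" by (simp add: induced_on_def)
      have out_v: "out_arcs E v0 = {}" using True by (simp add: sink_vertex_def)
      have "tail E e \<in> H" if "e \<in> arcs E" for e using that V out_v tail_in_verts[OF that] by auto
      then have aF: "arcs ?F = arcs E" by (auto simp: induced_on_def)
      have "p_commutator_graph (CHAR('k)) ?F"
        unfolding I.G1.p_commutator_graph_iff vF
        using I.acyclic_image[OF acyc] I.regular_iff I.vanishing_iff reg van unfolding vF by simp
      moreover have "disjoint_union_isolated E ?F v0"
        unfolding disjoint_union_isolated_def aF vF isolated_vertex_def
        using V v in_v out_v I.G1.wf_digraph_axioms by (simp add: induced_on_def)
      ultimately show ?thesis unfolding p_commutator_plus_isolated_def by blast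
    next
      case False
      then have inf: "infinite_emitter E v0" using nreg v(1) by (simp add: regular_vertex_def)
      have "hereditary E H" unfolding hereditary_def using HV awalk_in_H by blast
      moreover have "saturated E H" unfolding saturated_def
        using HV nreg V by (auto simp: regular_vertex_def)
      moreover have "{w. infinite_emitter E w} = {v0}"
        using inf reg V by (auto simp: infinite_emitter_def regular_vertex_def)
      moreover have "source_vertex E v0" using v in_v by (simp add: source_vertex_def)
      moreover have "p_commutator_graph (CHAR('k)) (porcupine E H v0)"
        using p_commutator_porcupine_iff[of H "CHAR('k)" v0] HV heads acyc reg van by blast
      ultimately show ?thesis unfolding p_commutator_porcupine_def using V v \<open>H \<noteq> {}\<close> by blast
    qed
  qed
  ultimately show ?thesis by blast
qed

theorem sufficiency:
  assumes "p_commutator_graph (CHAR('k)) E \<or> (\<exists>F v. p_commutator_plus_isolated (CHAR('k)) E F v) \<or>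
     (\<exists>H v. p_commutator_porcupine (CHAR('k)) E H v)"
    and U: "lie_sub U" "u \<in> U"
  shows "u * a \<in> U"
  using assms(1)
proof (elim disjE exE)
  assume p: "p_commutator_graph (CHAR('k)) E"
  \<comment> \<open>With \<open>S\<close> empty, any value may stand for the exceptional
    vertex.\<close>
  interpret almost_p_commutator E K "verts E" "{}" undefined
    by unfold_locales (use p in \<open>auto simp: p_commutator_graph_iff\<close>)
  show ?thesis using lie_sub_ideal U by blast
next
  fix F v assume "p_commutator_plus_isolated (CHAR('k)) E F v"
  then have p: "p_commutator_graph (CHAR('k)) F" and d: "disjoint_union_isolated E F v"
    by (auto simp: p_commutator_plus_isolated_def)
  interpret F: wf_digraph F using d by (simp add: disjoint_union_isolated_def)
  interpret I: hereditary_embedding F E id id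
    by unfold_locales (use d in \<open>auto simp: disjoint_union_isolated_def out_arcs_def\<close>)
  have heads: "head E e \<in> verts F" if "e \<in> arcs E" for e
    using d that by (auto simp: disjoint_union_isolated_def)
  interpret almost_p_commutator E K "verts F" "{v}" v
  proof unfold_locales
    show "acyclic_digraph E" using I.acyclic_transfer heads p by (simp add: F.p_commutator_graph_iff)
    show "regular_vertex E x" if "x \<in> verts F" for x
      using I.regular_iff[OF that] p that by (simp add: F.p_commutator_graph_iff)
    show "vanishing (CHAR('k)) E x" if "x \<in> verts F" for x
      using I.vanishing_iff[OF that] p that by (simp add: F.p_commutator_graph_iff)
  qed (use d heads in \<open>auto simp: disjoint_union_isolated_def\<close>)
  show ?thesis using lie_sub_ideal U by blast
next
  fix H v assume *: "p_commutator_porcupine (CHAR('k)) E H v"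
  then have V: "verts E = H \<union> {v}" "v \<notin> H" and s: "source_vertex E v"
    and p: "p_commutator_graph (CHAR('k)) (porcupine E H v)" by (auto simp: p_commutator_porcupine_def)
  have heads: "head E e \<in> H" if "e \<in> arcs E" for e
    using that s V head_in_verts[OF that] by (auto simp: source_vertex_def in_arcs_def)
  have HV: "H \<subseteq> verts E" using V by blast
  have "acyclic_digraph E \<and> (\<forall>x\<in>H. regular_vertex E x) \<and> (\<forall>x\<in>H. vanishing (CHAR('k)) E x)"
    using p_commutator_porcupine_iff[of H "CHAR('k)" v] HV heads p by blast
  then interpret almost_p_commutator E K H "{v}" v
    by unfold_locales (use V heads in auto)
  show ?thesis using lie_sub_ideal U by blast
qed

end

section \<open>The two decompositions\<close>

context lpa
begin

definition quot :: "(('v, 'e) lpa_gen list \<Rightarrow>\<^sub>0 'k) set \<Rightarrow> (('v, 'e) lpa_gen list \<Rightarrow>\<^sub>0 'k) set set" where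
  "quot S = (\<lambda>x. cls (res x)) ` S"

lemma quot_ideal:
  assumes sub: "fa.subspace S" and S: "S \<subseteq> augm" and mult: "\<And>a x. x \<in> S \<Longrightarrow> a * x \<in> S" "\<And>a x. x \<in> S \<Longrightarrow> x * a \<in> S"
  shows "kalg_ideal (leavitt K E) (quot S)"
proof -
  have car: "res x \<in> Car" if "x \<in> S" for x using that S res_in_Car by blast
  have add: "kadd (leavitt K E) (cls (res x)) (cls (res y)) \<in> quot S" if "x \<in> S" "y \<in> S" for x y
  proof -
    have "cls (res x + res y) = cls (res (x + y))" by (simp add: restr_add)
    then show ?thesis using fa.subspace_add[OF sub that] that unfolding quot_def by (auto simp: leavitt_ops car)
  qed
  have diff: "kdiff (leavitt K E) (cls (res x)) (cls (res y)) \<in> quot S" if "x \<in> S" "y \<in> S" for x y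
  proof -
    have "cls (res x - res y) = cls (res (x - y))" by (simp add: restr_diff)
    then show ?thesis using fa.subspace_diff[OF sub that] that unfolding quot_def by (auto simp: leavitt_ops car)
  qed
  have scale: "kscale (leavitt K E) c (cls (res x)) \<in> quot S" if "x \<in> S" for x c
  proof -
    have "cls (scal c * res x) = cls (res (scal c * x))" by (simp add: restr_scale)
    then show ?thesis using fa.subspace_scale[OF sub that] that leavitt_ops(4)[OF car[OF that] car[OF that]]
      unfolding quot_def by auto
  qed
  have mul: "kmult (leavitt K E) (cls a) (cls (res x)) \<in> quot S" "kmult (leavitt K E) (cls (res x)) (cls a) \<in> quot S"
    if "x \<in> S" "a \<in> Car" for x a
  proof -
    have "cls (a * res x) = cls (res (a * x))" "cls (res x * a) = cls (res (x * a))"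
      by (simp_all add: restr_mult res_Car[OF that(2)])
    then show "kmult (leavitt K E) (cls a) (cls (res x)) \<in> quot S" "kmult (leavitt K E) (cls (res x)) (cls a) \<in> quot S"
      using mult that unfolding quot_def by (auto simp: leavitt_ops car)
  qed
  have zero: "kzero (leavitt K E) \<in> quot S"
    unfolding leavitt_zero quot_def using fa.subspace_0[OF sub] by (auto simp: restr_zero intro!: image_eqI[of _ _ 0])
  have subset: "quot S \<subseteq> kcarrier (leavitt K E)"
    unfolding quot_def leavitt_carrier using car by blast
  have el: "X \<in> quot S \<longleftrightarrow> (\<exists>x\<in>S. X = cls (res x))" for X unfolding quot_def by blast
  have "ksubspace (leavitt K E) (quot S)"
    unfolding ksubspace_def using zero subset add scale by (simp only: el Ball_def) blast
  moreover have "ring_ideal (leavitt K E) (quot S)"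
    unfolding ring_ideal_def
  proof (intro conjI ballI)
    fix X Y assume "X \<in> quot S" "Y \<in> quot S"
    then show "kdiff (leavitt K E) X Y \<in> quot S" using diff el by metis
  next
    fix X Y assume X: "X \<in> quot S" and "Y \<in> kcarrier (leavitt K E)"
    then obtain a where "a \<in> Car" "Y = cls a" unfolding leavitt_carrier by blast
    then show "kmult (leavitt K E) Y X \<in> quot S" "kmult (leavitt K E) X Y \<in> quot S" using mul X el by metis+
  qed (use zero subset in auto)
  ultimately show ?thesis by (simp add: kalg_ideal_def)
qed

lemma leavitt_gen_cls: "leavitt_gen K E g = cls (mon [g])"
  by (simp add: leavitt_gen_def)

lemma mon_gen_Car: "g \<in> lpa_gens E \<Longrightarrow> mon [g] \<in> Car"
  by (simp add: Car_iff)

text \<open>The sum of \<open>S\<close> and the line through \<open>V v\<close> contains all letters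
  and is closed under left multiplication by them: no arc ends in \<open>v\<close>, so
  \<open>Arc e\<close> kills \<open>V v\<close>, while a ghost letter kills it or absorbs it and
  then lies in \<open>S\<close>. Both decompositions rest on this, with different choices of
  \<open>S\<close>.\<close>

lemma augm_line_plus:
  assumes S: "fa.subspace S" "Z \<subseteq> S" and left: "\<And>g x. x \<in> S \<Longrightarrow> mon [g] * x \<in> S"
    and v: "v \<in> verts E" and src: "\<And>e. e \<in> arcs E \<Longrightarrow> head E e \<noteq> v"
    and gens: "\<And>g. g \<in> lpa_gens E \<Longrightarrow> g \<noteq> Vert v \<Longrightarrow> mon [g] \<in> S"
    and x: "x \<in> augm"
  shows "\<exists>k. x - scal k * V v \<in> S"
proof -
  let ?W = "{x. \<exists>k. x - scal k * V v \<in> S}"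
  have W: "fa.subspace ?W" by (rule subspace_shifted[OF S(1)])
  have SW: "S \<subseteq> ?W" by (intro subsetI CollectI exI[of _ 0]) simp
  have cong: "y \<in> S" if "y \<approx> z" "z \<in> S" for y z by (rule cong_mem[OF S that])
  have zero: "0 \<in> S" by (rule fa.subspace_0[OF S(1)])
  have gens': "mon [g] \<in> S" if "g \<noteq> Vert v" for g
    using that gens notin_gens[of g] cong[OF _ zero] by blast
  have gV: "mon [g] * V v \<in> ?W" for g
  proof (cases g)
    case (Vert x)
    show ?thesis
    proof (cases "x = v")
      case True
      have "V v * V v - scal 1 * V v \<in> Z" using VV[of v v] by (simp add: eqv_def single_Nil_one)
      then show ?thesis using S(2) Vert True by blast
    next
      case False
      then have "V x * V v \<in> S" using VV[of x v] cong[OF _ zero] by auto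
      then show ?thesis using SW Vert by blast
    qed
  next
    case (Arc e)
    have "A e * V v \<approx> 0"
    proof (cases "e \<in> arcs E")
      case True
      then have "v \<noteq> head E e" using src by blast
      then show ?thesis by (rule AV_ne)
    next
      case False
      then show ?thesis by (rule eqv_zero_right[OF A_zero])
    qed
    then have "A e * V v \<in> S" using cong zero by blast
    then show ?thesis using SW Arc by blast
  next
    case (Ghost e)
    have "G e * V v \<in> S"
    proof (cases "tail E e = v \<and> e \<in> arcs E")
      case True
      then have "G e * V v \<approx> G e" using GV[of e] by simp
      then show ?thesis using cong gens' by blast
    next
      case False
      have "G e * V v \<approx> 0"
      proof (cases "e \<in> arcs E")
        case True
        then have "v \<noteq> tail E e" using False by blast
        then show ?thesis by (rule GV_ne)
      next
        case False
        then show ?thesis by (rule eqv_zero_right[OF G_zero])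
      qed
      then show ?thesis using cong zero by blast
    qed
    then show ?thesis using SW Ghost by blast
  qed
  have "augm \<subseteq> ?W"
  proof (rule augm_minimal[OF W])
    fix g x assume "x \<in> ?W"
    then obtain k where k: "x - scal k * V v \<in> S" by blast
    have "mon [g] * (x - scal k * V v) + scal k * (mon [g] * V v) \<in> ?W"
      using left[OF k] SW by (intro fa.subspace_add[OF W] fa.subspace_scale[OF W] gV) blast
    then show "mon [g] * x \<in> ?W" by (simp add: right_diff_distrib single_Nil_left_commute)
  next
    fix g show "mon [g] \<in> ?W"
    proof (cases "g = Vert v")
      case True
      have "V v - scal 1 * V v = 0" by (simp add: single_Nil_one)
      then have "V v - scal 1 * V v \<in> S" using zero by simp
      then show ?thesis using True by blast
    next
      case False
      then show ?thesis using gens' SW by blast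
    qed
  qed
  then show ?thesis using x by blast
qed

lemma ring_ideal_carrier: "ring_ideal (leavitt K E) (kcarrier (leavitt K E))"
proof -
  interpret L: kalgebra "leavitt K E" by (rule kalgebra_leavitt) unfold_locales
  show ?thesis unfolding ring_ideal_def using L.zero_closed L.diff_closed L.mult_closed by blast
qed

lemma ring_ideal_gen_ideal:
  assumes "S \<subseteq> kcarrier (leavitt K E)"
  shows "ring_ideal (leavitt K E) (ring_ideal_gen (leavitt K E) S)" "S \<subseteq> ring_ideal_gen (leavitt K E) S"
proof -
  let ?J = "ring_ideal_gen (leavitt K E) S"
  have sub: "?J \<subseteq> kcarrier (leavitt K E)"
    unfolding ring_ideal_gen_def using assms ring_ideal_carrier by (intro Inter_lower) simp
  show "S \<subseteq> ?J" by (auto simp: ring_ideal_gen_def)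
  show "ring_ideal (leavitt K E) ?J"
    unfolding ring_ideal_def[of _ ?J] using sub by (auto simp: ring_ideal_gen_def ring_ideal_def)
qed

text \<open>
  A ring ideal need not be closed under scalars a priori. The proof works with the elements all of whose
  scalar multiples lie in the ring ideal; these include the vertices in \<open>H\<close>, as vertices are idempotent.
\<close>

theorem leavitt_source_sum:
  assumes V: "verts E = H \<union> {v}" "v \<notin> H" and src: "source_vertex E v"
  shows "kcarrier (leavitt K E) =
    ksum (leavitt K E) (kline (leavitt K E) (leavitt_gen K E (Vert v)))
      (ring_ideal_gen (leavitt K E) ((\<lambda>w. leavitt_gen K E (Vert w)) ` H))"
proof -
  interpret L: kalgebra "leavitt K E" by (rule kalgebra_leavitt) unfold_locales
  have heads: "head E e \<in> H" if "e \<in> arcs E" for e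
    using that src V head_in_verts[OF that] by (auto simp: source_vertex_def in_arcs_def)
  let ?L = "leavitt K E" and ?gH = "(\<lambda>w. leavitt_gen K E (Vert w)) ` H"
  let ?J = "ring_ideal_gen ?L ?gH"
  have VC: "V w \<in> Car" if "w \<in> verts E" for w using that by (intro mon_gen_Car) (simp add: lpa_gens_def)
  have "?gH \<subseteq> kcarrier ?L" unfolding leavitt_gen_cls leavitt_carrier using VC V by blast
  note J = ring_ideal_gen_ideal[OF this]
  have JC: "?J \<subseteq> kcarrier ?L" and J0: "cls 0 \<in> ?J"
    and Jd: "\<And>x y. x \<in> ?J \<Longrightarrow> y \<in> ?J \<Longrightarrow> kdiff ?L x y \<in> ?J"
    and Jm: "\<And>x y. x \<in> ?J \<Longrightarrow> y \<in> kcarrier ?L \<Longrightarrow> kmult ?L y x \<in> ?J \<and> kmult ?L x y \<in> ?J"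
    using J(1) unfolding ring_ideal_def leavitt_zero by auto
  have Jd': "cls (x - y) \<in> ?J" if "cls x \<in> ?J" "cls y \<in> ?J" "x \<in> Car" "y \<in> Car" for x y
    using Jd[OF that(1,2)] leavitt_ops(2)[OF that(3,4)] by simp
  have Ja: "cls (x + y) \<in> ?J" if "cls x \<in> ?J" "cls y \<in> ?J" "x \<in> Car" "y \<in> Car" for x y
  proof -
    have "0 - y \<in> Car" by (rule Car_facts(3)[OF Car_facts(1) that(4)])
    from Jd'[OF that(1) Jd'[OF J0 that(2) Car_facts(1) that(4)] that(3) this] show ?thesis by simp
  qed
  have Jm': "cls (y * x) \<in> ?J" "cls (x * y) \<in> ?J" if "cls x \<in> ?J" "x \<in> Car" "y \<in> Car" for x y
    using Jm[OF that(1), of "cls y"] leavitt_ops(3)[OF that(2,3)] leavitt_ops(3)[OF that(3,2)] that(3)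
    unfolding leavitt_carrier by auto
  let ?S = "{x \<in> augm. \<forall>k. cls (res (scal k * x)) \<in> ?J}"
  have SC: "res (scal k * x) \<in> Car" if "x \<in> augm" for x k
    using that by (intro res_in_Car fa.subspace_scale[OF subspace_augm])
  have S: "fa.subspace ?S"
    unfolding fa.subspace_def
  proof (intro conjI ballI allI)
    show "0 \<in> ?S" using J0 fa.subspace_0[OF subspace_augm] by (simp add: restr_zero)
  next
    fix x y assume "x \<in> ?S" "y \<in> ?S"
    then show "x + y \<in> ?S"
      using fa.subspace_add[OF subspace_augm] Ja SC by (simp add: distrib_left restr_add)
  next
    fix c x assume "x \<in> ?S"
    then show "scal c * x \<in> ?S"
      using fa.subspace_scale[OF subspace_augm] by (simp add: single_Nil_mult)
  qed
  have SZ: "Z \<subseteq> ?S"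
  proof
    fix x assume x: "x \<in> Z"
    have "cls (res (scal k * x)) = cls 0" for k
      using cls_res_eqv[of "scal k * x" 0] Z_mult(1)[OF x] Z_augm fa.subspace_0[OF subspace_augm]
      by (auto simp: eqv_def restr_zero)
    then show "x \<in> ?S" using x Z_augm J0 by auto
  qed
  have left: "mon [g] * x \<in> ?S" and right: "x * mon [g] \<in> ?S" if x: "x \<in> ?S" for g x
  proof -
    have g: "mon [g] \<in> augm" by (simp add: mon_augm)
    have "cls (res (mon [g]) * res (scal k * x)) \<in> ?J" "cls (res (scal k * x) * res (mon [g])) \<in> ?J" for k
      using x SC res_in_Car[OF g] by (intro Jm'; blast)+
    then have "cls (res (scal k * (mon [g] * x))) \<in> ?J" "cls (res (scal k * (x * mon [g]))) \<in> ?J" for k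
      by (simp_all add: restr_mult res_scal single_Nil_left_commute mult.assoc)
    then show "mon [g] * x \<in> ?S" "x * mon [g] \<in> ?S" using augm_mult x by auto
  qed
  have cong: "x \<in> ?S" if "x \<approx> y" "y \<in> ?S" for x y by (rule cong_mem[OF S SZ that])
  have VS: "V h \<in> ?S" if h: "h \<in> H" for h
  proof -
    have hv: "h \<in> verts E" using h V by blast
    have "cls (V h) \<in> ?J" using J(2) h by (auto simp: leavitt_gen_cls)
    then have "cls ((scal k * V h) * V h) \<in> ?J" for k
      using VC[OF hv] Car_facts(5) by (intro Jm')
    moreover have "cls ((scal k * V h) * V h) = cls (scal k * V h)" for k
    proof -
      have "(scal k * V h) * V h \<approx> scal k * V h"
        using eqv_left[OF VV[of h h], of "scal k"] by (simp add: mult.assoc)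
      then show ?thesis
        using cls_res_eqv[of "(scal k * V h) * V h" "scal k * V h"] VC[OF hv] Car_facts(4,5) by (simp add: res_Car Car_augm)
    qed
    ultimately show ?thesis using VC[OF hv] by (simp add: res_Car Car_augm Car_facts)
  qed
  have gens: "mon [g] \<in> ?S" if gen: "g \<in> lpa_gens E" "g \<noteq> Vert v" for g
  proof -
    consider h where "g = Vert h" "h \<in> H" | e where "g = Arc e" "e \<in> arcs E" | e where "g = Ghost e" "e \<in> arcs E"
      using gen V by (cases g) (auto simp: lpa_gens_def)
    then show ?thesis
    proof cases
      case 1
      then show ?thesis using VS by blast
    next
      case 2
      then show ?thesis using cong[OF eqv_sym[OF AV] left[OF VS[OF heads]]] by blast
    next
      case 3
      then show ?thesis using cong[OF eqv_sym[OF VG] right[OF VS[OF heads]]] by blast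
    qed
  qed
  have v: "v \<in> verts E" using V by blast
  have noin: "head E e \<noteq> v" if "e \<in> arcs E" for e using heads[OF that] V(2) by blast
  show ?thesis
  proof (intro subset_antisym subsetI)
    fix X assume "X \<in> kcarrier ?L"
    then obtain x where x: "x \<in> Car" "X = cls x" unfolding leavitt_carrier by blast
    obtain k where k: "x - scal k * V v \<in> ?S"
      using augm_line_plus[OF S SZ left v noin gens Car_augm[OF x(1)]] by blast
    have kV: "scal k * V v \<in> Car" using VC[OF v] Car_facts(5) by blast
    have d: "x - scal k * V v \<in> Car" using Car_facts(3) x(1) kV by blast
    have "cls (res (scal 1 * (x - scal k * V v))) \<in> ?J" using k by blast
    then have "cls (x - scal k * V v) \<in> ?J" using d by (simp add: single_Nil_one res_Car)
    moreover have "kscale ?L k (cls (V v)) \<in> kline ?L (leavitt_gen K E (Vert v))"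
      unfolding kline_def leavitt_gen_cls by blast
    moreover have "X = kadd ?L (kscale ?L k (cls (V v))) (cls (x - scal k * V v))"
      using leavitt_ops(4)[OF VC[OF v] VC[OF v]] leavitt_ops(1)[OF kV d] x(2) by simp
    ultimately show "X \<in> ksum ?L (kline ?L (leavitt_gen K E (Vert v))) ?J" unfolding ksum_def by blast
  next
    fix X assume "X \<in> ksum ?L (kline ?L (leavitt_gen K E (Vert v))) ?J"
    then obtain k Y where XY: "X = kadd ?L (kscale ?L k (cls (V v))) Y" "Y \<in> ?J"
      unfolding ksum_def kline_def leavitt_gen_cls by blast
    have "cls (V v) \<in> kcarrier ?L" unfolding leavitt_carrier using VC[OF v] by blast
    then show "X \<in> kcarrier ?L" unfolding XY(1) using XY(2) JC by (intro L.add_closed L.scale_closed) blast+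
  qed
qed

end

text \<open>Killing the letter \<open>Vert v\<close> respects the relations of \<open>E\<close>,
  because \<open>v\<close> meets no arc and is not regular; this is
  \<open>E.Z \<subseteq> F.Z\<close> and yields injectivity. Conversely the relations of
  \<open>F\<close> hold in the algebra of \<open>E\<close>, which yields the homomorphism. All
  generators of \<open>F\<close> annihilate \<open>v\<close>, so the sum is direct.\<close>

theorem leavitt_splits_isolated:
  fixes E F :: "('v, 'e) pre_digraph" and K :: "'k::field itself"
  assumes wf: "wf_digraph E" and d: "disjoint_union_isolated E F v"
  shows "leavitt_splits K E F v"
proof -
  interpret E: lpa E K using wf by (simp add: lpa_def)
  interpret F: lpa F K using d by (simp add: lpa_def disjoint_union_isolated_def)
  have V: "verts E = verts F \<union> {v}" "v \<notin> verts F" and arcs: "arcs F = arcs E"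
    and t: "\<And>e. e \<in> arcs E \<Longrightarrow> tail F e = tail E e" and h: "\<And>e. e \<in> arcs E \<Longrightarrow> head F e = head E e"
    and iso: "isolated_vertex E v"
    using d by (auto simp: disjoint_union_isolated_def)
  have ends: "tail E e \<in> verts F" "head E e \<in> verts F" if "e \<in> arcs E" for e
    using F.tail_in_verts[of e] F.head_in_verts[of e] that arcs t[OF that] h[OF that] by auto
  have ne: "head E e \<noteq> v" "tail E e \<noteq> v" if "e \<in> arcs E" for e using ends[OF that] V(2) by auto
  have out: "out_arcs F w = out_arcs E w" for w using arcs t by (auto simp: out_arcs_def)
  have reg: "regular_vertex F w \<longleftrightarrow> regular_vertex E w" for w
  proof (cases "w = v")
    case True
    then show ?thesis using V iso by (simp add: regular_vertex_def sink_vertex_def isolated_vertex_def)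
  next
    case False
    then show ?thesis using V by (simp add: regular_vertex_def sink_vertex_def infinite_emitter_def out)
  qed
  have gens: "lpa_gens E = insert (Vert v) (lpa_gens F)"
    using V arcs by (auto simp: lpa_gens_def)
  have gF: "Vert v \<notin> lpa_gens F" using V by (auto simp: lpa_gens_def)
  have "lists (lpa_gens F) \<subseteq> lists (lpa_gens E)" using gens by (intro lists_mono) auto
  then have CarFE: "F.Car \<subseteq> E.Car" unfolding subset_iff E.Car_iff F.Car_iff by blast
  let ?r = "restr (lpa_gens F) :: (('v, 'e) lpa_gen list \<Rightarrow>\<^sub>0 'k) \<Rightarrow> _"
  have "E.Z \<subseteq> F.Z"
  proof (rule E.Z_minimal)
    fix x :: "('v, 'e) lpa_gen list \<Rightarrow>\<^sub>0 'k" assume "x \<in> lpa_rels E"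
    then show "x \<in> F.Z"
      by (cases rule: E.lpa_relsE)
        (use F.VV F.VA F.AV F.VG F.GV F.GA F.CK2 in
          \<open>simp_all add: F.eqv_def t[symmetric] h[symmetric] arcs reg out cong: if_cong\<close>)
  next
    fix g :: "('v, 'e) lpa_gen" assume "g \<notin> lpa_gens E"
    then show "mon [g] \<in> F.Z" using F.notin_gens F.eqv_zero_iff gens by blast
  qed (auto intro: F.subspace_Z F.Z_mult)
  then have idEF: "x \<in> lpa_ideal F" if x: "x \<in> lpa_ideal E" "x \<in> F.Car" for x
  proof -
    have "E.res x = x" using x(2) CarFE E.res_Car by blast
    then have "x \<in> F.Z" using x(1) \<open>E.Z \<subseteq> F.Z\<close> by (auto simp: E.Z_def)
    then show ?thesis using F.res_Car[OF x(2)] by (simp add: F.Z_def)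
  qed
  have "F.Z \<subseteq> {x. ?r x \<in> E.Z}"
  proof (rule F.Z_minimal)
    show "fa.subspace {x. ?r x \<in> E.Z}"
      using E.subspace_Z by (simp add: fa.subspace_def restr_zero restr_add restr_scale)
  next
    fix x :: "('v, 'e) lpa_gen list \<Rightarrow>\<^sub>0 'k" assume x: "x \<in> lpa_rels F"
    then have "?r x = x" by (intro F.res_Car) (use lpa_rels_carrier[OF F.wf_digraph_axioms] in blast)
    moreover from x have "x \<in> E.Z"
      by (cases rule: F.lpa_relsE)
        (use E.VV E.VA E.AV E.VG E.GV E.GA E.CK2 in
          \<open>simp_all add: E.eqv_def t h arcs reg out cong: if_cong\<close>)
    ultimately show "x \<in> {x. ?r x \<in> E.Z}" by simp
  qed (auto simp: restr_mult restr_mon intro: E.Z_mult fa.subspace_0[OF E.subspace_Z])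
  then have FE: "\<And>x. x \<in> F.Z \<Longrightarrow> ?r x \<in> E.Z" by blast
  have idFE: "x \<in> lpa_ideal E" if x: "x \<in> lpa_ideal F" "x \<in> F.Car" for x
  proof -
    have "E.res x = x" using x(2) CarFE E.res_Car by blast
    moreover have "x \<in> F.Z" using x(1) F.res_Car[OF x(2)] by (simp add: F.Z_def)
    then have "x \<in> E.Z" using FE[of x] F.res_Car[OF x(2)] by simp
    ultimately show ?thesis by (simp add: E.Z_def)
  qed
  \<comment> \<open>The saturation of a class under the congruence of \<open>E\<close>. By
    \<open>idFE\<close> this congruence contains that of \<open>F\<close>, so the value at an
    \<open>F\<close>-class is the \<open>E\<close>-class of any of its elements.\<close>
  define \<phi> where "\<phi> X = kcong (free_kalg (lpa_gens E)) (lpa_ideal E) `` X" for X :: "(('v, 'e) lpa_gen list \<Rightarrow>\<^sub>0 'k) set"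
  have \<phi>: "\<phi> (F.cls x) = E.cls x" if x: "x \<in> F.Car" for x
  proof -
    have 1: "E.cls y = E.cls x" if "y \<in> F.cls x" for y
    proof -
      have "y \<in> F.Car" "x - y \<in> lpa_ideal F" using that by (auto simp: kcong_iff[OF F.ideal_Z])
      then have "E.cls x = E.cls y" using x CarFE idFE F.Car_facts(3) by (subst E.cls_eq) auto
      then show ?thesis ..
    qed
    have 2: "x \<in> F.cls x" using x F.idf(1) by (simp add: kcong_iff[OF F.ideal_Z])
    have "\<phi> (F.cls x) = (\<Union>y\<in>F.cls x. E.cls y)" unfolding \<phi>_def by blast
    also have "\<dots> = E.cls x" using 1 2 by blast
    finally show ?thesis .
  qed
  have hom: "kalg_hom (leavitt K F) (leavitt K E) \<phi>"
    unfolding kalg_hom_def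
  proof (intro conjI ballI allI subsetI)
    fix Y assume "Y \<in> \<phi> ` kcarrier (leavitt K F)"
    then show "Y \<in> kcarrier (leavitt K E)"
      unfolding E.leavitt_carrier F.leavitt_carrier using \<phi> CarFE by auto
  next
    fix X Y assume "X \<in> kcarrier (leavitt K F)" "Y \<in> kcarrier (leavitt K F)"
    then obtain x y where "x \<in> F.Car" "y \<in> F.Car" "X = F.cls x" "Y = F.cls y" unfolding F.leavitt_carrier by blast
    moreover from this have "x \<in> E.Car" "y \<in> E.Car" using CarFE by auto
    ultimately show "\<phi> (kadd (leavitt K F) X Y) = kadd (leavitt K E) (\<phi> X) (\<phi> Y)"
      "\<phi> (kmult (leavitt K F) X Y) = kmult (leavitt K E) (\<phi> X) (\<phi> Y)"
      by (simp_all add: F.leavitt_ops E.leavitt_ops \<phi> F.Car_facts)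
  next
    fix c X assume "X \<in> kcarrier (leavitt K F)"
    then obtain x where x: "x \<in> F.Car" "X = F.cls x" unfolding F.leavitt_carrier by blast
    then have "x \<in> E.Car" using CarFE by auto
    then show "\<phi> (kscale (leavitt K F) c X) = kscale (leavitt K E) c (\<phi> X)"
      using F.leavitt_ops(4)[OF x(1) x(1)] E.leavitt_ops(4) x by (simp add: \<phi> F.Car_facts)
  qed
  have gen: "\<forall>g\<in>lpa_gens F. \<phi> (leavitt_gen K F g) = leavitt_gen K E g"
    unfolding E.leavitt_gen_cls F.leavitt_gen_cls using \<phi> F.mon_gen_Car by blast
  have inj: "inj_on \<phi> (kcarrier (leavitt K F))"
  proof (rule inj_onI)
    fix X Y assume "X \<in> kcarrier (leavitt K F)" "Y \<in> kcarrier (leavitt K F)" and eq: "\<phi> X = \<phi> Y"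
    then obtain x y where xy: "x \<in> F.Car" "y \<in> F.Car" "X = F.cls x" "Y = F.cls y" unfolding F.leavitt_carrier by blast
    then have "E.cls x = E.cls y" using eq \<phi> by simp
    then have "x - y \<in> lpa_ideal E" using xy CarFE E.cls_eq[of x y] by blast
    from idEF[OF this F.Car_facts(3)[OF xy(1,2)]] have "x - y \<in> lpa_ideal F" .
    then show "X = Y" using xy F.cls_eq by blast
  qed
  let ?Vv = "E.V v"
  have vE: "v \<in> verts E" using V by blast
  have VvC: "?Vv \<in> E.Car" using gens by (intro E.mon_gen_Car) blast
  \<comment> \<open>\<open>S1\<close> and \<open>S2\<close> are the full preimages of the line
    through \<open>v\<close> and of the image of \<open>\<phi>\<close>; \<open>line\<close> and
    \<open>img\<close> below confirm this.\<close>
  define S1 where "S1 = {x. \<exists>k. E.eqv x (scal k * ?Vv)}"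
  define S2 where "S2 = {x. \<exists>y\<in>F.Car. E.eqv x y}"
  have S1: "fa.subspace S1" unfolding S1_def E.eqv_def by (rule E.subspace_shifted[OF E.subspace_Z])
  have S1Z: "E.Z \<subseteq> S1" unfolding S1_def by (intro subsetI CollectI exI[of _ 0]) (simp add: E.eqv_zero_iff)
  have augm_cong: "x \<in> E.augm" if "E.eqv x y" "y \<in> E.augm" for x y
    by (rule E.cong_mem[OF E.subspace_augm E.Z_augm that])
  have S1a: "S1 \<subseteq> E.augm"
  proof
    fix x assume "x \<in> S1"
    then obtain k where "E.eqv x (scal k * ?Vv)" by (auto simp: S1_def)
    then show "x \<in> E.augm" by (rule augm_cong) (intro fa.subspace_scale[OF E.subspace_augm] E.mon_augm, simp)
  qed
  have gV: "E.eqv (mon [g] * ?Vv) (if g = Vert v then ?Vv else 0)" "E.eqv (?Vv * mon [g]) (if g = Vert v then ?Vv else 0)" for g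
  proof -
    have 0: "E.eqv (mon [g] * ?Vv) 0" "E.eqv (?Vv * mon [g]) 0" if "g \<notin> lpa_gens E"
      by (rule E.eqv_zero_right[OF E.notin_gens[OF that]], rule E.eqv_zero_left[OF E.notin_gens[OF that]])
    show "E.eqv (mon [g] * ?Vv) (if g = Vert v then ?Vv else 0)"
    proof (cases g)
      case (Vert x)
      then show ?thesis using E.VV[of x v] by auto
    next
      case (Arc e)
      then show ?thesis using 0 E.AV_ne[of v e] ne[of e] by (cases "e \<in> arcs E") (auto simp: lpa_gens_def)
    next
      case (Ghost e)
      then show ?thesis using 0 E.GV_ne[of v e] ne[of e] by (cases "e \<in> arcs E") (auto simp: lpa_gens_def)
    qed
    show "E.eqv (?Vv * mon [g]) (if g = Vert v then ?Vv else 0)"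
    proof (cases g)
      case (Vert x)
      then show ?thesis using E.VV[of v x] by auto
    next
      case (Arc e)
      then show ?thesis using 0 E.VA_ne[of v e] ne[of e] by (cases "e \<in> arcs E") (auto simp: lpa_gens_def)
    next
      case (Ghost e)
      then show ?thesis using 0 E.VG_ne[of v e] ne[of e] by (cases "e \<in> arcs E") (auto simp: lpa_gens_def)
    qed
  qed
  have S1g: "mon [g] * x \<in> S1" "x * mon [g] \<in> S1" if x: "x \<in> S1" for g x
  proof -
    obtain k where k: "E.eqv x (scal k * ?Vv)" using x by (auto simp: S1_def)
    let ?l = "if g = Vert v then k else 0"
    have "E.eqv (mon [g] * x) (mon [g] * (scal k * ?Vv))" by (rule E.eqv_left[OF k])
    also have "\<dots> = scal k * (mon [g] * ?Vv)" by (rule single_Nil_left_commute)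
    also have "E.eqv \<dots> (scal k * (if g = Vert v then ?Vv else 0))" by (rule E.eqv_left[OF gV(1)])
    also have "\<dots> = scal ?l * ?Vv" by simp
    finally show "mon [g] * x \<in> S1" unfolding S1_def by blast
    have "E.eqv (x * mon [g]) ((scal k * ?Vv) * mon [g])" by (rule E.eqv_right[OF k])
    also have "\<dots> = scal k * (?Vv * mon [g])" by (rule mult.assoc)
    also have "E.eqv \<dots> (scal k * (if g = Vert v then ?Vv else 0))" by (rule E.eqv_left[OF gV(2)])
    also have "\<dots> = scal ?l * ?Vv" by simp
    finally show "x * mon [g] \<in> S1" unfolding S1_def by blast
  qed
  have S2: "fa.subspace S2"
    unfolding fa.subspace_def S2_def
  proof (intro conjI ballI allI)
    show "0 \<in> {x. \<exists>y\<in>F.Car. E.eqv x y}" using F.Car_facts(1) E.eqv_refl by blast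
  next
    fix x y assume "x \<in> {x. \<exists>y\<in>F.Car. E.eqv x y}" "y \<in> {x. \<exists>y\<in>F.Car. E.eqv x y}"
    then show "x + y \<in> {x. \<exists>y\<in>F.Car. E.eqv x y}" using F.Car_facts(2) E.eqv_add by blast
  next
    fix c x assume "x \<in> {x. \<exists>y\<in>F.Car. E.eqv x y}"
    then show "scal c * x \<in> {x. \<exists>y\<in>F.Car. E.eqv x y}" using F.Car_facts(5) E.eqv_left by blast
  qed
  have S2Z: "E.Z \<subseteq> S2" unfolding S2_def using F.Car_facts(1) E.eqv_zero_iff by blast
  have S2a: "S2 \<subseteq> E.augm"
    unfolding S2_def using augm_cong CarFE E.Car_augm by blast
  have VF: "E.eqv (?Vv * y) 0 \<and> E.eqv (y * ?Vv) 0" if y: "y \<in> F.Car" for y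
  proof (rule mon_induct[of "\<lambda>y. E.eqv (?Vv * y) 0 \<and> E.eqv (y * ?Vv) 0"])
    show "fa.subspace {y. E.eqv (?Vv * y) 0 \<and> E.eqv (y * ?Vv) 0}"
      using E.subspace_Z unfolding E.eqv_zero_iff
      by (auto simp: fa.subspace_def distrib_left distrib_right single_Nil_left_commute mult.assoc)
    fix w assume "w \<in> Poly_Mapping.keys y"
    then have w: "w \<noteq> []" "set w \<subseteq> lpa_gens F" using y by (auto simp: F.Car_iff)
    have "E.eqv (?Vv * mon w) 0"
    proof -
      obtain g w' where gw: "w = g # w'" using w by (cases w) auto
      then have "g \<noteq> Vert v" using w gF by auto
      then have "E.eqv (?Vv * mon [g]) 0" using gV(2)[of g] by simp
      from E.eqv_zero_right[OF this, of "mon w'"] show ?thesis by (simp add: gw mon_mult)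
    qed
    moreover have "E.eqv (mon w * ?Vv) 0"
    proof -
      obtain g w' where gw: "w = w' @ [g]" using w by (cases w rule: rev_cases) auto
      then have "g \<noteq> Vert v" using w gF by auto
      then have "E.eqv (mon [g] * ?Vv) 0" using gV(1)[of g] by simp
      from E.eqv_zero_left[OF this, of "mon w'"] show ?thesis by (simp add: gw mon_mult)
    qed
    ultimately show "E.eqv (?Vv * mon w) 0 \<and> E.eqv (mon w * ?Vv) 0" ..
  qed
  have S2g: "mon [g] * x \<in> S2" "x * mon [g] \<in> S2" if x: "x \<in> S2" for g x
  proof -
    obtain y where y: "y \<in> F.Car" "E.eqv x y" using x by (auto simp: S2_def)
    have "E.eqv (mon [g] * y) 0 \<and> E.eqv (y * mon [g]) 0 \<or> mon [g] * y \<in> F.Car \<and> y * mon [g] \<in> F.Car"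
    proof (cases "g \<in> lpa_gens F")
      case True
      then show ?thesis using F.Car_facts(4) F.mon_gen_Car y by blast
    next
      case False
      show ?thesis
      proof (cases "g = Vert v")
        case True
        then show ?thesis using VF[OF y(1)] by blast
      next
        case ne: False
        then have "E.eqv (mon [g]) 0" using False gens by (intro E.notin_gens) auto
        then show ?thesis using E.eqv_zero_left E.eqv_zero_right by blast
      qed
    qed
    then obtain z z' where z: "z \<in> F.Car" "E.eqv (mon [g] * y) z" "z' \<in> F.Car" "E.eqv (y * mon [g]) z'"
      using F.Car_facts(1) E.eqv_refl by blast
    show "mon [g] * x \<in> S2" unfolding S2_def using z(1) E.eqv_trans[OF E.eqv_left[OF y(2)] z(2)] by blast
    show "x * mon [g] \<in> S2" unfolding S2_def using z(3) E.eqv_trans[OF E.eqv_right[OF y(2)] z(4)] by blast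
  qed
  have line: "kline (leavitt K E) (leavitt_gen K E (Vert v)) = E.quot S1"
  proof -
    have k: "cls' \<in> E.quot S1 \<longleftrightarrow> (\<exists>c. cls' = E.cls (scal c * ?Vv))" for cls'
    proof
      assume "cls' \<in> E.quot S1"
      then obtain x c where x: "x \<in> S1" "E.eqv x (scal c * ?Vv)" "cls' = E.cls (E.res x)"
        by (auto simp: E.quot_def S1_def)
      have "E.cls (E.res x) = E.cls (E.res (scal c * ?Vv))"
        using x S1a E.Car_augm[OF E.Car_facts(5)[OF VvC]] E.cls_res_eqv by blast
      then show "\<exists>c. cls' = E.cls (scal c * ?Vv)" using x(3) E.res_Car[OF E.Car_facts(5)[OF VvC]] by auto
    next
      assume "\<exists>c. cls' = E.cls (scal c * ?Vv)"
      then obtain c where c: "cls' = E.cls (E.res (scal c * ?Vv))" using E.res_Car[OF E.Car_facts(5)[OF VvC]] by auto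
      have "scal c * ?Vv \<in> S1" unfolding S1_def using E.eqv_refl by blast
      then show "cls' \<in> E.quot S1" unfolding E.quot_def c by blast
    qed
    show ?thesis
      unfolding kline_def E.leavitt_gen_cls E.leavitt_ops(4)[OF VvC VvC] using k by blast
  qed
  have img: "\<phi> ` kcarrier (leavitt K F) = E.quot S2"
  proof -
    have "\<phi> ` kcarrier (leavitt K F) = E.cls ` F.Car"
      unfolding F.leavitt_carrier image_image using \<phi> by (intro image_cong refl)
    also have "\<dots> = E.quot S2"
    proof (intro subset_antisym subsetI)
      fix X assume "X \<in> E.cls ` F.Car"
      then obtain y where y: "y \<in> F.Car" "X = E.cls y" by blast
      then have "X = E.cls (E.res y)" using CarFE E.res_Car[of y] by auto
      moreover have "y \<in> S2" unfolding S2_def using y(1) E.eqv_refl by blast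
      ultimately show "X \<in> E.quot S2" unfolding E.quot_def by blast
    next
      fix X assume "X \<in> E.quot S2"
      then obtain x y where x: "x \<in> S2" "y \<in> F.Car" "E.eqv x y" "X = E.cls (E.res x)" by (auto simp: E.quot_def S2_def)
      then have "X = E.cls (E.res y)" using S2a CarFE E.Car_augm E.cls_res_eqv by blast
      then have "X = E.cls y" using x(2) CarFE E.res_Car[of y] by auto
      then show "X \<in> E.cls ` F.Car" using x(2) by blast
    qed
    finally show ?thesis .
  qed
  have id1: "kalg_ideal (leavitt K E) (E.quot S1)"
    by (rule E.quot_ideal[OF S1 S1a left_mult_closed[OF S1 S1g(1)] right_mult_closed[OF S1 S1g(2)]])
  have id2: "kalg_ideal (leavitt K E) (E.quot S2)"
    by (rule E.quot_ideal[OF S2 S2a left_mult_closed[OF S2 S2g(1)] right_mult_closed[OF S2 S2g(2)]])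
  interpret L: kalgebra "leavitt K E" by (rule kalgebra_leavitt[OF wf])
  have "ksum (leavitt K E) (E.quot S1) (E.quot S2) = kcarrier (leavitt K E)"
  proof (intro subset_antisym subsetI)
    fix X assume "X \<in> ksum (leavitt K E) (E.quot S1) (E.quot S2)"
    moreover have "E.quot S1 \<subseteq> kcarrier (leavitt K E)" "E.quot S2 \<subseteq> kcarrier (leavitt K E)"
      using id1 id2 by (auto simp: kalg_ideal_def ksubspace_def)
    ultimately show "X \<in> kcarrier (leavitt K E)" unfolding ksum_def using L.add_closed by blast
  next
    fix X assume "X \<in> kcarrier (leavitt K E)"
    then obtain x where x: "x \<in> E.Car" "X = E.cls x" unfolding E.leavitt_carrier by blast
    have "mon [g] \<in> S2" if "g \<in> lpa_gens E" "g \<noteq> Vert v" for g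
      using that gens F.mon_gen_Car[of g] E.eqv_refl unfolding S2_def by blast
    then obtain k where k: "x - scal k * ?Vv \<in> S2"
      using E.augm_line_plus[OF S2 S2Z S2g(1) vE ne(1) _ E.Car_augm[OF x(1)]] by blast
    have "scal k * ?Vv \<in> S1" unfolding S1_def using E.eqv_refl by blast
    then have "E.cls (E.res (scal k * ?Vv)) \<in> E.quot S1" "E.cls (E.res (x - scal k * ?Vv)) \<in> E.quot S2"
      using k unfolding E.quot_def by blast+
    moreover have kV: "scal k * ?Vv \<in> E.Car" and xk: "x - scal k * ?Vv \<in> E.Car"
      using E.Car_facts(3,5) VvC x(1) by blast+
    moreover have "X = kadd (leavitt K E) (E.cls (E.res (scal k * ?Vv))) (E.cls (E.res (x - scal k * ?Vv)))"
      unfolding E.res_Car[OF kV] E.res_Car[OF xk] E.leavitt_ops(1)[OF kV xk] x(2) by simp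
    ultimately show "X \<in> ksum (leavitt K E) (E.quot S1) (E.quot S2)" unfolding ksum_def by blast
  qed
  moreover have "E.quot S1 \<inter> E.quot S2 = {kzero (leavitt K E)}"
  proof (intro subset_antisym subsetI)
    fix X assume "X \<in> E.quot S1 \<inter> E.quot S2"
    then obtain x y where x: "x \<in> S1" "X = E.cls (E.res x)" and y: "y \<in> S2" "X = E.cls (E.res y)"
      unfolding E.quot_def by blast
    have "E.eqv x y" using x y S1a S2a E.cls_res_eqv by blast
    obtain k where k: "E.eqv x (scal k * ?Vv)" using x by (auto simp: S1_def)
    obtain z where z: "z \<in> F.Car" "E.eqv y z" using y by (auto simp: S2_def)
    have zk: "E.eqv z (scal k * ?Vv)"
      using E.eqv_trans[OF E.eqv_sym[OF z(2)] E.eqv_trans[OF E.eqv_sym[OF \<open>E.eqv x y\<close>] k]] .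
    \<comment> \<open>Left multiplication by \<open>?Vv\<close> fixes multiples of
      \<open>?Vv\<close> and kills elements of \<open>F.Car\<close>, so a common element is
      0.\<close>
    have "E.eqv (scal k * ?Vv) (scal k * (?Vv * ?Vv))" using E.eqv_left[OF E.eqv_sym[OF E.VV[of v v]], of "scal k"] by simp
    also have "\<dots> = ?Vv * (scal k * ?Vv)" by (rule single_Nil_left_commute[symmetric])
    also have "E.eqv \<dots> (?Vv * z)" by (rule E.eqv_left[OF E.eqv_sym[OF zk]])
    also have "E.eqv \<dots> 0" using VF[OF z(1)] by blast
    finally have "E.eqv x 0" by (rule E.eqv_trans[OF k])
    then have "E.cls (E.res x) = E.cls (E.res 0)"
      using x S1a fa.subspace_0[OF E.subspace_augm] E.cls_res_eqv by blast
    then show "X \<in> {kzero (leavitt K E)}" using x(2) by (simp add: E.leavitt_zero restr_zero)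
  next
    fix X assume "X \<in> {kzero (leavitt K E)}"
    then show "X \<in> E.quot S1 \<inter> E.quot S2" using id1 id2 by (auto simp: kalg_ideal_def ksubspace_def)
  qed
  ultimately have "kalg_direct_sum (leavitt K E)
      (kline (leavitt K E) (leavitt_gen K E (Vert v))) (\<phi> ` kcarrier (leavitt K F))"
    unfolding kalg_direct_sum_def line img using id1 id2 by blast
  then show ?thesis unfolding leavitt_splits_def using hom gen inj by blast
qed

theorem theorem3p8:
  fixes E :: "('v, 'e) pre_digraph" and K :: "'k::field itself"
  assumes "wf_digraph E"
    and "\<not> commutative_kalg (leavitt K E)"
  shows
    "((\<forall>U. lie_ideal (leavitt K E) U \<longrightarrow> ring_ideal (leavitt K E) U) \<longleftrightarrow>
       (\<exists>p. CHAR('k) = p \<and> p > 0 \<and>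
          (p_commutator_graph p E \<or>
           (\<exists>F v. p_commutator_plus_isolated p E F v) \<or>
           (\<exists>H v. p_commutator_porcupine p E H v)))) \<and>
     (\<forall>p F v. CHAR('k) = p \<and> p > 0 \<and> p_commutator_plus_isolated p E F v \<longrightarrow> leavitt_splits K E F v) \<and>
     (\<forall>p H v. CHAR('k) = p \<and> p > 0 \<and> p_commutator_porcupine p E H v \<longrightarrow>
        kcarrier (leavitt K E) =
          ksum (leavitt K E) (kline (leavitt K E) (leavitt_gen K E (Vert v)))
            (ring_ideal_gen (leavitt K E) ((\<lambda>w. leavitt_gen K E (Vert w)) ` H))) \<and>
     ((\<forall>U. lie_ideal (leavitt K E) U \<longrightarrow> ring_ideal (leavitt K E) U) \<longrightarrow> acyclic_digraph E)"
proof -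
  interpret lpa E K using assms(1) by (simp add: lpa_def)
  let ?R = "\<forall>U. lie_sub U \<longrightarrow> (\<forall>u\<in>U. \<forall>a. u * a \<in> U)"
  let ?C = "p_commutator_graph (CHAR('k)) E \<or> (\<exists>F v. p_commutator_plus_isolated (CHAR('k)) E F v) \<or>
    (\<exists>H v. p_commutator_porcupine (CHAR('k)) E H v)"
  have 1: "CHAR('k) > 0 \<and> ?C" if ?R by (rule necessity[OF _ assms(2)]) (use that in blast)
  have 2: ?R if ?C by (intro allI impI ballI, rule sufficiency[OF that])
  have 3: "acyclic_digraph E" if ?R by (rule necessity_acyclic) (use that in blast)
  show ?thesis
    unfolding all_lie_ideals_ideals_iff
  proof (intro conjI allI impI)
    show "?R \<longleftrightarrow> (\<exists>p. CHAR('k) = p \<and> p > 0 \<and> (p_commutator_graph p E \<or>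
        (\<exists>F v. p_commutator_plus_isolated p E F v) \<or> (\<exists>H v. p_commutator_porcupine p E H v)))"
    proof
      assume ?R
      from 1[OF this] show "\<exists>p. CHAR('k) = p \<and> p > 0 \<and> (p_commutator_graph p E \<or>
        (\<exists>F v. p_commutator_plus_isolated p E F v) \<or> (\<exists>H v. p_commutator_porcupine p E H v))"
        by (intro exI[of _ "CHAR('k)"] conjI) (simp_all only:)
    next
      assume "\<exists>p. CHAR('k) = p \<and> p > 0 \<and> (p_commutator_graph p E \<or>
        (\<exists>F v. p_commutator_plus_isolated p E F v) \<or> (\<exists>H v. p_commutator_porcupine p E H v))"
      then have ?C by (elim exE conjE) (simp only:)
      then show ?R by (rule 2)
    qed
  next
    fix p F v assume "CHAR('k) = p \<and> p > 0 \<and> p_commutator_plus_isolated p E F v"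
    then show "leavitt_splits K E F v"
      by (intro leavitt_splits_isolated[OF assms(1)]) (simp add: p_commutator_plus_isolated_def)
  next
    fix p H v assume "CHAR('k) = p \<and> p > 0 \<and> p_commutator_porcupine p E H v"
    then show "kcarrier (leavitt K E) =
          ksum (leavitt K E) (kline (leavitt K E) (leavitt_gen K E (Vert v)))
            (ring_ideal_gen (leavitt K E) ((\<lambda>w. leavitt_gen K E (Vert w)) ` H))"
      by (intro leavitt_source_sum) (auto simp: p_commutator_porcupine_def)
  qed (rule 3)
qed

end
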